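(* Let $\mathbb{T}^n$ be the $n$-dimensional flat torus, let $T>0$, and let $\frac13\le\alpha<1$ and $\lambda>0$. Let $(u,p)$ be a weak solution of the incompressible Euler equations $$\partial_t u+u\cdot\nabla u+\nabla p=0,\quad \nabla\cdot u=0\ \text{ in }\mathbb{T}^n\times(0,T),$$ and assume that $$u\in L^3\big((0,T);C^{0,\alpha}_{\lambda}(\mathbb{T}^n)\big).$$ Then $$\|u(\cdot,t_2)\|_{L^2(\mathbb{T}^n)}=\|u(\cdot,t_1)\|_{L^2(\mathbb{T}^n)}\qquad\text{for any } t_1,t_2\in(0,T).$$
   Context: Functions on $\mathbb{T}^n$ are identified with periodic functions on $\mathbb{R}^n$. Hölog spaces: for $0\le\alpha<1$ and $\lambda\in\mathbb{R}$, $C^{0,\alpha}_\lambda(\mathbb{T}^n)$ is the set of continuous functions $f$ on $\mathbb{T}^n$ such that $$[f]_{C^{0,\alpha}_\lambda}=\sup_{0<|x-y|<1}\frac{|f(x)-f(y)|}{\left(\log\frac1{|x-y|}\right)^{-\lambda}|x-y|^\alpha}<\infty,$$ with norm $\|f\|_{C^{0,\alpha}_\lambda}=[f]_{C^{0,\alpha}_\lambda}+\sup|f|$. For vector fields the same definition is used. Weak solution: a pair $(u,p)$ with $u\in L^\infty(0,T;L^2(\mathbb{T}^n))$, $p\in L^1_{loc}(\mathbb{T}^n\times(0,T))$, $\nabla\cdot u=0$ in the sense of distributions, and, for every smooth vector field $\psi$ on $\mathbb{T}^n\times(0,T)$ with compact support, $$\int_0^T\int_{\mathbb{T}^n}\Big(u\cdot\partial_t\psi+u\otimes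 u:\nabla\psi+p\,\nabla\cdot\psi\Big)dx\,dt=0,$$ where $u\otimes u:\nabla\psi=\sum_{i,j}u_iu_j\partial_i\psi_j$. Convention: $u$ is identified with its representative that is weakly continuous in time with values in $L^2(\mathbb{T}^n)$, so that $u(\cdot,t)$ is meaningful for every $t\in(0,T)$. *)

theory Defs
  imports "HOL-Analysis.Analysis"
begin

(* The flat torus is R^n / Z^n.  A function on it is a function on real ^ 'n of period 1 in
   every coordinate, and integrals over the torus are integrals over the unit cube. *)

definition periodic :: "(real ^ 'n \<Rightarrow> 'b) \<Rightarrow> bool" where
  "periodic f \<longleftrightarrow> (\<forall>x i. f (x + axis i 1) = f x)"

definition torus_cell :: "(real ^ 'n) set" where
  "torus_cell = cbox 0 (\<chi> i. 1)"

definition torus_integral :: "(real ^ 'n \<Rightarrow> real) \<Rightarrow> real" where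
  "torus_integral f = (LINT x:torus_cell|lborel. f x)"

definition torus_L2 :: "(real ^ 'n \<Rightarrow> 'b::euclidean_space) set" where
  "torus_L2 = {f. periodic f \<and> f \<in> borel_measurable borel \<and>
                  set_integrable lborel torus_cell (\<lambda>x. (norm (f x))\<^sup>2)}"

definition torus_L2_norm :: "(real ^ 'n \<Rightarrow> 'b::euclidean_space) \<Rightarrow> real" where
  "torus_L2_norm f = sqrt (torus_integral (\<lambda>x. (norm (f x))\<^sup>2))"


definition holog_quotient ::
  "real \<Rightarrow> real \<Rightarrow> (real ^ 'n \<Rightarrow> 'b::real_normed_vector) \<Rightarrow> (real ^ 'n) \<times> (real ^ 'n) \<Rightarrow> real" where
  "holog_quotient \<alpha> lam f = (\<lambda>(x, y).
     norm (f x - f y) / (ln (1 / norm (x - y)) powr (- lam) * norm (x - y) powr \<alpha>))"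

definition near_pairs :: "((real ^ 'n) \<times> (real ^ 'n)) set" where
  "near_pairs = {(x, y). 0 < norm (x - y) \<and> norm (x - y) < 1}"

definition holog_space :: "real \<Rightarrow> real \<Rightarrow> (real ^ 'n \<Rightarrow> 'b::real_normed_vector) set" where
  "holog_space \<alpha> lam = {f. periodic f \<and> continuous_on UNIV f \<and>
                           bdd_above (holog_quotient \<alpha> lam f ` near_pairs)}"

definition holog_seminorm :: "real \<Rightarrow> real \<Rightarrow> (real ^ 'n \<Rightarrow> 'b::real_normed_vector) \<Rightarrow> real" where
  "holog_seminorm \<alpha> lam f = (SUP z\<in>near_pairs. holog_quotient \<alpha> lam f z)"

definition holog_norm :: "real \<Rightarrow> real \<Rightarrow> (real ^ 'n \<Rightarrow> 'b::real_normed_vector) \<Rightarrow> real" where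
  "holog_norm \<alpha> lam f = holog_seminorm \<alpha> lam f + (SUP x. norm (f x))"


(* Elements of the spaces of functions of time below are represented by pointwise defined
   functions u t x, which matter only for t in (0,T).  As L^2 is separable, Bochner
   measurability with values in L^2 amounts to the existence of a jointly measurable
   representative. *)

definition Linf_L2 :: "real \<Rightarrow> (real \<Rightarrow> real ^ 'n \<Rightarrow> 'b::euclidean_space) set" where
  "Linf_L2 T = {u. (\<forall>t\<in>{0<..<T}. periodic (u t)) \<and>
     set_borel_measurable borel (UNIV \<times> {0<..<T}) (\<lambda>(x, t). u t x) \<and>
     (\<exists>C. AE t\<in>{0<..<T} in lborel. u t \<in> torus_L2 \<and> torus_L2_norm (u t) \<le> C)}"

definition L1_loc :: "real \<Rightarrow> (real \<Rightarrow> real ^ 'n \<Rightarrow> real) set" where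
  "L1_loc T = {p. (\<forall>t\<in>{0<..<T}. periodic (p t)) \<and>
     (\<forall>K. compact K \<and> K \<subseteq> UNIV \<times> {0<..<T} \<longrightarrow> set_integrable lborel K (\<lambda>(x, t). p t x))}"

(* Membership concerns the class of u: almost every u t agrees almost everywhere with an
   element w t of the Hoelog space.  Only the norm is required to be measurable in time;
   strong measurability into this non-separable space is not demanded. *)

definition Lq_holog ::
  "nat \<Rightarrow> real \<Rightarrow> real \<Rightarrow> real \<Rightarrow> (real \<Rightarrow> real ^ 'n \<Rightarrow> 'b::euclidean_space) set" where
  "Lq_holog q T \<alpha> lam = {u. \<exists>w.
     (AE t\<in>{0<..<T} in lborel. w t \<in> holog_space \<alpha> lam \<and> (AE x in lborel. u t x = w t x)) \<and>
     set_integrable lborel {0<..<T} (\<lambda>t. holog_norm \<alpha> lam (w t) ^ q)}"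


primrec Ck_on :: "nat \<Rightarrow> 'a::real_normed_vector set \<Rightarrow> ('a \<Rightarrow> 'b::real_normed_vector) \<Rightarrow> bool" where
  "Ck_on 0 S f \<longleftrightarrow> continuous_on S f"
| "Ck_on (Suc k) S f \<longleftrightarrow> (\<forall>z\<in>S. f differentiable (at z)) \<and>
     (\<forall>v. Ck_on k S (\<lambda>z. frechet_derivative f (at z) v))"

definition smooth_on :: "'a::real_normed_vector set \<Rightarrow> ('a \<Rightarrow> 'b::real_normed_vector) \<Rightarrow> bool" where
  "smooth_on S f \<longleftrightarrow> (\<forall>k. Ck_on k S f)"

(* The torus being compact, compact support in T^n x (0,T) is a condition on time only. *)

definition test_function :: "real \<Rightarrow> ((real ^ 'n) \<times> real \<Rightarrow> 'b::euclidean_space) \<Rightarrow> bool" where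
  "test_function T \<psi> \<longleftrightarrow>
     smooth_on (UNIV \<times> {0<..<T}) \<psi> \<and>
     (\<forall>t\<in>{0<..<T}. periodic (\<lambda>x. \<psi> (x, t))) \<and>
     (\<exists>K. compact K \<and> K \<subseteq> {0<..<T} \<and> (\<forall>x. \<forall>t\<in>{0<..<T} - K. \<psi> (x, t) = 0))"

definition dt :: "((real ^ 'n) \<times> real \<Rightarrow> 'b::euclidean_space) \<Rightarrow> real ^ 'n \<Rightarrow> real \<Rightarrow> 'b" where
  "dt \<psi> x t = frechet_derivative \<psi> (at (x, t)) (0, 1)"

definition dx :: "'n \<Rightarrow> ((real ^ 'n) \<times> real \<Rightarrow> 'b::euclidean_space) \<Rightarrow> real ^ 'n \<Rightarrow> real \<Rightarrow> 'b" where
  "dx i \<psi> x t = frechet_derivative \<psi> (at (x, t)) (axis i 1, 0)"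

definition weakly_div_free :: "real \<Rightarrow> (real \<Rightarrow> real ^ 'n \<Rightarrow> real ^ 'n) \<Rightarrow> bool" where
  "weakly_div_free T u \<longleftrightarrow>
     (\<forall>\<phi> :: (real ^ 'n) \<times> real \<Rightarrow> real. test_function T \<phi> \<longrightarrow>
        (LINT t:{0<..<T}|lborel. torus_integral (\<lambda>x. \<Sum>i\<in>UNIV. u t x $ i * dx i \<phi> x t)) = 0)"

definition weak_euler_solution ::
  "real \<Rightarrow> (real \<Rightarrow> real ^ 'n \<Rightarrow> real ^ 'n) \<Rightarrow> (real \<Rightarrow> real ^ 'n \<Rightarrow> real) \<Rightarrow> bool" where
  "weak_euler_solution T u p \<longleftrightarrow>
     u \<in> Linf_L2 T \<and> p \<in> L1_loc T \<and> weakly_div_free T u \<and>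
     (\<forall>\<psi> :: (real ^ 'n) \<times> real \<Rightarrow> real ^ 'n. test_function T \<psi> \<longrightarrow>
        (LINT t:{0<..<T}|lborel. torus_integral (\<lambda>x.
            u t x \<bullet> dt \<psi> x t
          + (\<Sum>i\<in>UNIV. \<Sum>j\<in>UNIV. u t x $ i * u t x $ j * dx i \<psi> x t $ j)
          + p t x * (\<Sum>i\<in>UNIV. dx i \<psi> x t $ i))) = 0)"

definition weakly_continuous_representative ::
  "real \<Rightarrow> (real \<Rightarrow> real ^ 'n \<Rightarrow> real ^ 'n) \<Rightarrow> (real \<Rightarrow> real ^ 'n \<Rightarrow> real ^ 'n) \<Rightarrow> bool" where
  "weakly_continuous_representative T u v \<longleftrightarrow>
     (AE t\<in>{0<..<T} in lborel. AE x in lborel. v t x = u t x) \<and>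
     (\<forall>t\<in>{0<..<T}. v t \<in> torus_L2) \<and>
     (\<forall>\<phi>\<in>torus_L2. continuous_on {0<..<T} (\<lambda>t. torus_integral (\<lambda>x. v t x \<bullet> \<phi> x)))"

end

theory Submission imports Defs
begin

text \<open>The kinetic energy is followed through a mollification in space, and the defect of its conservation is
cubic in the oscillation of the velocity. Let \<open>k\<close> be a smooth, even, nonnegative periodic kernel supported
within distance \<open>e\<close> of the integer lattice, with mass \<open>A\<close>, and let \<open>E(s,t)\<close> be the integral of
\<open>k(x - y) v(s,x) \<bullet> v(t,y)\<close> over pairs of points of the torus (\<open>energy_pairing\<close>). With \<open>t\<close> frozen, the
weak formulation gives the increments of \<open>E\<close> in \<open>s\<close> as integrals of a flux (\<open>energy_pairing_increment\<close>):
after integration against \<open>v(t,y)\<close> the pressure meets the gradient of \<open>k(x - y)\<close> in \<open>y\<close>, to which the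
divergence-free field \<open>v(t)\<close> is orthogonal, and so it disappears. As \<open>E\<close> is symmetric, \<open>E(b,b) - E(a,a)\<close> is a
sum of such increments over any partition of \<open>[a,b]\<close>; since \<open>v\<close> is weakly continuous in time the flux is
continuous in \<open>t\<close>, and in the limit of fine partitions only its diagonal values matter
(\<open>diagonal_flux_bound\<close>).

On the diagonal the flux is, up to the factor \<open>-1/4\<close>, the integral of
\<open>(\<nabla>k(x - y) \<bullet> (v(x) - v(y))) |v(x) - v(y)|\<^sup>2\<close>, an identity of Duchon and Robert
(\<open>third_order_flux_bound\<close>). The gradient of \<open>k\<close> has mass of order \<open>A/e\<close> (\<open>dkern_mass_le_kern_mass\<close>) and at
almost every time \<open>v\<close> oscillates at distance \<open>e\<close> by at most \<open>K e\<^bsup>1/3\<^esup> (log (1/e))\<^bsup>-\<lambda>\<^esup>\<close>, where \<open>K\<close>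
is the Hoelog norm (\<open>holog_oscillation\<close>). The powers of \<open>e\<close> cancel: the flux is at most a constant times
\<open>A K\<^sup>3 (log (1/e))\<^bsup>-3\<lambda>\<^esup>\<close>. As \<open>K\<^sup>3\<close> is integrable in time, \<open>E(b,b)/A - E(a,a)/A\<close> tends to zero with \<open>e\<close>
(\<open>mollified_energy_increment\<close>).

It remains to compare \<open>E(t,t)/A\<close> with the squared norm of \<open>v(t)\<close>. It never exceeds it, and it converges to it
when \<open>v(t)\<close> is continuous, hence at almost every time. Therefore at almost every \<open>s\<close> the energy is at most
the energy at an arbitrary time \<open>t\<close> (\<open>energy_minimal_at_regular_times\<close>). Weak lower semicontinuity of the norm
extends this inequality from almost every \<open>s\<close> to every \<open>s\<close> (\<open>energy_le_of_AE\<close>), and exchanging the two times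
gives equality.\<close>

section \<open>Smooth functions and a smooth step\<close>

lemma Ck_on_SucD: "Ck_on (Suc k) S f \<Longrightarrow> Ck_on k S f"
proof (induction k arbitrary: f)
  case 0
  then show ?case
    by (auto intro!: continuous_at_imp_continuous_on differentiable_imp_continuous_within)
next
  case (Suc k)
  have "Ck_on k S (\<lambda>z. frechet_derivative f (at z) v)" for v
    using Suc.prems by (intro Suc.IH) (simp add: Ck_on.simps(2))
  then show ?case
    using Suc.prems by (simp add: Ck_on.simps(2))
qed

lemma Ck_on_subset: "Ck_on k S f \<Longrightarrow> R \<subseteq> S \<Longrightarrow> Ck_on k R f"
  by (induction k arbitrary: f) (auto intro: continuous_on_subset)

text \<open>A derivative given at every point of the space is the one that \<open>frechet_derivative\<close> chooses, so the
usual differentiation rules prove \<open>Ck_on\<close> by induction on the order.\<close>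
lemma Ck_on_SucI:
  assumes "\<And>z. (f has_derivative f' z) (at z)" "\<And>v. Ck_on k UNIV (\<lambda>z. f' z v)"
  shows "Ck_on (Suc k) UNIV f"
proof -
  have "frechet_derivative f (at z) = f' z" for z
    using frechet_derivative_at[OF assms(1)] by simp
  then show ?thesis
    using assms by (auto simp: differentiable_def)
qed

lemma Ck_on_Suc_has_derivative:
  assumes "Ck_on (Suc k) UNIV f"
  shows "(f has_derivative frechet_derivative f (at z)) (at z)"
  using assms by (simp add: frechet_derivative_works)

lemma Ck_on_Suc_frechet:
  "Ck_on (Suc k) UNIV f \<Longrightarrow> Ck_on k UNIV (\<lambda>z. frechet_derivative f (at z) v)"
  by simp

lemma Ck_on_const: "Ck_on k UNIV (\<lambda>z. c)"
proof (induction k arbitrary: c)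
  case (Suc k)
  show ?case by (rule Ck_on_SucI[where f' = "\<lambda>_ _. 0"]) (auto intro: Suc)
qed simp

lemma Ck_on_linear:
  assumes "bounded_linear f"
  shows "Ck_on k UNIV f"
proof (cases k)
  case 0
  then show ?thesis using assms by (simp add: linear_continuous_on)
next
  case (Suc m)
  then show ?thesis
    unfolding Suc using assms
    by (intro Ck_on_SucI[where f' = "\<lambda>_. f"] Ck_on_const bounded_linear_imp_has_derivative)
qed

lemma Ck_on_add:
  "Ck_on k UNIV f \<Longrightarrow> Ck_on k UNIV g \<Longrightarrow> Ck_on k UNIV (\<lambda>z. f z + g z)"
proof (induction k arbitrary: f g)
  case 0
  then show ?case by (auto intro: continuous_on_add)
next
  case (Suc k)
  show ?case
    by (rule Ck_on_SucI[OF has_derivative_add[OF Suc.prems[THEN Ck_on_Suc_has_derivative]]])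
      (intro Suc.IH Suc.prems[THEN Ck_on_Suc_frechet])
qed

lemma Ck_on_mult:
  fixes f g :: "'a::real_normed_vector \<Rightarrow> real"
  shows "Ck_on k UNIV f \<Longrightarrow> Ck_on k UNIV g \<Longrightarrow> Ck_on k UNIV (\<lambda>z. f z * g z)"
proof (induction k arbitrary: f g)
  case 0
  then show ?case by (auto intro: continuous_on_mult)
next
  case (Suc k)
  show ?case
    by (rule Ck_on_SucI[OF has_derivative_mult[OF Suc.prems[THEN Ck_on_Suc_has_derivative]]])
      (intro Ck_on_add Suc.IH Suc.prems[THEN Ck_on_Suc_frechet] Suc.prems[THEN Ck_on_SucD])
qed

lemma Ck_on_sum:
  assumes "finite I" "\<And>i. i \<in> I \<Longrightarrow> Ck_on k UNIV (f i)"
  shows "Ck_on k UNIV (\<lambda>z. \<Sum>i\<in>I. f i z)"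
  using assms by (induction I) (auto intro: Ck_on_const Ck_on_add)

lemma Ck_on_linear_comp:
  assumes "bounded_linear h"
  shows "Ck_on k UNIV f \<Longrightarrow> Ck_on k UNIV (\<lambda>z. h (f z))"
proof (induction k arbitrary: f)
  case 0
  then show ?case
    using assms by (auto intro: bounded_linear.continuous_on)
next
  case (Suc k)
  show ?case
    by (rule Ck_on_SucI[OF bounded_linear.has_derivative[OF assms Ck_on_Suc_has_derivative[OF Suc.prems]]])
      (intro Suc.IH Suc.prems[THEN Ck_on_Suc_frechet])
qed

text \<open>For a scalar outer function the chain rule is a product of two functions of one order less, so
\<open>Ck_on_mult\<close> closes the induction.\<close>
lemma Ck_on_comp:
  fixes h :: "real \<Rightarrow> real" and g :: "'a::real_normed_vector \<Rightarrow> real"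
  shows "Ck_on k UNIV h \<Longrightarrow> Ck_on k UNIV g \<Longrightarrow> Ck_on k UNIV (\<lambda>z. h (g z))"
proof (induction k arbitrary: h g)
  case 0
  then show ?case using continuous_on_compose2[of UNIV h UNIV g] by simp
next
  case (Suc k)
  have "((\<lambda>z. h (g z)) has_derivative
      (\<lambda>v. frechet_derivative h (at (g z)) 1 * frechet_derivative g (at z) v)) (at z)" for z
  proof -
    have d: "(h has_derivative frechet_derivative h (at (g z))) (at (g z))"
      using Suc.prems(1) by (rule Ck_on_Suc_has_derivative)
    have lin: "frechet_derivative h (at (g z)) x = frechet_derivative h (at (g z)) 1 * x" for x
      using linear_cmul[OF has_derivative_linear[OF d], of x 1]
      by (simp only: real_scaleR_def mult_1_right mult_1_left mult.commute)
    show ?thesis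
      by (rule has_derivative_eq_rhs[OF has_derivative_compose[OF
            Ck_on_Suc_has_derivative[OF Suc.prems(2)] d]]) (rule ext, rule lin)
  qed
  then show ?case
    by (rule Ck_on_SucI)
      (rule Ck_on_mult[OF Suc.IH[OF Ck_on_Suc_frechet[OF Suc.prems(1)] Ck_on_SucD[OF Suc.prems(2)]]
          Ck_on_Suc_frechet[OF Suc.prems(2)]])
qed

lemma Ck_on_real_SucI:
  fixes h :: "real \<Rightarrow> real"
  assumes "\<And>x. (h has_real_derivative h' x) (at x)" "Ck_on k UNIV h'"
  shows "Ck_on (Suc k) UNIV h"
  by (rule Ck_on_SucI[OF assms(1)[unfolded has_field_derivative_def]])
    (intro Ck_on_mult assms(2) Ck_on_const)

lemma Ck_on_cos: "Ck_on k UNIV (cos :: real \<Rightarrow> real)"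
proof -
  have "Ck_on k UNIV (\<lambda>x::real. cos (x + c))" for c
  proof (induction k arbitrary: c)
    case 0
    then show ?case by (auto intro!: continuous_intros)
  next
    case (Suc k)
    have "cos (x + (c + pi / 2)) = - sin (x + c)" for x
      using cos_add[of "x + c" "pi / 2"] by (simp add: add.assoc)
    then have "((\<lambda>x. cos (x + c)) has_real_derivative cos (x + (c + pi / 2))) (at x)" for x
      by (auto intro!: derivative_eq_intros)
    then show ?case
      by (rule Ck_on_real_SucI) (rule Suc)
  qed
  from this[of 0] show ?thesis by simp
qed


text \<open>The polynomial factor makes the family closed under differentiation; \<open>flat 1\<close> is the classical function
\<open>exp (- 1 / x)\<close>, which vanishes to infinite order at 0.\<close>
definition flat :: "real poly \<Rightarrow> real \<Rightarrow> real" where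
  "flat P x = (if x > 0 then poly P (1 / x) * exp (- (1 / x)) else 0)"

lemma poly_times_exp_tendsto_0: "((\<lambda>y::real. poly P y * exp (- y)) \<longlongrightarrow> 0) at_top"
proof -
  have *: "((\<lambda>y::real. \<Sum>i\<le>degree P. coeff P i * (y ^ i / exp y)) \<longlongrightarrow> (\<Sum>i\<le>degree P. coeff P i * 0)) at_top"
    by (intro tendsto_intros tendsto_power_div_exp_0)
  have "(\<lambda>y. poly P y * exp (- y)) = (\<lambda>y. \<Sum>i\<le>degree P. coeff P i * (y ^ i / exp y))"
    by (simp add: poly_altdef sum_distrib_right exp_minus divide_inverse mult.assoc)
  then show ?thesis using * by simp
qed

text \<open>With \<open>y = 1 / x\<close> the derivative of \<open>P(y) exp(-y)\<close> is \<open>y\<^sup>2 (P(y) - P'(y)) exp(-y)\<close>. At 0 the difference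
quotient is again a polynomial in \<open>y\<close> times \<open>exp(-y)\<close>, with one more factor \<open>y\<close>, and tends to 0.\<close>
lemma has_real_derivative_flat:
  "(flat P has_real_derivative flat ([:0, 0, 1:] * (P - pderiv P)) x) (at x)"
proof -
  consider "x > 0" | "x < 0" | "x = 0" by linarith
  then show ?thesis
  proof cases
    case 1
    have 1: "((\<lambda>x. poly P (1 / x)) has_real_derivative poly (pderiv P) (1 / x) * (- (1 / x) * (1 / x))) (at x)"
      using 1 by (auto intro!: DERIV_chain2[OF poly_DERIV] derivative_eq_intros)
    have 2: "((\<lambda>x. exp (- (1 / x))) has_real_derivative exp (- (1 / x)) * ((1 / x) * (1 / x))) (at x)"
      using \<open>x > 0\<close> by (auto intro!: derivative_eq_intros)
    have "((\<lambda>x. poly P (1 / x) * exp (- (1 / x))) has_real_derivative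
        flat ([:0, 0, 1:] * (P - pderiv P)) x) (at x)"
      by (rule DERIV_cong[OF DERIV_mult[OF 1 2]])
        (use \<open>x > 0\<close> in \<open>simp add: flat_def algebra_simps\<close>)
    moreover have "eventually (\<lambda>y. poly P (1 / y) * exp (- (1 / y)) = flat P y) (nhds x)"
      using eventually_nhds_in_open[of "{0<..}" x] \<open>x > 0\<close>
      by (auto elim!: eventually_mono simp: flat_def)
    ultimately show ?thesis
      using DERIV_cong_ev[OF refl _ refl] by fast
  next
    case 2
    have "eventually (\<lambda>y. 0 = flat P y) (nhds x)"
      using eventually_nhds_in_open[of "{..<0}" x] 2
      by (auto elim!: eventually_mono simp: flat_def)
    moreover have "((\<lambda>x. 0) has_real_derivative 0) (at x)" by simp
    ultimately show ?thesis
      using 2 DERIV_cong_ev[of x x "\<lambda>_. 0" "flat P" 0 0] by (simp add: flat_def)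
  next
    case 3
    have "((\<lambda>h. flat P h / h) \<longlongrightarrow> 0) (at_right 0)"
    proof -
      have lim: "((\<lambda>h::real. poly (pCons 0 P) (1 / h) * exp (- (1 / h))) \<longlongrightarrow> 0) (at_right 0)"
        using filterlim_compose[OF poly_times_exp_tendsto_0[of "pCons 0 P"]
            filterlim_inverse_at_top_right] by (simp add: inverse_eq_divide)
      show ?thesis
        by (rule Lim_transform_eventually[OF lim])
          (auto simp: flat_def eventually_at_filter)
    qed
    moreover have "((\<lambda>h. flat P h / h) \<longlongrightarrow> 0) (at_left 0)"
      by (rule Lim_transform_eventually[OF tendsto_const[of 0]])
        (auto simp: flat_def eventually_at_filter)
    ultimately have "((\<lambda>h. flat P h / h) \<longlongrightarrow> 0) (at 0)"
      by (intro filterlim_split_at)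
    then show ?thesis
      using 3 by (simp add: DERIV_def flat_def)
  qed
qed

lemma Ck_on_flat: "Ck_on k UNIV (flat P)"
proof (induction k arbitrary: P)
  case 0
  have "isCont (flat P) x" for x using has_real_derivative_flat by (rule DERIV_isCont)
  then show ?case by (simp add: continuous_at_imp_continuous_on)
next
  case (Suc k)
  show ?case by (rule Ck_on_real_SucI[OF has_real_derivative_flat Suc])
qed

lemma continuous_flat: "continuous_on S f \<Longrightarrow> continuous_on S (\<lambda>x. flat P (f x))"
  using continuous_on_compose2[of UNIV "flat P" S f] Ck_on_flat[of 0 P] by simp

abbreviation expflat :: "real \<Rightarrow> real" where "expflat \<equiv> flat 1"
abbreviation dexpflat :: "real \<Rightarrow> real" where "dexpflat \<equiv> flat [:0, 0, 1:]"

lemma DERIV_expflat: "(expflat has_real_derivative dexpflat x) (at x)"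
  using has_real_derivative_flat[of 1 x] by simp

lemma expflat_nonneg: "0 \<le> expflat x" by (simp add: flat_def)

lemma expflat_mono:
  assumes "x \<le> y"
  shows "expflat x \<le> expflat y"
proof (cases "x > 0")
  case True
  then have "1 / y \<le> 1 / x" using assms by (intro divide_left_mono) auto
  then show ?thesis using True assms by (simp add: flat_def)
qed (simp add: flat_def)

lemma expflat_le_0_iff: "expflat x = 0 \<longleftrightarrow> x \<le> 0" by (simp add: flat_def)

lemma dexpflat_nonneg: "0 \<le> dexpflat x" by (simp add: flat_def)

lemma dexpflat_le_2: "dexpflat x \<le> 2"
proof (cases "x > 0")
  case True
  define y where "y = 1 / x"
  have "0 < y" using True by (simp add: y_def)
  then have "y * y \<le> 2 * exp y"
    using exp_lower_Taylor_quadratic[of y] unfolding power2_eq_square by linarith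
  then have "y * y / exp y \<le> 2"
    by (simp add: pos_divide_le_eq)
  then show ?thesis
    using True by (simp add: flat_def exp_minus divide_inverse y_def)
qed (simp add: flat_def)

text \<open>A smooth step in closed form, by nesting the flat function: for \<open>t \<le> 0\<close> the inner term is at least 1 and
the outer argument is nonpositive, while for \<open>t \<ge> 1\<close> the inner term is 0 and \<open>expflat 1 = exp (-1)\<close>.\<close>
definition step :: "real \<Rightarrow> real" where
  "step t = exp 1 * expflat (1 - exp 1 * expflat (1 - t))"

lemma step_0: "t \<le> 0 \<Longrightarrow> step t = 0"
proof -
  assume "t \<le> 0"
  then have "expflat 1 \<le> expflat (1 - t)" by (intro expflat_mono) auto
  then have "exp 1 * expflat 1 \<le> exp 1 * expflat (1 - t)" by simp
  moreover have "exp 1 * expflat 1 = 1" by (simp add: flat_def exp_minus)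
  ultimately show ?thesis by (simp add: step_def expflat_le_0_iff)
qed

lemma step_1: "t \<ge> 1 \<Longrightarrow> step t = 1"
  by (simp add: step_def flat_def exp_minus)

lemma step_mono: "s \<le> t \<Longrightarrow> step s \<le> step t"
  unfolding step_def
  by (intro expflat_mono mult_left_mono diff_left_mono exp_ge_zero) simp

lemma Ck_on_step: "Ck_on k UNIV step"
proof -
  have "Ck_on k UNIV (\<lambda>t. exp 1 * expflat (1 + (- exp 1) * expflat (1 + (-1) * t)))"
    by (intro Ck_on_mult Ck_on_const Ck_on_comp[OF Ck_on_flat] Ck_on_add
        Ck_on_linear[of "\<lambda>t. t"] bounded_linear_ident)
  then show ?thesis by (simp add: step_def[abs_def])
qed


section \<open>A periodic mollifier\<close>

text \<open>Near the integer lattice this is comparable with the squared distance to it. It is smooth and periodic, so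
functions of it need no periodization.\<close>
definition cosdist :: "real ^ 'n \<Rightarrow> real" where
  "cosdist z = (\<Sum>i\<in>UNIV. 1 - cos (2 * pi * z $ i))"

definition kern :: "real \<Rightarrow> real ^ 'n \<Rightarrow> real" where
  "kern e z = expflat (1 - cosdist z / e\<^sup>2)"

text \<open>The partial derivative of \<open>kern e\<close> in direction \<open>i\<close>.\<close>
definition dkern :: "real \<Rightarrow> 'n \<Rightarrow> real ^ 'n \<Rightarrow> real" where
  "dkern e i z = dexpflat (1 - cosdist z / e\<^sup>2) * (- (2 * pi * sin (2 * pi * z $ i)) / e\<^sup>2)"

lemma has_derivative_cosdist:
  "(cosdist has_derivative (\<lambda>v. \<Sum>i\<in>UNIV. 2 * pi * sin (2 * pi * z $ i) * v $ i)) (at z)"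
proof -
  have "((\<lambda>z. 1 - cos (2 * pi * z $ i)) has_derivative (\<lambda>v. 2 * pi * sin (2 * pi * z $ i) * v $ i)) (at z)" for i
    by (auto intro!: derivative_eq_intros bounded_linear.has_derivative[OF bounded_linear_vec_nth]
        simp: mult_ac)
  then show ?thesis
    unfolding cosdist_def[abs_def] by (intro has_derivative_sum)
qed

lemma has_derivative_kern:
  "(kern e has_derivative (\<lambda>v. \<Sum>i\<in>UNIV. dkern e i z * v $ i)) (at z)"
proof -
  have "((\<lambda>z. 1 - cosdist z / e\<^sup>2) has_derivative
      (\<lambda>v. 0 - (\<Sum>i\<in>UNIV. 2 * pi * sin (2 * pi * z $ i) * v $ i) / e\<^sup>2)) (at z)"
    by (intro has_derivative_diff has_derivative_const bounded_linear.has_derivative[OF bounded_linear_divide] has_derivative_cosdist)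
  from DERIV_compose_FDERIV[OF DERIV_expflat this]
  have "(kern e has_derivative
      (\<lambda>v. (0 - (\<Sum>i\<in>UNIV. 2 * pi * sin (2 * pi * z $ i) * v $ i) / e\<^sup>2) *
         dexpflat (1 - cosdist z / e\<^sup>2))) (at z)"
    unfolding kern_def[abs_def] .
  moreover have "(0 - (\<Sum>i\<in>UNIV. 2 * pi * sin (2 * pi * z $ i) * v $ i) / e\<^sup>2) *
         dexpflat (1 - cosdist z / e\<^sup>2) = (\<Sum>i\<in>UNIV. dkern e i z * v $ i)" for v
    unfolding dkern_def
    by (simp add: sum_distrib_left sum_distrib_right sum_divide_distrib sum_negf[symmetric] mult_ac)
  ultimately show ?thesis by simp
qed

lemma has_derivative_kern_shift:
  "((\<lambda>x. kern e (x - y)) has_derivative (\<lambda>v. \<Sum>i\<in>UNIV. dkern e i (x - y) * v $ i)) (at x)"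
proof -
  have "((\<lambda>x. x - y) has_derivative (\<lambda>v. v)) (at x)"
    by (auto intro!: derivative_eq_intros)
  from has_derivative_compose[OF this has_derivative_kern[of e "x - y"]] show ?thesis .
qed

lemma Ck_on_kern_shift: "Ck_on k UNIV (\<lambda>x. kern e (x - y))"
proof -
  have a: "Ck_on k UNIV (\<lambda>x. 2 * pi * (x - y) $ i)" for i
  proof -
    have "Ck_on k UNIV (\<lambda>x::real^'a. (- (2 * pi * y $ i)) + 2 * pi * x $ i)"
      by (intro Ck_on_add Ck_on_const Ck_on_mult[OF Ck_on_const] Ck_on_linear bounded_linear_vec_nth)
    then show ?thesis by (simp add: algebra_simps)
  qed
  have "Ck_on k UNIV (\<lambda>x. 1 + (-1) * cos (2 * pi * (x - y) $ i))" for i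
    by (rule Ck_on_add[OF Ck_on_const Ck_on_mult[OF Ck_on_const Ck_on_comp[OF Ck_on_cos a]]])
  then have "Ck_on k UNIV (\<lambda>x. 1 + (- 1 / e\<^sup>2) * (\<Sum>i\<in>UNIV. 1 + (-1) * cos (2 * pi * (x - y) $ i)))"
    by (rule Ck_on_add[OF Ck_on_const Ck_on_mult[OF Ck_on_const Ck_on_sum[OF finite]]])
  then have "Ck_on k UNIV (\<lambda>x. expflat (1 + (- 1 / e\<^sup>2) * (\<Sum>i\<in>UNIV. 1 + (-1) * cos (2 * pi * (x - y) $ i))))"
    by (rule Ck_on_comp[OF Ck_on_flat])
  then show ?thesis by (simp add: kern_def cosdist_def)
qed

lemma continuous_kern [continuous_intros]:
  assumes "continuous_on S f"
  shows "continuous_on S (\<lambda>x. kern e (f x))"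
proof -
  have "continuous_on UNIV (kern e)"
    using has_derivative_kern by (intro continuous_at_imp_continuous_on ballI has_derivative_continuous)
  then show ?thesis using assms continuous_on_compose2 by blast
qed

lemma continuous_dkern [continuous_intros]:
  fixes f :: "'a::t2_space \<Rightarrow> real ^ 'n"
  assumes "continuous_on S f"
  shows "continuous_on S (\<lambda>x. dkern e i (f x))"
proof -
  show ?thesis
    unfolding dkern_def cosdist_def divide_inverse by (intro continuous_intros continuous_flat assms)
qed

lemma cos_sin_diff_swap:
  "cos (2 * pi * (y - x) $ i) = cos (2 * pi * (x - y) $ i)"
  "sin (2 * pi * (y - x) $ i) = - sin (2 * pi * (x - y) $ i)"
proof -
  have e: "2 * pi * (y - x) $ i = - (2 * pi * (x - y) $ i)" by (simp add: algebra_simps)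
  show "cos (2 * pi * (y - x) $ i) = cos (2 * pi * (x - y) $ i)"
    "sin (2 * pi * (y - x) $ i) = - sin (2 * pi * (x - y) $ i)"
    unfolding e by (simp_all only: cos_minus sin_minus)
qed

lemma cosdist_even: "cosdist (y - x) = cosdist (x - y)"
  unfolding cosdist_def by (simp only: cos_sin_diff_swap(1)[of y x])

lemma kern_even: "kern e (y - x) = kern e (x - y)"
  unfolding kern_def by (simp only: cosdist_even[of y x])

lemma dkern_odd: "dkern e i (y - x) = - dkern e i (x - y)"
  unfolding dkern_def by (simp add: cosdist_even[of y x] cos_sin_diff_swap(2)[of y x] del: vector_minus_component)

lemma cos_sin_axis_shift:
  "cos (2 * pi * (z + axis i 1) $ j) = cos (2 * pi * z $ j)"
  "sin (2 * pi * (z + axis i 1) $ j) = sin (2 * pi * z $ j)"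
proof -
  have "2 * pi * (z + axis i 1) $ j = 2 * pi * z $ j + (if j = i then 2 * pi else 0)"
    by (simp add: axis_def algebra_simps)
  then show "cos (2 * pi * (z + axis i 1) $ j) = cos (2 * pi * z $ j)"
    "sin (2 * pi * (z + axis i 1) $ j) = sin (2 * pi * z $ j)"
    by simp_all
qed

lemma periodic_kern: "periodic (kern e)" and periodic_dkern: "periodic (dkern e i)"
  unfolding periodic_def kern_def dkern_def cosdist_def cos_sin_axis_shift by simp_all

lemma periodic_shift: "periodic f \<Longrightarrow> periodic (\<lambda>x. f (x + a))"
proof -
  assume f: "periodic f"
  have "f (x + axis i 1 + a) = f (x + a)" for x i
    using f[unfolded periodic_def, rule_format, of "x + a" i] by (simp add: add_ac)
  then show ?thesis by (simp add: periodic_def)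
qed

lemma periodic_kern_shift: "periodic (\<lambda>x. kern e (x - y))"
  using periodic_shift[OF periodic_kern, of e "- y"] by simp

lemma periodic_dkern_shift: "periodic (\<lambda>x. dkern e i (x - y))"
  using periodic_shift[OF periodic_dkern, of e i "- y"] by simp

lemma periodic_dkern_shift': "periodic (\<lambda>y. dkern e i (x - y))"
  unfolding dkern_odd[of e i x] using periodic_dkern_shift[of e i x]
  by (simp add: periodic_def)

lemma kern_nonneg: "0 \<le> kern e z" by (simp add: kern_def expflat_nonneg)

lemma expflat_le_1: "expflat x \<le> 1" by (simp add: flat_def)

lemma kern_le_1: "kern e z \<le> 1" by (simp add: kern_def expflat_le_1)

lemma kern_eq_0: "0 < e \<Longrightarrow> e\<^sup>2 \<le> cosdist z \<Longrightarrow> kern e z = 0"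
  by (simp add: kern_def flat_def)

lemma dkern_eq_0: "0 < e \<Longrightarrow> e\<^sup>2 \<le> cosdist z \<Longrightarrow> dkern e i z = 0"
  by (simp add: dkern_def flat_def)

text \<open>On the support \<open>sin\<^sup>2 = (1 - cos) (1 + cos) \<le> 2 e\<^sup>2\<close>, so one of the two factors \<open>1 / e\<close> is
absorbed by the sine.\<close>
lemma dkern_bound:
  assumes "0 < e"
  shows "\<bar>dkern e i z\<bar> \<le> 32 / e"
proof (cases "e\<^sup>2 \<le> cosdist z")
  case True
  then show ?thesis using assms by (simp add: dkern_eq_0)
next
  case False
  let ?c = "cos (2 * pi * z $ i)" and ?s = "sin (2 * pi * z $ i)"
  have 1: "1 - ?c \<le> cosdist z"
    unfolding cosdist_def by (rule member_le_sum) auto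
  have "?s\<^sup>2 = (1 - ?c) * (1 + ?c)"
    using sin_squared_eq[of "2 * pi * z $ i"] by (simp add: algebra_simps power2_eq_square)
  also have "\<dots> \<le> (1 - ?c) * 2"
    by (intro mult_left_mono) auto
  also have "\<dots> \<le> e\<^sup>2 * 2"
    using 1 False by (intro mult_right_mono) auto
  also have "\<dots> \<le> 4 * e\<^sup>2" by simp
  finally have "?s\<^sup>2 \<le> 4 * e\<^sup>2" .
  then have "?s\<^sup>2 \<le> (2 * e)\<^sup>2"
    by (simp add: power_mult_distrib)
  then have s: "\<bar>?s\<bar> \<le> 2 * e"
    using assms abs_le_square_iff[of ?s "2 * e"] by simp
  have "\<bar>dkern e i z\<bar> = dexpflat (1 - cosdist z / e\<^sup>2) * (2 * pi * \<bar>?s\<bar> / e\<^sup>2)"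
    using dexpflat_nonneg pi_ge_zero by (simp add: dkern_def abs_mult)
  also have "\<dots> \<le> 2 * (2 * 4 * (2 * e) / e\<^sup>2)"
    using s pi_less_4 assms
    by (intro mult_mono divide_right_mono dexpflat_le_2) (auto intro!: mult_nonneg_nonneg divide_nonneg_nonneg)
  also have "\<dots> = 32 / e"
    using assms by (simp add: power2_eq_square)
  finally show ?thesis .
qed

text \<open>By the mean value theorem \<open>sin y \<ge> y cos y\<close>, hence \<open>sin (2 y) \<ge> 2 y cos\<^sup>2 y \<ge> y\<close> for
\<open>0 < y \<le> \<pi> / 4\<close>; then \<open>1 - cos (4 y) = 2 sin\<^sup>2 (2 y)\<close> with \<open>y = \<pi> r / 2\<close>.\<close>
lemma one_minus_cos_ge:
  assumes "\<bar>r\<bar> \<le> 1 / 2"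
  shows "r\<^sup>2 \<le> 1 - cos (2 * pi * r)"
proof -
  have main: "s\<^sup>2 \<le> 1 - cos (2 * pi * s)" if s: "0 < s" "s \<le> 1 / 2" for s :: real
  proof -
    define y where "y = pi * s / 2"
    have y: "0 < y" "y \<le> pi / 4" using s by (auto simp: y_def)
    obtain x where x: "0 < x" "x < y" "sin y - sin 0 = (y - 0) * cos x"
      using MVT2[of 0 y sin cos] y by (auto intro: DERIV_sin)
    have "cos y \<le> cos x" using x y by (intro cos_monotone_0_pi_le) auto
    then have sy: "y * cos y \<le> sin y" using x y by simp
    have "0 \<le> cos (2 * y)" using y by (intro cos_ge_zero) auto
    then have cy: "1 / 2 \<le> (cos y)\<^sup>2" by (simp add: cos_double_cos)
    have "0 < cos y" using y by (intro cos_gt_zero) auto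
    have "y * 1 \<le> y * (2 * (cos y)\<^sup>2)" using y cy by (intro mult_left_mono) auto
    also have "\<dots> = 2 * (y * cos y) * cos y" by (simp add: power2_eq_square)
    also have "\<dots> \<le> 2 * sin y * cos y" using sy \<open>0 < cos y\<close> by (intro mult_right_mono) auto
    also have "\<dots> = sin (2 * y)" by (simp add: sin_double)
    finally have 1: "y \<le> sin (2 * y)" by simp
    have "s \<le> y" using s pi_ge_two by (simp add: y_def)
    then have "s\<^sup>2 \<le> (sin (2 * y))\<^sup>2" using 1 s by (intro power_mono) auto
    also have "\<dots> \<le> 2 * (sin (2 * y))\<^sup>2" by simp
    also have "\<dots> = 1 - cos (2 * (2 * y))" by (simp only: cos_double_sin[of "2 * y"])
    finally show ?thesis by (simp add: y_def mult_ac)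
  qed
  have "cos (2 * pi * r) = cos (2 * pi * \<bar>r\<bar>)"
    by (cases "r \<ge> 0") simp_all
  then show ?thesis using main[of "\<bar>r\<bar>"] assms by (cases "r = 0") auto
qed

text \<open>Rounding every coordinate leaves residues of size at most 1/2, to which \<open>one_minus_cos_ge\<close> applies.\<close>
lemma near_lattice:
  fixes z :: "real ^ 'n"
  assumes "cosdist z < e\<^sup>2" "0 < e"
  shows "\<exists>k. (\<forall>i. k $ i \<in> \<int>) \<and> norm (z - k) \<le> e"
proof -
  define k :: "real ^ 'n" where "k = (\<chi> i. of_int (round (z $ i)))"
  have r: "\<bar>(z - k) $ i\<bar> \<le> 1 / 2" for i
    using of_int_round_abs_le[of "z $ i"] by (simp add: k_def abs_minus_commute)
  have "cos (2 * pi * (z - k) $ i) = cos (2 * pi * z $ i)" for i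
    using cos_int_2pin[of "round (z $ i)"] sin_int_2pin[of "round (z $ i)"]
    by (simp add: k_def algebra_simps cos_diff)
  then have "((z - k) $ i)\<^sup>2 \<le> 1 - cos (2 * pi * z $ i)" for i
    using one_minus_cos_ge[OF r, of i] by simp
  then have "(\<Sum>i\<in>UNIV. ((z - k) $ i)\<^sup>2) \<le> cosdist z"
    unfolding cosdist_def by (intro sum_mono)
  then have "(norm (z - k))\<^sup>2 \<le> e\<^sup>2"
    using assms by (simp add: norm_vec_def L2_set_def sum_nonneg)
  then have "norm (z - k) \<le> e" using assms(2) by (simp add: power2_le_iff_abs_le)
  then show ?thesis by (intro exI[of _ k]) (auto simp: k_def)
qed

lemma periodic_add_of_int:
  assumes "periodic f"
  shows "f (x + of_int k *\<^sub>R axis i 1) = f x"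
proof -
  have n: "f (x + of_nat n *\<^sub>R axis i 1) = f x" for n x
  proof (induction n)
    case (Suc n)
    have "x + of_nat (Suc n) *\<^sub>R axis i 1 = (x + of_nat n *\<^sub>R axis i 1) + axis i 1"
      by (simp add: scaleR_add_left add_ac)
    then show ?case using Suc assms by (metis periodic_def)
  qed simp
  show ?thesis
  proof (cases "k \<ge> 0")
    case True
    then show ?thesis using n[of x "nat k"] by simp
  next
    case False
    then show ?thesis using n[of "x + of_int k *\<^sub>R axis i 1" "nat (- k)"] by simp
  qed
qed

lemma vec_axis_sum: "x = (\<Sum>i\<in>UNIV. x $ i *\<^sub>R axis i (1::real))"
  using basis_expansion[of x] by (simp add: scalar_mult_eq_scaleR)

lemma periodic_add_lattice:
  assumes "periodic f" "\<And>i. k $ i \<in> \<int>"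
  shows "f (x + k) = f x"
proof -
  have "f (x + (\<Sum>i\<in>S. k $ i *\<^sub>R axis i 1)) = f x" if "finite S" for S
    using that
  proof (induction S)
    case (insert i S)
    obtain m where m: "k $ i = of_int m" using assms(2) by (auto elim: Ints_cases)
    have "f (x + (\<Sum>i\<in>insert i S. k $ i *\<^sub>R axis i 1)) =
        f ((x + (\<Sum>i\<in>S. k $ i *\<^sub>R axis i 1)) + of_int m *\<^sub>R axis i 1)"
      using insert m by (simp add: add_ac)
    then show ?case using insert periodic_add_of_int[OF assms(1)] by metis
  qed simp
  from this[of UNIV] show ?thesis using vec_axis_sum[of k] by simp
qed


section \<open>Integration over the torus\<close>

text \<open>Integrals over the cell and over a time interval become integrals with respect to finite measures, so that
Fubini's theorem is available on their products.\<close>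
definition cellM :: "(real ^ 'n) measure" where
  "cellM = restrict_space lborel torus_cell"

definition timeM :: "real \<Rightarrow> real \<Rightarrow> real measure" where
  "timeM a b = restrict_space lborel {a<..<b}"

lemma compact_torus_cell: "compact torus_cell"
  by (simp add: torus_cell_def)

lemma sets_torus_cell [measurable]: "torus_cell \<in> sets borel"
  by (simp add: torus_cell_def)

lemma mem_torus_cell: "x \<in> torus_cell \<longleftrightarrow> (\<forall>i. 0 \<le> x $ i \<and> x $ i \<le> 1)"
  by (simp add: torus_cell_def mem_box_cart)

lemma space_cellM: "space cellM = torus_cell"
  by (simp add: cellM_def space_restrict_space)

lemma space_timeM: "space (timeM a b) = {a<..<b}"
  by (simp add: timeM_def space_restrict_space)

lemma torus_integral_eq: "torus_integral f = integral\<^sup>L cellM f"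
  by (simp add: torus_integral_def cellM_def set_lebesgue_integral_def integral_restrict_space)

lemma integrable_cellM_iff:
  fixes f :: "real ^ 'n \<Rightarrow> 'b::{banach, second_countable_topology}"
  shows "integrable cellM f \<longleftrightarrow> set_integrable lborel torus_cell f"
  by (simp add: cellM_def set_integrable_def integrable_restrict_space)

lemma integrable_timeM_iff:
  fixes f :: "real \<Rightarrow> 'b::{banach, second_countable_topology}"
  shows "integrable (timeM a b) f \<longleftrightarrow> set_integrable lborel {a<..<b} f"
  by (simp add: timeM_def set_integrable_def integrable_restrict_space)

lemma integral_timeM:
  fixes f :: "real \<Rightarrow> 'b::{banach, second_countable_topology}"
  shows "integral\<^sup>L (timeM a b) f = (LINT t:{a<..<b}|lborel. f t)"
  by (simp add: timeM_def set_lebesgue_integral_def integral_restrict_space)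

lemma AE_timeM_iff: "(AE t in timeM a b. P t) \<longleftrightarrow> (AE t\<in>{a<..<b} in lborel. P t)"
  unfolding timeM_def by (subst AE_restrict_space_iff) auto

lemma AE_cellM: "AE x in lborel. P x \<Longrightarrow> AE x in cellM. P x"
  unfolding cellM_def by (subst AE_restrict_space_iff) auto

lemma measurable_cellM [measurable_dest]: "f \<in> borel_measurable borel \<Longrightarrow> f \<in> borel_measurable cellM"
  by (simp add: cellM_def measurable_restrict_space1)

lemma emeasure_cellM: "emeasure cellM (space cellM) = 1"
proof -
  have "emeasure lborel (torus_cell :: (real ^ 'n) set) = ennreal (measure lborel (torus_cell :: (real ^ 'n) set))"
    using emeasure_bounded_finite[of "torus_cell :: (real ^ 'n) set"]
    by (intro emeasure_eq_ennreal_measure) (auto simp: torus_cell_def)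
  also have "measure lborel (torus_cell :: (real ^ 'n) set) = 1"
    unfolding torus_cell_def by (subst content_cbox_if_cart) (auto simp: interval_eq_empty_cart)
  finally show ?thesis
    by (simp add: space_cellM) (simp add: cellM_def emeasure_restrict_space)
qed

lemma finite_measure_cellM: "finite_measure cellM"
  by (rule finite_measureI) (simp add: emeasure_cellM)

lemma measure_cellM: "measure cellM (space cellM) = 1"
  by (simp add: measure_def emeasure_cellM)

lemma finite_measure_timeM: "finite_measure (timeM a b)"
proof (rule finite_measureI)
  have "emeasure (timeM a b) (space (timeM a b)) = emeasure lborel {a<..<b}"
    by (simp add: space_timeM) (simp add: timeM_def emeasure_restrict_space)
  also have "\<dots> \<le> emeasure lborel {a..b}" by (intro emeasure_mono) auto
  also have "\<dots> < \<infinity>" by (cases "a \<le> b") auto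
  finally show "emeasure (timeM a b) (space (timeM a b)) \<noteq> \<infinity>" by simp
qed

interpretation cellM: finite_measure cellM by (rule finite_measure_cellM)
interpretation timeM: finite_measure "timeM a b" for a b by (rule finite_measure_timeM)
interpretation cc: pair_sigma_finite cellM cellM ..
interpretation ct: pair_sigma_finite cellM "timeM a b" for a b ..

lemma measurable_id_restrict_pair:
  "(\<lambda>z. z) \<in> measurable (restrict_space lborel A \<Otimes>\<^sub>M restrict_space lborel B)
     (borel :: ('a::euclidean_space \<times> 'b::euclidean_space) measure)"
proof -
  have "(\<lambda>x. x) \<in> measurable (restrict_space lborel A) (borel :: 'a measure)"
    "(\<lambda>x. x) \<in> measurable (restrict_space lborel B) (borel :: 'b measure)"
    by (auto intro: measurable_restrict_space1)
  note [measurable] = measurable_compose[OF measurable_fst this(1)] measurable_compose[OF measurable_snd this(2)]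
  have "(\<lambda>z. (fst z, snd z)) \<in> measurable (restrict_space lborel A \<Otimes>\<^sub>M restrict_space lborel B)
     (borel \<Otimes>\<^sub>M (borel :: 'b measure))"
    by measurable
  then show ?thesis by (simp add: borel_prod)
qed

lemma measurable_restrict_pair:
  fixes f :: "'a::euclidean_space \<times> 'b::euclidean_space \<Rightarrow> 'c::euclidean_space"
  assumes "set_borel_measurable borel (A \<times> B) f"
  shows "f \<in> borel_measurable (restrict_space lborel A \<Otimes>\<^sub>M restrict_space lborel B)"
proof -
  have "(\<lambda>z. indicator (A \<times> B) z *\<^sub>R f z) \<in>
      borel_measurable (restrict_space lborel A \<Otimes>\<^sub>M restrict_space lborel B)"
    using measurable_compose[OF measurable_id_restrict_pair assms[unfolded set_borel_measurable_def]] .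
  then show ?thesis
    by (rule measurable_cong[THEN iffD1, rotated])
      (auto simp: space_pair_measure space_restrict_space)
qed

text \<open>Tonelli's theorem reduces the norm integral over the product of the restricted measures to the one over the
restricted product, without an identification of the two measures.\<close>
lemma integrable_restrict_pair:
  fixes f :: "'a::euclidean_space \<times> 'b::euclidean_space \<Rightarrow> real"
  assumes "set_integrable lborel (A \<times> B) f" and [measurable]: "A \<in> sets borel" "B \<in> sets borel"
  shows "integrable (restrict_space lborel A \<Otimes>\<^sub>M restrict_space lborel B) f"
proof (rule integrableI_bounded)
  interpret B: sigma_finite_measure "restrict_space lborel B"
    by (rule sigma_finite_measure_restrict_space[OF sigma_finite_lborel]) simp
  have meas: "(\<lambda>z. indicator (A \<times> B) z *\<^sub>R f z) \<in> borel_measurable (lborel \<Otimes>\<^sub>M lborel)"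
    using assms(1) by (simp add: set_integrable_def lborel_prod borel_measurable_integrable del: scaleR_conv_of_real)
  show f: "f \<in> borel_measurable (restrict_space lborel A \<Otimes>\<^sub>M restrict_space lborel B)"
    using assms(1) by (intro measurable_restrict_pair)
      (auto simp: set_integrable_def set_borel_measurable_def dest!: borel_measurable_integrable)
  have "(\<integral>\<^sup>+ z. norm (f z) \<partial>(restrict_space lborel A \<Otimes>\<^sub>M restrict_space lborel B)) =
      (\<integral>\<^sup>+ x. (\<integral>\<^sup>+ y. norm (f (x, y)) \<partial>restrict_space lborel B) \<partial>restrict_space lborel A)"
    using f by (intro B.nn_integral_fst[symmetric]) auto
  also have "\<dots> = (\<integral>\<^sup>+ x. (\<integral>\<^sup>+ y. ennreal (norm (indicator (A \<times> B) (x, y) *\<^sub>R f (x, y))) \<partial>lborel) \<partial>lborel)"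
    by (subst nn_integral_restrict_space, simp, intro nn_integral_cong,
        subst nn_integral_restrict_space, simp,
        subst nn_integral_multc[symmetric] nn_integral_cong[symmetric])
      (auto intro!: nn_integral_cong split: split_indicator)
  also have "\<dots> = (\<integral>\<^sup>+ z. ennreal (norm (indicator (A \<times> B) z *\<^sub>R f z)) \<partial>(lborel \<Otimes>\<^sub>M lborel))"
    using meas by (intro lborel.nn_integral_fst) simp
  also have "\<dots> < \<infinity>"
    using assms(1) unfolding set_integrable_def lborel_prod by (simp add: integrable_iff_bounded)
  finally show "(\<integral>\<^sup>+ z. norm (f z) \<partial>(restrict_space lborel A \<Otimes>\<^sub>M restrict_space lborel B)) < \<infinity>" .
qed

text \<open>All kernels below are bounded and jointly measurable; with this lemma each exchange of integrals only needs
integrability of the two outer factors.\<close>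
lemma integrable_product_kernel:
  fixes f :: "'a \<Rightarrow> real" and g :: "'b \<Rightarrow> real"
  assumes "pair_sigma_finite M1 M2"
    and f: "integrable M1 f" and g: "integrable M2 g"
    and \<kappa>: "case_prod \<kappa> \<in> borel_measurable (M1 \<Otimes>\<^sub>M M2)" "\<And>x y. \<bar>\<kappa> x y\<bar> \<le> c"
  shows "integrable (M1 \<Otimes>\<^sub>M M2) (\<lambda>(x, y). f x * \<kappa> x y * g y)"
proof -
  interpret pair_sigma_finite M1 M2 by fact
  have [measurable]: "f \<in> borel_measurable M1" "g \<in> borel_measurable M2"
    using f g by auto
  have "integrable (M1 \<Otimes>\<^sub>M M2) (\<lambda>(x, y). f x * g y)"
    using f g by (intro Fubini_integrable) (auto simp: abs_mult)
  then have "integrable (M1 \<Otimes>\<^sub>M M2) (\<lambda>z. c * (case z of (x, y) \<Rightarrow> f x * g y))"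
    by (rule integrable_mult_right)
  then show ?thesis
  proof (rule Bochner_Integration.integrable_bound)
    show "(\<lambda>(x, y). f x * \<kappa> x y * g y) \<in> borel_measurable (M1 \<Otimes>\<^sub>M M2)"
      using \<kappa>(1) by measurable
    have "\<bar>f x * \<kappa> x y * g y\<bar> \<le> \<bar>c * (f x * g y)\<bar>" for x y
    proof -
      have "\<bar>\<kappa> x y\<bar> * \<bar>f x * g y\<bar> \<le> \<bar>c\<bar> * \<bar>f x * g y\<bar>"
        using \<kappa>(2)[of x y] by (intro mult_right_mono) auto
      then show ?thesis by (simp add: abs_mult mult_ac)
    qed
    then show "AE z in M1 \<Otimes>\<^sub>M M2. norm (case z of (x, y) \<Rightarrow> f x * \<kappa> x y * g y) \<le>
        norm (c * (case z of (x, y) \<Rightarrow> f x * g y))"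
      by auto
  qed
qed

lemma lborel_integral_shift:
  fixes f :: "'a::euclidean_space \<Rightarrow> real"
  assumes "f \<in> borel_measurable borel"
  shows "(\<integral>x. f (c + x) \<partial>lborel) = integral\<^sup>L lborel f"
proof -
  have "integral\<^sup>L lborel f = integral\<^sup>L (distr lborel borel ((+) c)) f"
    by (simp add: lborel_distr_plus)
  also have "\<dots> = (\<integral>x. f (c + x) \<partial>lborel)"
    using assms by (intro integral_distr) auto
  finally show ?thesis by simp
qed

lemma AE_coord_neq: "AE x in lborel. x $ i \<noteq> (c::real)"
proof -
  have eq: "{x::real^'a. \<not> x $ i \<noteq> c} = {x. axis i 1 \<bullet> x = c}"
    by (simp add: inner_axis' )
  have "closed {x::real^'a. axis i 1 \<bullet> x = c}" by (rule closed_hyperplane)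
  then have "{x::real^'a. axis i 1 \<bullet> x = c} \<in> sets lborel" by auto
  moreover have "{x::real^'a. axis i 1 \<bullet> x = c} \<in> null_sets lebesgue"
    unfolding negligible_iff_null_sets[symmetric] by (rule negligible_hyperplane) auto
  ultimately have "{x::real^'a. axis i 1 \<bullet> x = c} \<in> null_sets lborel"
    by (simp add: null_sets_completion_iff)
  then show ?thesis
    by (intro AE_I'[of "{x. axis i 1 \<bullet> x = c}"]) (auto simp: eq[symmetric])
qed

lemma integrable_continuous_cellM:
  fixes f :: "real ^ 'n \<Rightarrow> real"
  assumes "continuous_on UNIV f"
  shows "integrable cellM f"
  unfolding integrable_cellM_iff set_integrable_def
  by (rule borel_integrable_compact[OF compact_torus_cell]) (use assms continuous_on_subset in blast)

text \<open>The part of the shifted cell beyond the hyperplane \<open>x\<^sub>i = 1\<close> is moved back by one period. The two pieces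
then tile the original cell up to the hyperplanes \<open>x\<^sub>i = s\<close> and \<open>x\<^sub>i = 1\<close>, which are null sets.\<close>
lemma torus_integral_shift_axis:
  fixes f :: "real ^ 'n \<Rightarrow> real"
  assumes per: "periodic f" and cont: "continuous_on UNIV f" and s: "0 \<le> s" "s < 1"
  shows "torus_integral (\<lambda>x. f (x + s *\<^sub>R axis i 1)) = torus_integral f"
proof -
  let ?e = "axis i 1 :: real ^ 'n"
  have [measurable]: "f \<in> borel_measurable borel"
    using cont by (rule borel_measurable_continuous_onI)
  define J where "J c x = indicator torus_cell (x - c *\<^sub>R ?e) * f x" for c x
  have J: "integrable lborel (J c)" for c
  proof -
    have "(\<lambda>x::real^'n. indicator torus_cell (x - c *\<^sub>R ?e) :: real) = indicator ((+) (c *\<^sub>R ?e) ` torus_cell)"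
      by (auto simp: indicator_def image_iff fun_eq_iff intro!: bexI[of _ "_ - c *\<^sub>R ?e"])
    then have "J c = (\<lambda>x. indicator ((+) (c *\<^sub>R ?e) ` torus_cell) x *\<^sub>R f x)"
      by (auto simp: J_def fun_eq_iff)
    then show ?thesis
      using borel_integrable_compact[OF compact_translation[OF compact_torus_cell], of _ f]
        continuous_on_subset[OF cont] by auto
  qed
  have [measurable]: "J c \<in> borel_measurable borel" for c
    using J[of c] by auto
  have f1: "f (x + ?e) = f x" for x using per by (simp add: periodic_def)
  have "torus_integral (\<lambda>x. f (x + s *\<^sub>R ?e)) = (\<integral>x. J s (s *\<^sub>R ?e + x) \<partial>lborel)"
    by (simp add: torus_integral_def set_lebesgue_integral_def J_def add.commute)
  also have "\<dots> = (\<integral>x. J s x \<partial>lborel)" by (rule lborel_integral_shift) simp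
  also have "\<dots> = (\<integral>x. indicator {x. x $ i < 1} x * J s x + indicator {x. x $ i \<ge> 1} x * J s x \<partial>lborel)"
    by (intro Bochner_Integration.integral_cong) (auto simp: indicator_def)
  also have "\<dots> = (\<integral>x. indicator {x. x $ i < 1} x * J s x \<partial>lborel) + (\<integral>x. indicator {x. x $ i \<ge> 1} x * J s x \<partial>lborel)"
    by (intro Bochner_Integration.integral_add integrable_real_mult_indicator[unfolded mult.commute[of _ "indicator _ _"]] J) auto
  also have "(\<integral>x. indicator {x. x $ i \<ge> 1} x * J s x \<partial>lborel) =
      (\<integral>x. indicator {x. x $ i \<ge> 1} (?e + x) * J s (?e + x) \<partial>lborel)"
    by (rule lborel_integral_shift[symmetric]) measurable
  also have "\<dots> = (\<integral>x. indicator {x. x $ i \<ge> 0} x * J (s - 1) x \<partial>lborel)"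
    by (intro Bochner_Integration.integral_cong)
      (auto simp: J_def f1 add.commute[of ?e] algebra_simps indicator_def)
  also have "(\<integral>x. indicator {x. x $ i < 1} x * J s x \<partial>lborel) + \<dots> =
      (\<integral>x. indicator {x. x $ i < 1} x * J s x + indicator {x. x $ i \<ge> 0} x * J (s - 1) x \<partial>lborel)"
    by (intro Bochner_Integration.integral_add[symmetric] integrable_real_mult_indicator[unfolded mult.commute[of _ "indicator _ _"]] J) auto
  also have "\<dots> = (\<integral>x. indicator torus_cell x *\<^sub>R f x \<partial>lborel)"
  proof (rule integral_cong_AE)
    have "indicator {x. x $ i < 1} x * J s x + indicator {x. x $ i \<ge> 0} x * J (s - 1) x
        = indicator torus_cell x *\<^sub>R f x" if "x $ i \<noteq> s" "x $ i \<noteq> 1" for x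
    proof -
      have m: "x - c *\<^sub>R ?e \<in> torus_cell \<longleftrightarrow>
          (\<forall>j. j \<noteq> i \<longrightarrow> 0 \<le> x $ j \<and> x $ j \<le> 1) \<and> c \<le> x $ i \<and> x $ i \<le> 1 + c" for c
        unfolding mem_torus_cell by (auto simp: axis_def)
      have m0: "x \<in> torus_cell \<longleftrightarrow> (\<forall>j. j \<noteq> i \<longrightarrow> 0 \<le> x $ j \<and> x $ j \<le> 1) \<and> 0 \<le> x $ i \<and> x $ i \<le> 1"
        using m[of 0] by simp
      show ?thesis
        using that s by (auto simp: J_def indicator_def m m0)
    qed
    with AE_coord_neq[of i s] AE_coord_neq[of i 1]
    show "AE x in lborel. indicator {x. x $ i < 1} x * J s x + indicator {x. x $ i \<ge> 0} x * J (s - 1) x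
        = indicator torus_cell x *\<^sub>R f x"
      by (auto elim: eventually_elim2)
  qed auto
  finally show ?thesis
    by (simp add: torus_integral_def set_lebesgue_integral_def)
qed

lemma torus_integral_shift:
  fixes f :: "real ^ 'n \<Rightarrow> real"
  assumes per: "periodic f" and cont: "continuous_on UNIV f"
  shows "torus_integral (\<lambda>x. f (x + a)) = torus_integral f"
proof -
  have one: "torus_integral (\<lambda>x. g (x + c *\<^sub>R axis i 1)) = torus_integral g"
    if g: "periodic g" "continuous_on UNIV g" for g :: "real ^ 'n \<Rightarrow> real" and c i
  proof -
    have "g (x + c *\<^sub>R axis i 1) = g (x + frac c *\<^sub>R axis i 1)" for x
      using periodic_add_of_int[OF g(1), of "x + frac c *\<^sub>R axis i 1" "\<lfloor>c\<rfloor>" i]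
      by (simp add: frac_def algebra_simps)
    then show ?thesis
      using torus_integral_shift_axis[OF g, of "frac c" i] by (simp add: frac_lt_1)
  qed
  have "torus_integral (\<lambda>x. f (x + (\<Sum>i\<in>S. a $ i *\<^sub>R axis i 1))) = torus_integral f" if "finite S" for S
    using that
  proof (induction S)
    case (insert i S)
    let ?g = "\<lambda>x. f (x + (\<Sum>i\<in>S. a $ i *\<^sub>R axis i 1))"
    have "torus_integral (\<lambda>x. ?g (x + a $ i *\<^sub>R axis i 1)) = torus_integral ?g"
      by (intro one periodic_shift per continuous_on_compose2[OF cont] continuous_intros) auto
    then show ?case using insert by (simp add: add_ac)
  qed simp
  from this[of UNIV] show ?thesis using vec_axis_sum[of a] by simp
qed


section \<open>The mass of the mollifier and of its gradient\<close>

lemma integrable_continuous_cell_pair: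
  fixes f :: "(real ^ 'n) \<times> (real ^ 'n) \<Rightarrow> real"
  assumes "continuous_on UNIV f"
  shows "integrable (cellM \<Otimes>\<^sub>M cellM) f"
  unfolding cellM_def
  by (rule integrable_restrict_pair, unfold set_integrable_def, rule borel_integrable_compact)
    (auto intro!: compact_Times compact_torus_cell continuous_on_subset[OF assms])

lemma kern_mass_shift:
  fixes y :: "real ^ 'n"
  shows "integral\<^sup>L cellM (\<lambda>x. kern e (x - y)) = torus_integral (kern e :: real ^ 'n \<Rightarrow> real)"
    "integral\<^sup>L cellM (\<lambda>x. kern e (y - x)) = torus_integral (kern e :: real ^ 'n \<Rightarrow> real)"
proof -
  show 1: "integral\<^sup>L cellM (\<lambda>x. kern e (x - y)) = torus_integral (kern e :: real ^ 'n \<Rightarrow> real)"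
    using torus_integral_shift[OF periodic_kern continuous_kern[OF continuous_on_id], of e "- y"]
    by (simp add: torus_integral_eq)
  show "integral\<^sup>L cellM (\<lambda>x. kern e (y - x)) = torus_integral (kern e :: real ^ 'n \<Rightarrow> real)"
    unfolding kern_even[of e y] using 1 .
qed

lemma abs_dkern_mass_shift:
  fixes y :: "real ^ 'n"
  shows "integral\<^sup>L cellM (\<lambda>x. \<bar>dkern e i (x - y)\<bar>) = torus_integral (\<lambda>x. \<bar>dkern e i x\<bar>)"
proof -
  have "periodic (\<lambda>x::real^'n. \<bar>dkern e i x\<bar>)"
    using periodic_dkern[of e i] by (simp add: periodic_def)
  then show ?thesis
    using torus_integral_shift[of "\<lambda>x. \<bar>dkern e i x\<bar>" "- y"]
    by (simp add: torus_integral_eq continuous_intros)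
qed

text \<open>The double integral of \<open>dkern e i (x - y)\<close> over the cell is \<open>I\<close> in one order of integration and \<open>- I\<close> in
the other, where \<open>I\<close> is the integral of \<open>dkern e i\<close>, by oddness and translation invariance.\<close>
lemma dkern_mass_zero:
  fixes x :: "real ^ 'n"
  shows "integral\<^sup>L cellM (\<lambda>y. dkern e i (x - y)) = 0"
proof -
  define I where "I = torus_integral (dkern e i :: real ^ 'n \<Rightarrow> real)"
  have sh: "integral\<^sup>L cellM (\<lambda>x. dkern e i (x - y)) = I" for y :: "real ^ 'n"
    using torus_integral_shift[OF periodic_dkern continuous_dkern[OF continuous_on_id], of e i "- y"]
    by (simp add: torus_integral_eq I_def)
  then have sh': "integral\<^sup>L cellM (\<lambda>y. dkern e i (x - y)) = - I" for x :: "real ^ 'n"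
    unfolding dkern_odd[of e i x] by simp
  have "integrable (cellM \<Otimes>\<^sub>M cellM) (\<lambda>(x, y::real^'n). dkern e i (x - y))"
    by (rule integrable_continuous_cell_pair) (simp add: split_beta continuous_intros)
  from cc.Fubini_integral[OF this] have "I = - I"
    by (simp add: sh sh' measure_cellM)
  then show ?thesis using sh' by simp
qed

text \<open>On the cube of side \<open>r = e / (8 n)\<close> at the origin each summand of \<open>cosdist\<close> is at most \<open>2 (\<pi> r)\<^sup>2 \<le> 32 r\<^sup>2\<close>,
so \<open>cosdist \<le> e\<^sup>2 / 2\<close> there.\<close>
lemma kern_mass_ge:
  assumes "0 < e" "e \<le> 1"
  shows "expflat (1 / 2) * (e / (8 * real CARD('n))) ^ CARD('n) \<le>
    torus_integral (kern e :: real ^ 'n \<Rightarrow> real)"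
proof -
  define r where "r = e / (8 * real CARD('n))"
  let ?B = "cbox 0 (\<chi> i. r) :: (real ^ 'n) set"
  have n: "1 \<le> real CARD('n)" by (simp add: Suc_leI)
  have "e / (8 * real CARD('n)) \<le> e / 1"
    using assms n by (intro divide_left_mono mult_pos_pos; linarith)
  then have r: "0 < r" "r \<le> 1"
    unfolding r_def using assms by (simp, linarith)
  have memB: "x \<in> ?B \<longleftrightarrow> (\<forall>i. 0 \<le> x $ i \<and> x $ i \<le> r)" for x
    by (simp add: mem_box_cart)
  have low: "expflat (1 / 2) \<le> kern e z" if z: "z \<in> ?B" for z
  proof -
    have "1 - cos (2 * pi * z $ i) \<le> 32 * r\<^sup>2" for i
    proof -
      have "1 - cos (2 * pi * z $ i) = 2 * (sin (pi * z $ i))\<^sup>2"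
        using cos_double_sin[of "pi * z $ i"] by (simp add: mult.assoc)
      also have "\<dots> \<le> 2 * (4 * r)\<^sup>2"
      proof -
        have "\<bar>sin (pi * z $ i)\<bar> \<le> \<bar>pi * z $ i\<bar>" by (rule abs_sin_x_le_abs_x)
        also have "\<dots> \<le> 4 * r"
          using z[unfolded memB] pi_less_4 pi_ge_zero by (auto simp: abs_mult intro!: mult_mono)
        finally show ?thesis
          by (simp only: power2_abs[symmetric, of "sin _"]) (intro mult_left_mono power_mono; simp)
      qed
      finally show ?thesis by (simp add: power_mult_distrib)
    qed
    then have "cosdist z \<le> (\<Sum>i\<in>(UNIV::'n set). 32 * r\<^sup>2)"
      unfolding cosdist_def by (intro sum_mono)
    also have "\<dots> = e\<^sup>2 / (2 * real CARD('n))"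
      using n by (simp add: r_def power2_eq_square field_simps)
    also have "\<dots> \<le> e\<^sup>2 / 2"
      using n by (intro divide_left_mono) auto
    finally have "cosdist z / e\<^sup>2 \<le> 1 / 2"
      using assms by (simp add: field_simps)
    then show ?thesis unfolding kern_def by (intro expflat_mono) simp
  qed
  have sub: "?B \<subseteq> torus_cell" using r unfolding memB subset_iff mem_torus_cell
    by (meson order_trans)
  have "expflat (1 / 2) * r ^ CARD('n) = expflat (1 / 2) * measure lborel ?B"
    using r by (subst content_cbox_if_cart) (auto simp: interval_eq_empty_cart not_less)
  also have "\<dots> = (\<integral>x. indicator ?B x * expflat (1 / 2) \<partial>lborel)"
    by simp
  also have "\<dots> \<le> (\<integral>x. indicator torus_cell x *\<^sub>R kern e (x :: real ^ 'n) \<partial>lborel)"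
  proof (rule Bochner_Integration.integral_mono)
    have "emeasure lborel ?B < \<infinity>" by (rule emeasure_bounded_finite) simp
    then show "integrable lborel (\<lambda>x. indicator ?B x * expflat (1 / 2))"
      by (intro integrable_mult_left integrable_real_indicator) simp_all
    show "integrable lborel (\<lambda>x::real^'n. indicator torus_cell x *\<^sub>R kern e x)"
      by (intro borel_integrable_compact compact_torus_cell continuous_intros)
    show "indicator ?B x * expflat (1 / 2) \<le> indicator torus_cell x *\<^sub>R kern e x" for x
      using low[of x] sub kern_nonneg[of e x] by (auto simp: indicator_def)
  qed
  finally show ?thesis
    by (simp add: torus_integral_def set_lebesgue_integral_def r_def)
qed

lemma kern_mass_pos: "0 < e \<Longrightarrow> e \<le> 1 \<Longrightarrow> 0 < torus_integral (kern e :: real ^ 'n \<Rightarrow> real)"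
  by (rule less_le_trans[OF _ kern_mass_ge]) (auto simp: flat_def)

text \<open>After a shift of the cell to the cube of side 1 centred at 0, the support lies in the cube of half-width \<open>e\<close>
around the centre.\<close>
lemma dkern_mass_le:
  assumes e: "0 < e"
  shows "torus_integral (\<lambda>x::real^'n. \<bar>dkern e i x\<bar>) \<le> 32 / e * (2 * e) ^ CARD('n)"
proof -
  let ?c = "(\<chi> i. 1 / 2) :: real ^ 'n"
  let ?B = "cbox (\<chi> i. 1 / 2 - e) (\<chi> i. 1 / 2 + e) :: (real ^ 'n) set"
  have "torus_integral (\<lambda>x::real^'n. \<bar>dkern e i x\<bar>) = torus_integral (\<lambda>x::real^'n. \<bar>dkern e i (x - ?c)\<bar>)"
    using abs_dkern_mass_shift[of e i ?c] by (simp add: torus_integral_eq)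
  also have "\<dots> = (\<integral>x. indicator torus_cell x *\<^sub>R \<bar>dkern e i (x - ?c)\<bar> \<partial>lborel)"
    by (simp add: torus_integral_def set_lebesgue_integral_def)
  also have "\<dots> \<le> (\<integral>x. indicator ?B x * (32 / e) \<partial>lborel)"
  proof (rule Bochner_Integration.integral_mono)
    have "emeasure lborel ?B < \<infinity>" by (rule emeasure_bounded_finite) simp
    then show "integrable lborel (\<lambda>x. indicator ?B x * (32 / e))"
      by (intro integrable_mult_left integrable_real_indicator) simp_all
    show "integrable lborel (\<lambda>x. indicator torus_cell x *\<^sub>R \<bar>dkern e i (x - ?c)\<bar>)"
      by (intro borel_integrable_compact compact_torus_cell continuous_intros)
    fix x :: "real ^ 'n"
    show "indicator torus_cell x *\<^sub>R \<bar>dkern e i (x - ?c)\<bar> \<le> indicator ?B x * (32 / e)"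
    proof (cases "x \<in> torus_cell \<and> dkern e i (x - ?c) \<noteq> 0")
      case True
      then have small: "cosdist (x - ?c) < e\<^sup>2"
        using dkern_eq_0[OF e, of "x - ?c" i] by fastforce
      have "\<bar>(x - ?c) $ j\<bar> \<le> e" for j
      proof -
        have "\<bar>(x - ?c) $ j\<bar> \<le> 1 / 2"
          using True by (auto simp: mem_torus_cell abs_le_iff algebra_simps)
             (smt (verit) field_sum_of_halves)
        then have "((x - ?c) $ j)\<^sup>2 \<le> 1 - cos (2 * pi * (x - ?c) $ j)"
          by (rule one_minus_cos_ge)
        also have "\<dots> \<le> cosdist (x - ?c)"
          unfolding cosdist_def by (rule member_le_sum) auto
        finally have "((x - ?c) $ j)\<^sup>2 \<le> e\<^sup>2" using small by simp
        then show ?thesis using e abs_le_square_iff[of "(x - ?c) $ j" e] by simp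
      qed
      then have "x \<in> ?B" by (simp add: mem_box_cart abs_le_iff algebra_simps)
      then show ?thesis using dkern_bound[OF e, of i "x - ?c"] e by (simp add: indicator_def)
    qed (use e in \<open>auto simp: indicator_def\<close>)
  qed
  also have "\<dots> = 32 / e * measure lborel ?B" by simp
  also have "measure lborel ?B = (2 * e) ^ CARD('n)"
    using e by (subst content_cbox_if_cart) (auto simp: interval_eq_empty_cart not_less)
  finally show ?thesis .
qed

text \<open>The two masses are of order \<open>e\<^bsup>n-1\<^esup>\<close> and \<open>e\<^sup>n\<close>. The loss of a single factor \<open>1 / e\<close> is what makes 1/3 the
critical exponent in the flux estimate.\<close>
lemma dkern_mass_le_kern_mass:
  "\<exists>K>0. \<forall>e i. 0 < e \<longrightarrow> e \<le> 1 \<longrightarrow>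
     torus_integral (\<lambda>x::real^'n. \<bar>dkern e i x\<bar>) \<le> K / e * torus_integral (kern e :: real ^ 'n \<Rightarrow> real)"
proof -
  let ?n = "CARD('n)"
  define K where "K = 32 * 2 ^ ?n * (8 * real ?n) ^ ?n / expflat (1 / 2)"
  have p: "0 < expflat (1 / 2)" by (simp add: flat_def)
  have "torus_integral (\<lambda>x::real^'n. \<bar>dkern e i x\<bar>) \<le> K / e * torus_integral (kern e :: real ^ 'n \<Rightarrow> real)"
    if e: "0 < e" "e \<le> 1" for e i
  proof -
    have "32 / e * (2 * e) ^ ?n = K / e * (expflat (1 / 2) * (e / (8 * real ?n)) ^ ?n)"
      using p by (simp add: K_def power_mult_distrib power_divide)
    also have "\<dots> \<le> K / e * torus_integral (kern e :: real ^ 'n \<Rightarrow> real)"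
      using e p by (intro mult_left_mono kern_mass_ge) (auto simp: K_def)
    finally show ?thesis using dkern_mass_le[OF e(1), of i] by linarith
  qed
  moreover have "0 < K" using p by (simp add: K_def)
  ultimately show ?thesis by blast
qed


definition dstep :: "real \<Rightarrow> real" where
  "dstep t = exp 1 * (dexpflat (1 - exp 1 * expflat (1 - t)) * (exp 1 * dexpflat (1 - t)))"

lemma DERIV_step: "(step has_real_derivative dstep t) (at t)"
proof -
  have 1: "((\<lambda>t. 1 - t) has_real_derivative - 1) (at t)"
    by (auto intro!: derivative_eq_intros)
  have 2: "((\<lambda>t. 1 - exp 1 * expflat (1 - t)) has_real_derivative 0 - exp 1 * (dexpflat (1 - t) * - 1)) (at t)"
    by (intro DERIV_diff DERIV_const DERIV_cmult DERIV_chain2[OF DERIV_expflat 1])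
  show ?thesis
    unfolding step_def[abs_def]
    by (rule DERIV_cong[OF DERIV_cmult[OF DERIV_chain2[OF DERIV_expflat 2]]]) (simp add: dstep_def)
qed

lemma dstep_nonneg: "0 \<le> dstep t"
  by (simp add: dstep_def dexpflat_nonneg)

lemma dstep_eq_0: "t \<notin> {0..1} \<Longrightarrow> dstep t = 0"
proof -
  assume "t \<notin> {0..1}"
  then consider "t < 0" | "t > 1" by fastforce
  then show ?thesis
  proof cases
    case 1
    then have "exp 1 * expflat 1 \<le> exp 1 * expflat (1 - t)"
      by (intro mult_left_mono expflat_mono) auto
    moreover have "exp 1 * expflat 1 = 1" by (simp add: flat_def exp_minus)
    ultimately have "1 - exp 1 * expflat (1 - t) \<le> 0" by simp
    then show ?thesis by (simp add: dstep_def flat_def[of "[:0, 0, 1:]" "1 - exp 1 * expflat (1 - t)"])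
  next
    case 2
    then show ?thesis by (simp add: dstep_def flat_def)
  qed
qed

lemma continuous_dstep: "continuous_on UNIV dstep"
  unfolding dstep_def[abs_def] by (intro continuous_intros continuous_flat)

lemma integral_dstep: "(\<integral>t. dstep t \<partial>lborel) = 1"
proof -
  have "(\<integral>t. dstep t \<partial>lborel) = (\<integral>t. dstep t * indicator {0..1} t \<partial>lborel)"
    using dstep_eq_0 by (intro Bochner_Integration.integral_cong) (auto simp: indicator_def)
  also have "\<dots> = step 1 - step 0"
    by (rule integral_FTC_Icc_nonneg)
      (auto intro: DERIV_step dstep_nonneg borel_measurable_continuous_onI continuous_dstep)
  finally show ?thesis by (simp add: step_0 step_1)
qed

text \<open>The rescaled derivatives of the step are an approximate unit concentrated to the right of \<open>s\<close>.\<close>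
lemma rescaled_dstep_limit:
  fixes g :: "real \<Rightarrow> real"
  assumes g: "continuous_on {s..s + d} g" and d: "0 < d"
  shows "(\<lambda>n. \<integral>t. dstep ((t - s) / (d / real (Suc n))) / (d / real (Suc n)) * g t \<partial>lborel) \<longlonglongrightarrow> g s"
proof -
  define c where "c n = d / real (Suc n)" for n
  have c: "0 < c n" "c n \<le> d" for n
    using d by (auto simp: c_def field_simps)
  have c0: "c \<longlonglongrightarrow> 0"
    unfolding c_def[abs_def] by (rule lim_const_over_n[THEN LIMSEQ_Suc])
  have eq: "(\<integral>t. dstep ((t - s) / c n) / c n * g t \<partial>lborel) =
      (\<integral>t. indicator {0..1} t *\<^sub>R (dstep t * g (s + c n * t)) \<partial>lborel)" for n
  proof -
    have "(\<integral>t. dstep ((t - s) / c n) / c n * g t \<partial>lborel) =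
        c n * (\<integral>t. dstep t / c n * g (s + c n * t) \<partial>lborel)"
      using c[of n] by (subst lborel_integral_real_affine[of "c n" _ s]) simp_all
    also have "\<dots> = (\<integral>t. c n * (dstep t / c n * g (s + c n * t)) \<partial>lborel)"
      by (rule integral_mult_right_zero[symmetric])
    also have "\<dots> = (\<integral>t. indicator {0..1} t *\<^sub>R (dstep t * g (s + c n * t)) \<partial>lborel)"
      using c[of n] dstep_eq_0
      by (intro Bochner_Integration.integral_cong) (auto simp: indicator_def)
    finally show ?thesis .
  qed
  have mem: "s + c n * t \<in> {s..s + d}" if "t \<in> {0..1}" for n t
  proof -
    have "c n * t \<le> d * 1" using that c[of n] d by (intro mult_mono) auto
    then show ?thesis using that c[of n] by auto
  qed
  obtain B where B: "\<And>t. t \<in> {s..s + d} \<Longrightarrow> \<bar>g t\<bar> \<le> B"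
    using compact_imp_bounded[OF compact_continuous_image[OF g compact_Icc]]
    unfolding bounded_iff by (metis imageI real_norm_def)
  have "(\<lambda>n. \<integral>t. indicator {0..1} t *\<^sub>R (dstep t * g (s + c n * t)) \<partial>lborel) \<longlonglongrightarrow>
      (\<integral>t. indicator {0..1} t *\<^sub>R (dstep t * g s) \<partial>lborel)"
  proof (rule integral_dominated_convergence[where w = "\<lambda>t. indicator {0..1} t *\<^sub>R (dstep t * B)"])
    show "integrable lborel (\<lambda>t. indicator {0..1} t *\<^sub>R (dstep t * B))"
      by (intro borel_integrable_compact continuous_intros continuous_on_subset[OF continuous_dstep]) auto
    show "(\<lambda>t. indicator {0..1} t *\<^sub>R (dstep t * g (s + c n * t))) \<in> borel_measurable lborel" for n
    proof -
      have "continuous_on {0..1} (\<lambda>t. g (s + c n * t))"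
        by (rule continuous_on_compose2[OF g]) (use mem in \<open>auto intro!: continuous_intros\<close>)
      then have "continuous_on {0..1} (\<lambda>t. dstep t * g (s + c n * t))"
        by (intro continuous_intros continuous_on_subset[OF continuous_dstep]) auto
      then show ?thesis by (intro borel_measurable_integrable borel_integrable_compact) auto
    qed
    show "(\<lambda>t. indicator {0..1} t *\<^sub>R (dstep t * g s)) \<in> borel_measurable lborel"
      by (intro borel_measurable_integrable borel_integrable_compact continuous_intros
          continuous_on_subset[OF continuous_dstep]) auto
    show "AE t in lborel. (\<lambda>n. indicator {0..1} t *\<^sub>R (dstep t * g (s + c n * t))) \<longlonglongrightarrow>
        indicator {0..1} t *\<^sub>R (dstep t * g s)"
    proof (rule AE_I2)
      fix t :: real
      show "(\<lambda>n. indicator {0..1} t *\<^sub>R (dstep t * g (s + c n * t))) \<longlonglongrightarrow>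
        indicator {0..1} t *\<^sub>R (dstep t * g s)"
      proof (cases "t \<in> {0..1}")
        case True
        have "(\<lambda>n. s + c n * t) \<longlonglongrightarrow> s + 0 * t" by (intro tendsto_intros c0)
        then have "(\<lambda>n. g (s + c n * t)) \<longlonglongrightarrow> g s"
          using continuous_on_tendsto_compose[OF g, of "\<lambda>n. s + c n * t" s sequentially] mem[OF True] d
          by simp
        then show ?thesis by (intro tendsto_intros)
      qed simp
    qed
    show "AE t in lborel. norm (indicator {0..1} t *\<^sub>R (dstep t * g (s + c n * t))) \<le>
        indicator {0..1} t *\<^sub>R (dstep t * B)" for n
      using B[OF mem] dstep_nonneg by (auto simp: indicator_def abs_mult intro!: mult_left_mono)
  qed
  also have "(\<integral>t. indicator {0..1} t *\<^sub>R (dstep t * g s) \<partial>lborel) = (\<integral>t. dstep t * g s \<partial>lborel)"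
    using dstep_eq_0 by (intro Bochner_Integration.integral_cong) (auto simp: indicator_def)
  also have "\<dots> = g s" by (simp add: integral_dstep)
  finally show ?thesis by (simp only: eq[symmetric]) (simp only: c_def)
qed


section \<open>Increments from weak time derivatives\<close>

text \<open>The fundamental theorem of calculus for a weak derivative. The test functions are smooth plateaus over
\<open>{s1<..s2}\<close>, whose derivative is the difference of two approximate units; continuity of \<open>g\<close> is what
identifies its values at the two end points.\<close>
lemma increment_of_weak_derivative:
  fixes g h :: "real \<Rightarrow> real"
  assumes s: "0 < s1" "s1 < s2" "s2 < T"
    and g: "continuous_on {0<..<T} g"
    and h: "\<And>a b. 0 < a \<Longrightarrow> b < T \<Longrightarrow> integrable (timeM a b) h"
    and weak: "\<And>\<theta> \<theta>' a b. (\<And>k. Ck_on k UNIV \<theta>) \<Longrightarrow>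
        (\<And>t. (\<theta> has_real_derivative \<theta>' t) (at t)) \<Longrightarrow> 0 < a \<Longrightarrow> b < T \<Longrightarrow>
        (\<And>t. t \<notin> {a..b} \<Longrightarrow> \<theta> t = 0) \<Longrightarrow>
        integral\<^sup>L (timeM 0 T) (\<lambda>t. \<theta>' t * g t + \<theta> t * h t) = 0"
  shows "g s2 - g s1 = integral\<^sup>L (timeM s1 s2) h"
proof -
  define d where "d = (T - s2) / 2"
  have d: "0 < d" "s2 + d < T" using s by (auto simp: d_def field_simps)
  define b where "b = (s2 + d + T) / 2"
  have b: "s2 + d < b" "b < T" using d by (auto simp: b_def)
  define a where "a = s1 / 2"
  have a: "0 < a" "a < s1" using s by (auto simp: a_def)
  define c where "c n = d / real (Suc n)" for n
  have c: "0 < c n" "c n \<le> d" for n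
    using d by (auto simp: c_def field_simps)
  have c0: "c \<longlonglongrightarrow> 0"
    unfolding c_def[abs_def] by (rule lim_const_over_n[THEN LIMSEQ_Suc])
  \<comment> \<open>Plateaus of height 1 with slopes of width \<open>c n\<close> to the right of \<open>s1\<close> and of \<open>s2\<close>; as \<open>c n\<close> shrinks they
    converge pointwise to the indicator of \<open>{s1<..s2}\<close>.\<close>
  define \<theta> where "\<theta> n t = step ((t - s1) / c n) - step ((t - s2) / c n)" for n t
  define D where "D s n t = dstep ((t - s) / c n) / c n" for s n t
  have Ck: "Ck_on k UNIV (\<theta> n)" for k n
  proof -
    have *: "Ck_on k UNIV (\<lambda>t. step ((- s / c n) + (1 / c n) * t))" for s
      by (intro Ck_on_comp[OF Ck_on_step] Ck_on_add Ck_on_mult Ck_on_const Ck_on_linear[of "\<lambda>t. t"]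
          bounded_linear_ident)
    have "Ck_on k UNIV (\<lambda>t. step ((- s1 / c n) + (1 / c n) * t) +
        (- 1) * step ((- s2 / c n) + (1 / c n) * t))"
      by (intro Ck_on_add Ck_on_mult Ck_on_const *)
    then show ?thesis
      unfolding \<theta>_def[abs_def] by (simp add: diff_divide_distrib)
  qed
  have der: "(\<theta> n has_real_derivative D s1 n t - D s2 n t) (at t)" for n t
  proof -
    have 1: "((\<lambda>t. (t - s) / c n) has_real_derivative 1 / c n) (at t)" for s
      using c[of n] by (auto intro!: derivative_eq_intros)
    show ?thesis
      unfolding \<theta>_def[abs_def] D_def
      using DERIV_diff[OF DERIV_chain2[OF DERIV_step 1] DERIV_chain2[OF DERIV_step 1]] by simp
  qed
  have \<theta>0: "\<theta> n t = 0" if "t \<notin> {s1..s2 + d}" for n t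
  proof (cases "t < s1")
    case True
    then have "(t - s1) / c n \<le> 0" "(t - s2) / c n \<le> 0"
      using c[of n] s by (auto intro!: divide_nonpos_pos)
    then show ?thesis by (simp add: \<theta>_def step_0)
  next
    case False
    then have "s2 + d < t" using that by auto
    then have "1 \<le> (t - s1) / c n" "1 \<le> (t - s2) / c n"
      using c[of n] s by (auto simp: pos_le_divide_eq)
    then show ?thesis by (simp add: \<theta>_def step_1)
  qed
  have step_bd: "0 \<le> step t" "step t \<le> 1" for t
    using step_mono[of 0 t] step_mono[of t 1] step_0[of t] step_1[of t] step_0[of 0] step_1[of 1]
    by (cases "t \<le> 0"; cases "t \<ge> 1"; simp)+
  have \<theta>_bd: "\<bar>\<theta> n t\<bar> \<le> 1" for n t
    using step_bd[of "(t - s1) / c n"] step_bd[of "(t - s2) / c n"] by (simp add: \<theta>_def)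
  have D0: "D s n t = 0" if "t \<notin> {s..s + d}" for s n t
  proof -
    have "(t - s) / c n \<notin> {0..1}"
      using that c[of n] by (auto simp: pos_le_divide_eq pos_divide_le_eq)
    then show ?thesis by (simp add: D_def dstep_eq_0)
  qed
  have gD: "integrable lborel (\<lambda>t. D s n t * g t)" and
    gD': "integral\<^sup>L (timeM 0 T) (\<lambda>t. D s n t * g t) = (\<integral>t. D s n t * g t \<partial>lborel)" and
    gD'': "integrable (timeM 0 T) (\<lambda>t. D s n t * g t)"
    if "s \<in> {s1, s2}" for s n
  proof -
    have sub: "{s..s + d} \<subseteq> {0<..<T}" using that s d by auto
    have "continuous_on {s..s + d} (\<lambda>t. D s n t * g t)"
      unfolding D_def using c[of n]
      by (intro continuous_intros continuous_on_subset[OF g sub]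
          continuous_on_compose2[OF continuous_dstep]) auto
    then have "integrable lborel (\<lambda>t. indicator {s..s + d} t *\<^sub>R (D s n t * g t))"
      by (intro borel_integrable_compact) auto
    moreover have "indicator {s..s + d} t *\<^sub>R (D s n t * g t) = D s n t * g t" for t
      using D0[of t s n] by (auto simp: indicator_def)
    ultimately show "integrable lborel (\<lambda>t. D s n t * g t)" by (simp only:)
    have *: "indicator {0<..<T} t *\<^sub>R (D s n t * g t) = D s n t * g t" for t
      using D0[of t s n] sub by (cases "t \<in> {s..s + d}") (auto simp: indicator_def)
    show "integral\<^sup>L (timeM 0 T) (\<lambda>t. D s n t * g t) = (\<integral>t. D s n t * g t \<partial>lborel)"
      unfolding integral_timeM set_lebesgue_integral_def * ..
    show "integrable (timeM 0 T) (\<lambda>t. D s n t * g t)"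
      unfolding integrable_timeM_iff set_integrable_def * by fact
  qed
  have h': "integrable lborel (\<lambda>t. indicator {a<..<b} t * h t)"
    using h[of a b] a b by (simp add: integrable_timeM_iff set_integrable_def)
  have \<theta>h_eq: "\<theta> n t * (indicator {a<..<b} t * h t) = \<theta> n t * h t" for n t
    using \<theta>0[of t n] a b by (cases "t \<in> {s1..s2 + d}") (auto simp: indicator_def)
  have \<theta>_meas: "\<theta> n \<in> borel_measurable borel" for n
    using Ck[of 0 n] by (auto intro: borel_measurable_continuous_onI)
  have \<theta>h: "integrable lborel (\<lambda>t. \<theta> n t * h t)" for n
  proof -
    have "integrable lborel (\<lambda>t. \<theta> n t * (indicator {a<..<b} t * h t))"
    proof (rule Bochner_Integration.integrable_bound[OF h'])
      show "(\<lambda>t. \<theta> n t * (indicator {a<..<b} t * h t)) \<in> borel_measurable lborel"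
        using \<theta>_meas by (intro borel_measurable_times[OF _ borel_measurable_integrable[OF h']]) auto
      show "AE t in lborel. norm (\<theta> n t * (indicator {a<..<b} t * h t)) \<le> norm (indicator {a<..<b} t * h t)"
        unfolding norm_mult real_norm_def[of "\<theta> n _"]
        by (intro AE_I2 mult_left_le_one_le \<theta>_bd) auto
    qed
    then show ?thesis unfolding \<theta>h_eq .
  qed
  have *: "indicator {0<..<T} t *\<^sub>R (\<theta> n t * h t) = \<theta> n t * h t" for n t
    using \<theta>0[of t n] a b s d by (cases "t \<in> {s1..s2 + d}") (auto simp: indicator_def)
  have \<theta>h': "integrable (timeM 0 T) (\<lambda>t. \<theta> n t * h t)"
    "integral\<^sup>L (timeM 0 T) (\<lambda>t. \<theta> n t * h t) = (\<integral>t. \<theta> n t * h t \<partial>lborel)" for n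
    unfolding integrable_timeM_iff set_integrable_def integral_timeM set_lebesgue_integral_def *
    using \<theta>h by auto
  have balance: "(\<integral>t. D s2 n t * g t \<partial>lborel) - (\<integral>t. D s1 n t * g t \<partial>lborel) = (\<integral>t. \<theta> n t * h t \<partial>lborel)" for n
  proof -
    have "0 = integral\<^sup>L (timeM 0 T) (\<lambda>t. (D s1 n t - D s2 n t) * g t + \<theta> n t * h t)"
      by (rule weak[OF Ck der, of s1 "s2 + d", symmetric]) (use s d \<theta>0 in auto)
    also have "\<dots> = integral\<^sup>L (timeM 0 T) (\<lambda>t. D s1 n t * g t - D s2 n t * g t + \<theta> n t * h t)"
      by (simp add: left_diff_distrib)
    also have "\<dots> = integral\<^sup>L (timeM 0 T) (\<lambda>t. D s1 n t * g t) - integral\<^sup>L (timeM 0 T) (\<lambda>t. D s2 n t * g t)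
        + integral\<^sup>L (timeM 0 T) (\<lambda>t. \<theta> n t * h t)"
      using gD'' \<theta>h' by simp
    finally show ?thesis using gD'[of s1 n] gD'[of s2 n] \<theta>h'[of n] by simp
  qed
  have lim1: "(\<lambda>n. \<integral>t. D s n t * g t \<partial>lborel) \<longlonglongrightarrow> g s" if "s \<in> {s1, s2}" for s
    unfolding D_def c_def
    by (rule rescaled_dstep_limit[OF continuous_on_subset[OF g] d(1)]) (use that s d in auto)
  have lim2: "(\<lambda>n. \<integral>t. \<theta> n t * h t \<partial>lborel) \<longlonglongrightarrow> (\<integral>t. indicator {s1<..s2} t * (indicator {a<..<b} t * h t) \<partial>lborel)"
    unfolding \<theta>h_eq[symmetric]
  proof (rule integral_dominated_convergence[where w = "\<lambda>t. norm (indicator {a<..<b} t * h t)"])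
    show "integrable lborel (\<lambda>t. norm (indicator {a<..<b} t * h t))"
      using h' by (rule integrable_norm)
    show "(\<lambda>t. indicator {s1<..s2} t * (indicator {a<..<b} t * h t)) \<in> borel_measurable lborel"
      by (intro borel_measurable_times[OF _ borel_measurable_integrable[OF h']]) auto
    show "(\<lambda>t. \<theta> n t * (indicator {a<..<b} t * h t)) \<in> borel_measurable lborel" for n
      using \<theta>_meas by (intro borel_measurable_times[OF _ borel_measurable_integrable[OF h']]) auto
    show "AE t in lborel. norm (\<theta> n t * (indicator {a<..<b} t * h t)) \<le> norm (indicator {a<..<b} t * h t)" for n
      unfolding norm_mult real_norm_def[of "\<theta> n _"]
      by (intro AE_I2 mult_left_le_one_le \<theta>_bd) auto
    show "AE t in lborel. (\<lambda>n. \<theta> n t * (indicator {a<..<b} t * h t)) \<longlonglongrightarrow>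
        indicator {s1<..s2} t * (indicator {a<..<b} t * h t)"
    proof (intro AE_I2 tendsto_mult tendsto_const)
      fix t
      have st: "(\<lambda>n. step ((t - s) / c n)) \<longlonglongrightarrow> indicator {s<..} t" for s
      proof (cases "s < t")
        case True
        then have "eventually (\<lambda>n. c n < t - s) sequentially"
          using order_tendstoD(2)[OF c0, of "t - s"] by simp
        then have "eventually (\<lambda>n. step ((t - s) / c n) = 1) sequentially"
          by eventually_elim (use c in \<open>auto intro!: step_1 simp: pos_le_divide_eq\<close>)
        then show ?thesis using True by (simp add: tendsto_eventually)
      next
        case False
        then have "step ((t - s) / c n) = 0" for n
          using c[of n] by (intro step_0 divide_nonpos_pos) auto
        then show ?thesis using False by simp
      qed
      have "(indicator {s1<..s2} t :: real) = indicator {s1<..} t - indicator {s2<..} t"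
        using s by (auto simp: indicator_def)
      then show "(\<lambda>n. \<theta> n t) \<longlonglongrightarrow> indicator {s1<..s2} t"
        unfolding \<theta>_def using tendsto_diff[OF st[of s1] st[of s2]] by simp
    qed
  qed
  have "g s2 - g s1 = (\<integral>t. indicator {s1<..s2} t * (indicator {a<..<b} t * h t) \<partial>lborel)"
    using LIMSEQ_unique[OF tendsto_diff[OF lim1[of s2] lim1[of s1]]] lim2 balance by simp
  also have "\<dots> = (\<integral>t. indicator {s1<..<s2} t *\<^sub>R h t \<partial>lborel)"
  proof (rule integral_cong_AE)
    show "(\<lambda>t. indicator {s1<..s2} t * (indicator {a<..<b} t * h t)) \<in> borel_measurable lborel"
      by (intro borel_measurable_times[OF _ borel_measurable_integrable[OF h']]) auto
    show "(\<lambda>t. indicator {s1<..<s2} t *\<^sub>R h t) \<in> borel_measurable lborel"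
      using h[of s1 s2] s by (auto simp: integrable_timeM_iff set_integrable_def)
    show "AE t in lborel. indicator {s1<..s2} t * (indicator {a<..<b} t * h t) = indicator {s1<..<s2} t *\<^sub>R h t"
      using AE_lborel_singleton[of s2] by eventually_elim (use a b d in \<open>auto simp: indicator_def\<close>)
  qed
  finally show ?thesis
    by (simp add: integral_timeM set_lebesgue_integral_def)
qed


section \<open>Test functions with separated variables\<close>

lemma Ck_on_comp_linear:
  assumes L: "bounded_linear L"
  shows "Ck_on k UNIV f \<Longrightarrow> Ck_on k UNIV (\<lambda>z. f (L z))"
proof (induction k arbitrary: f)
  case 0
  then show ?case
    using continuous_on_compose2[of UNIV f UNIV L] linear_continuous_on[OF L] by simp
next
  case (Suc k)
  show ?case
    by (rule Ck_on_SucI[OF has_derivative_compose[OF bounded_linear_imp_has_derivative[OF L]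
            Ck_on_Suc_has_derivative[OF Suc.prems]]])
      (rule Suc.IH[OF Ck_on_Suc_frechet[OF Suc.prems]])
qed

lemma integral_timeM_support:
  fixes f :: "real \<Rightarrow> real"
  assumes "c \<le> a" "b \<le> d" "\<And>t. t \<in> {c<..<d} \<Longrightarrow> t \<notin> {a<..<b} \<Longrightarrow> f t = 0"
  shows "integral\<^sup>L (timeM c d) f = integral\<^sup>L (timeM a b) f"
  unfolding integral_timeM set_lebesgue_integral_def
  using assms by (intro Bochner_Integration.integral_cong) (auto simp: indicator_def)

lemma AE_timeM_ex:
  assumes "a < b" "AE t in timeM a b. P t"
  shows "\<exists>t\<in>{a<..<b}. P t"
proof (rule ccontr)
  assume no: "\<not> ?thesis"
  have "AE t in timeM a b. False"
    using assms(2) AE_space by eventually_elim (use no in \<open>auto simp: space_timeM\<close>)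
  then have "emeasure (timeM a b) (space (timeM a b)) = 0"
    by (simp add: AE_iff_measurable[OF _ refl])
  moreover have "emeasure (timeM a b) (space (timeM a b)) = ennreal (b - a)"
    unfolding space_timeM unfolding timeM_def
    using assms(1) by (subst emeasure_restrict_space) auto
  ultimately show False using assms(1) by simp
qed

lemma AE_timeM_subset:
  assumes "AE t in timeM c d. P t" "c \<le> a" "b \<le> d"
  shows "AE t in timeM a b. P t"
  using assms unfolding AE_timeM_iff by (auto elim!: AE_mp)

lemma measurable_timeM_continuous:
  fixes g :: "real \<Rightarrow> real"
  assumes "continuous_on {a<..<b} g"
  shows "g \<in> borel_measurable (timeM a b)"
  using borel_measurable_continuous_on_restrict[OF assms]
  by (simp add: timeM_def cong: measurable_cong_sets sets_restrict_space_cong)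

lemma measurable_integral_cell:
  fixes f :: "(real ^ 'n) \<times> real \<Rightarrow> real"
  assumes "f \<in> borel_measurable (cellM \<Otimes>\<^sub>M timeM a b)"
  shows "(\<lambda>t. \<integral>x. f (x, t) \<partial>cellM) \<in> borel_measurable (timeM a b)"
  by (rule cellM.borel_measurable_lebesgue_integral)
    (use measurable_compose[OF measurable_pair_swap' assms] in \<open>simp add: split_beta'\<close>)

lemma measurable_fst_cell:
  "f \<in> borel_measurable borel \<Longrightarrow> (\<lambda>(x, t). f x) \<in> borel_measurable (cellM \<Otimes>\<^sub>M timeM a b)"
  unfolding split_beta' by (auto intro!: measurable_compose[OF measurable_fst] measurable_cellM)

lemma zero_of_integrals_zero:
  fixes d :: "real \<Rightarrow> real"
  assumes d: "continuous_on {0<..<T} d"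
    and int: "\<And>a b. 0 < a \<Longrightarrow> a < b \<Longrightarrow> b < T \<Longrightarrow> integral\<^sup>L (timeM a b) d = 0"
    and t: "t \<in> {0<..<T}"
  shows "d t = 0"
proof -
  have pos: "\<not> 0 < f t"
    if f: "continuous_on {0<..<T} f"
      and fint: "\<And>a b. 0 < a \<Longrightarrow> a < b \<Longrightarrow> b < T \<Longrightarrow> integral\<^sup>L (timeM a b) f = 0" for f :: "real \<Rightarrow> real"
  proof
    assume ft: "0 < f t"
    have "isCont f t" using f t by (simp add: continuous_on_eq_continuous_at)
    then have "eventually (\<lambda>s. f t / 2 < f s) (nhds t)"
      using ft by (intro order_tendstoD(1)[of f "f t"]) (auto simp: isCont_def tendsto_at_iff_tendsto_nhds)
    moreover have "eventually (\<lambda>s. s \<in> {0<..<T}) (nhds t)"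
      using t by (intro eventually_nhds_in_open) auto
    ultimately have "eventually (\<lambda>s. f t / 2 < f s \<and> s \<in> {0<..<T}) (nhds t)"
      by eventually_elim auto
    then obtain r where r: "0 < r" "\<And>s. dist s t < r \<Longrightarrow> f t / 2 < f s \<and> s \<in> {0<..<T}"
      unfolding eventually_nhds_metric by blast
    define a b where "a = t - r / 2" and "b = t + r / 2"
    have ab: "a < b" "0 < a" "b < T"
      using r(1) r(2)[of a] r(2)[of b] by (auto simp: a_def b_def dist_real_def)
    have in_r: "f t / 2 < f s" if "s \<in> {a..b}" for s
      using r(1) that by (intro r(2)[THEN conjunct1]) (auto simp: a_def b_def dist_real_def abs_less_iff)
    have "set_integrable lborel {a..b} f"
      unfolding set_integrable_def
      using ab by (intro borel_integrable_compact continuous_on_subset[OF f]) auto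
    then have "integrable (timeM a b) f"
      unfolding integrable_timeM_iff by (rule set_integrable_subset) auto
    moreover have "integrable (timeM a b) (\<lambda>_. f t / 2)" by simp
    ultimately have "integral\<^sup>L (timeM a b) (\<lambda>_. f t / 2) \<le> integral\<^sup>L (timeM a b) f"
      by (intro Bochner_Integration.integral_mono) (use in_r in \<open>auto simp: space_timeM less_imp_le\<close>)
    also have "\<dots> = 0" using ab by (intro fint)
    finally have "measure (timeM a b) (space (timeM a b)) * (f t / 2) \<le> 0" by simp
    moreover have "measure (timeM a b) (space (timeM a b)) = b - a"
      unfolding space_timeM unfolding timeM_def using ab
      by (subst measure_restrict_space) auto
    ultimately show False using ab ft by (simp add: mult_le_0_iff)
  qed
  have "\<not> 0 < d t" by (rule pos[OF d int])
  moreover have "\<not> 0 < - d t"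
    by (rule pos) (auto intro!: continuous_intros d int)
  ultimately show ?thesis by linarith
qed

lemma bounded_in_torus_L2:
  fixes f :: "real ^ 'n \<Rightarrow> 'b::euclidean_space"
  assumes "periodic f" "f \<in> borel_measurable borel" "\<And>x. norm (f x) \<le> c"
  shows "f \<in> torus_L2"
proof -
  have "integrable cellM (\<lambda>x. (norm (f x))\<^sup>2)"
  proof (rule cellM.integrable_const_bound[of _ "c\<^sup>2"])
    show "AE x in cellM. norm ((norm (f x))\<^sup>2) \<le> c\<^sup>2"
      using assms(3) by (auto intro!: power_mono)
    show "(\<lambda>x. (norm (f x))\<^sup>2) \<in> borel_measurable cellM"
      using assms(2) by (intro measurable_cellM) measurable
  qed
  then show ?thesis using assms by (simp add: torus_L2_def integrable_cellM_iff)
qed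

text \<open>The gradient is carried along as an argument, with a common uniform bound, so that later integrals mention
neither \<open>frechet_derivative\<close> nor an argument of compactness.\<close>
definition smooth_periodic :: "(real ^ 'n \<Rightarrow> real) \<Rightarrow> ('n \<Rightarrow> real ^ 'n \<Rightarrow> real) \<Rightarrow> bool" where
  "smooth_periodic \<phi> D \<longleftrightarrow> (\<forall>k. Ck_on k UNIV \<phi>) \<and> periodic \<phi> \<and>
     (\<forall>x. (\<phi> has_derivative (\<lambda>w. \<Sum>i\<in>UNIV. D i x * w $ i)) (at x)) \<and>
     (\<forall>i. continuous_on UNIV (D i) \<and> periodic (D i)) \<and>
     (\<exists>c. \<forall>x. \<bar>\<phi> x\<bar> \<le> c \<and> (\<forall>i. \<bar>D i x\<bar> \<le> c))"

lemma smooth_periodic_kern: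
  assumes "0 < e"
  shows "smooth_periodic (\<lambda>x. kern e (x - y)) (\<lambda>i x. dkern e i (x - y))"
  unfolding smooth_periodic_def
proof (intro conjI allI exI)
  show "\<bar>kern e (x - y)\<bar> \<le> max 1 (32 / e)" for x
    using kern_nonneg[of e "x - y"] kern_le_1[of e "x - y"] by simp
  show "\<bar>dkern e i (x - y)\<bar> \<le> max 1 (32 / e)" for x i
    using dkern_bound[OF assms, of i "x - y"] by simp
qed (auto intro!: Ck_on_kern_shift periodic_kern_shift has_derivative_kern_shift periodic_dkern_shift
    continuous_intros)

lemma separated_test_function:
  fixes \<phi> :: "real ^ 'n \<Rightarrow> real" and \<theta> :: "real \<Rightarrow> real" and e :: "'b::euclidean_space"
  assumes \<phi>: "smooth_periodic \<phi> D"
    and \<theta>: "\<And>k. Ck_on k UNIV \<theta>" "\<And>t. (\<theta> has_real_derivative \<theta>' t) (at t)"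
    and supp: "0 < a" "b < T" "\<forall>t. t \<notin> {a..b} \<longrightarrow> \<theta> t = 0"
  shows "test_function T (\<lambda>z. (\<theta> (snd z) * \<phi> (fst z)) *\<^sub>R e)"
    and "dt (\<lambda>z. (\<theta> (snd z) * \<phi> (fst z)) *\<^sub>R e) x t = (\<theta>' t * \<phi> x) *\<^sub>R e"
    and "dx i (\<lambda>z. (\<theta> (snd z) * \<phi> (fst z)) *\<^sub>R e) x t = (\<theta> t * D i x) *\<^sub>R e"
proof -
  let ?\<psi> = "\<lambda>z. (\<theta> (snd z) * \<phi> (fst z)) *\<^sub>R e"
  have "Ck_on k UNIV ?\<psi>" for k
    using \<phi> unfolding smooth_periodic_def
    by (intro Ck_on_linear_comp[OF bounded_linear_scaleR_left] Ck_on_mult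
        Ck_on_comp_linear[OF bounded_linear_snd \<theta>(1)] Ck_on_comp_linear[OF bounded_linear_fst]) auto
  then have "smooth_on (UNIV \<times> {0<..<T}) ?\<psi>"
    unfolding smooth_on_def by (auto intro: Ck_on_subset)
  moreover have "\<exists>K. compact K \<and> K \<subseteq> {0<..<T} \<and> (\<forall>x. \<forall>t\<in>{0<..<T} - K. ?\<psi> (x, t) = 0)"
    using supp by (intro exI[of _ "{a..b}"]) auto
  moreover have "periodic (\<lambda>x. ?\<psi> (x, t))" for t
    using \<phi> by (simp add: smooth_periodic_def periodic_def)
  ultimately show "test_function T ?\<psi>"
    unfolding test_function_def by blast
  have 1: "((\<lambda>z. \<theta> (snd z)) has_derivative (\<lambda>w. snd w * \<theta>' t)) (at (x, t))"
    using DERIV_compose_FDERIV[of \<theta> "\<theta>' t" snd "(x, t)" snd UNIV] \<theta>(2)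
    by (simp add: bounded_linear_imp_has_derivative bounded_linear_snd)
  have \<phi>d: "(\<phi> has_derivative (\<lambda>w. \<Sum>i\<in>UNIV. D i x * w $ i)) (at (fst (x, t)))"
    using \<phi> by (simp add: smooth_periodic_def)
  have 2: "((\<lambda>z. \<phi> (fst z)) has_derivative (\<lambda>w. \<Sum>i\<in>UNIV. D i x * fst w $ i)) (at (x, t))"
    using has_derivative_compose[OF bounded_linear_imp_has_derivative[OF bounded_linear_fst] \<phi>d] .
  have "(?\<psi> has_derivative (\<lambda>w. (\<theta> (snd (x, t)) * (\<Sum>i\<in>UNIV. D i x * fst w $ i) +
      snd w * \<theta>' t * \<phi> (fst (x, t))) *\<^sub>R e)) (at (x, t))"
    by (rule bounded_linear.has_derivative[OF bounded_linear_scaleR_left has_derivative_mult[OF 1 2]])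
  from frechet_derivative_at[OF this]
  have fd: "frechet_derivative ?\<psi> (at (x, t)) = (\<lambda>w. (\<theta> (snd (x, t)) * (\<Sum>i\<in>UNIV. D i x * fst w $ i) +
      snd w * \<theta>' t * \<phi> (fst (x, t))) *\<^sub>R e)" by simp
  show "dt ?\<psi> x t = (\<theta>' t * \<phi> x) *\<^sub>R e"
    unfolding dt_def fd by simp
  have "(\<Sum>k\<in>UNIV. D k x * axis i 1 $ k) = D i x"
    by (simp add: axis_def if_distrib cong: if_cong)
  then show "dx i ?\<psi> x t = (\<theta> t * D i x) *\<^sub>R e"
    unfolding dx_def fd by simp
qed

lemma DERIV_zero_outside:
  assumes "\<And>t. t \<notin> {a..b} \<Longrightarrow> \<theta> t = 0" "(\<theta> has_real_derivative d) (at t)" "t \<notin> {a..b}"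
  shows "d = 0"
proof -
  have "open (- {a..b})" by auto
  then have "((\<lambda>_. 0) has_real_derivative d) (at t)"
    using assms by (auto intro: has_field_derivative_transform_within_open[OF assms(2)])
  then show ?thesis using DERIV_unique[OF _ DERIV_const] by blast
qed


section \<open>Integrability of weak solutions\<close>

lemma torus_L2_dest:
  assumes "f \<in> torus_L2"
  shows "periodic f" "f \<in> borel_measurable borel" "integrable cellM (\<lambda>x. (norm (f x))\<^sup>2)"
  using assms by (auto simp: torus_L2_def integrable_cellM_iff)

lemma torus_L2_integrable_inner:
  assumes "f \<in> torus_L2" "g \<in> torus_L2"
  shows "integrable cellM (\<lambda>x. f x \<bullet> g x)"
proof (rule Bochner_Integration.integrable_bound)
  show "integrable cellM (\<lambda>x. (norm (f x))\<^sup>2 + (norm (g x))\<^sup>2)"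
    using assms by (intro Bochner_Integration.integrable_add torus_L2_dest)
  have [measurable]: "f \<in> borel_measurable cellM" "g \<in> borel_measurable cellM"
    using assms by (auto intro: measurable_cellM torus_L2_dest)
  show "(\<lambda>x. f x \<bullet> g x) \<in> borel_measurable cellM" by measurable
  have "\<bar>f x \<bullet> g x\<bar> \<le> (norm (f x))\<^sup>2 + (norm (g x))\<^sup>2" for x
  proof -
    have "\<bar>f x \<bullet> g x\<bar> \<le> norm (f x) * norm (g x)" by (rule Cauchy_Schwarz_ineq2)
    also have "\<dots> \<le> 2 * (norm (f x) * norm (g x))" by simp
    also have "\<dots> \<le> (norm (f x))\<^sup>2 + (norm (g x))\<^sup>2"
      using sum_squares_bound[of "norm (f x)" "norm (g x)"] by simp
    finally show ?thesis .
  qed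
  then show "AE x in cellM. norm (f x \<bullet> g x) \<le> norm ((norm (f x))\<^sup>2 + (norm (g x))\<^sup>2)"
    by (auto intro: AE_I2 order_trans)
qed

lemma torus_L2_const: "(\<lambda>_. c) \<in> torus_L2"
  by (rule bounded_in_torus_L2[where c = "norm c"]) (auto simp: periodic_def)

lemma torus_L2_integrable_component:
  fixes f :: "real ^ 'n \<Rightarrow> real ^ 'm"
  assumes "f \<in> torus_L2"
  shows "integrable cellM (\<lambda>x. f x $ j)"
  using torus_L2_integrable_inner[OF assms torus_L2_const, of "axis j 1"]
  by (simp add: inner_axis)

locale euler_solution =
  fixes T :: real and u v :: "real \<Rightarrow> real ^ 'n \<Rightarrow> real ^ 'n" and p :: "real \<Rightarrow> real ^ 'n \<Rightarrow> real"
  assumes T: "0 < T"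
    and euler: "weak_euler_solution T u p"
    and rep: "weakly_continuous_representative T u v"
begin

lemma v_L2: "t \<in> {0<..<T} \<Longrightarrow> v t \<in> torus_L2"
  using rep by (simp add: weakly_continuous_representative_def)

lemma v_weakly_continuous:
  "\<phi> \<in> torus_L2 \<Longrightarrow> continuous_on {0<..<T} (\<lambda>t. integral\<^sup>L cellM (\<lambda>x. v t x \<bullet> \<phi> x))"
  using rep by (simp add: weakly_continuous_representative_def torus_integral_eq)

lemma AE_v_eq_u: "AE t in timeM 0 T. AE x in cellM. v t x = u t x"
  unfolding AE_timeM_iff using rep
  by (auto simp: weakly_continuous_representative_def elim!: eventually_mono intro: AE_cellM)

lemma u_bound: "\<exists>C. AE t in timeM 0 T. u t \<in> torus_L2 \<and> integral\<^sup>L cellM (\<lambda>x. (norm (u t x))\<^sup>2) \<le> C"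
proof -
  obtain C where C: "AE t\<in>{0<..<T} in lborel. u t \<in> torus_L2 \<and> torus_L2_norm (u t) \<le> C"
    using euler by (auto simp: weak_euler_solution_def Linf_L2_def)
  have "integral\<^sup>L cellM (\<lambda>x. (norm (u t x))\<^sup>2) \<le> C\<^sup>2" if "torus_L2_norm (u t) \<le> C" for t
    using that by (simp add: torus_L2_norm_def torus_integral_eq sqrt_le_D)
  then show ?thesis
    unfolding AE_timeM_iff using C by (intro exI[of _ "C\<^sup>2"]) (auto elim!: eventually_mono)
qed

lemma measurable_u:
  assumes "0 \<le> a" "b \<le> T"
  shows "(\<lambda>(x, t). u t x) \<in> borel_measurable (cellM \<Otimes>\<^sub>M timeM a b)"
  unfolding cellM_def timeM_def
proof (rule measurable_restrict_pair)
  have 1: "set_borel_measurable borel (UNIV \<times> {0<..<T}) (\<lambda>(x, t). u t x)"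
    using euler by (auto simp: weak_euler_solution_def Linf_L2_def)
  have "(\<lambda>z. indicator (torus_cell \<times> {a<..<b}) z *\<^sub>R (indicator (UNIV \<times> {0<..<T}) z *\<^sub>R (case z of (x, t) \<Rightarrow> u t x)))
      \<in> borel_measurable borel"
    by (rule borel_measurable_scaleR[OF borel_measurable_indicator 1[unfolded set_borel_measurable_def]])
      (auto simp: borel_prod[symmetric] intro!: pair_measureI)
  moreover have "indicator (torus_cell \<times> {a<..<b}) z *\<^sub>R (indicator (UNIV \<times> {0<..<T}) z *\<^sub>R (case z of (x, t) \<Rightarrow> u t x))
     = (indicator (torus_cell \<times> {a<..<b}) z *\<^sub>R (case z of (x, t) \<Rightarrow> u t x))" for z
    using assms by (cases z) (auto simp: indicator_def)
  ultimately show "set_borel_measurable borel (torus_cell \<times> {a<..<b}) (\<lambda>(x, t). u t x)"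
    unfolding set_borel_measurable_def by (simp only:)
qed

text \<open>The norm bound holds at almost every time, so integrating over space first gives a bounded function of time
on a bounded interval.\<close>
lemma integrable_u_square:
  assumes "0 \<le> a" "b \<le> T"
  shows "integrable (cellM \<Otimes>\<^sub>M timeM a b) (\<lambda>(x, t). (norm (u t x))\<^sup>2)"
proof -
  interpret tc: pair_sigma_finite "timeM a b" "cellM :: (real ^ 'n) measure" ..
  obtain C where C: "AE t in timeM 0 T. u t \<in> torus_L2 \<and> integral\<^sup>L cellM (\<lambda>x. (norm (u t x))\<^sup>2) \<le> C"
    using u_bound by blast
  have meas: "(\<lambda>(x, t). (norm (u t x))\<^sup>2) \<in> borel_measurable (cellM \<Otimes>\<^sub>M timeM a b)"
    using measurable_u[OF assms] by (simp add: split_beta')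
  have "integrable (timeM a b \<Otimes>\<^sub>M cellM) (\<lambda>(t, x). (norm (u t x))\<^sup>2)"
  proof (rule tc.Fubini_integrable)
    show "(\<lambda>(t, x). (norm (u t x))\<^sup>2) \<in> borel_measurable (timeM a b \<Otimes>\<^sub>M cellM)"
      using measurable_compose[OF measurable_pair_swap' meas] by (simp add: split_beta')
    have Cab: "AE t in timeM a b. u t \<in> torus_L2 \<and> integral\<^sup>L cellM (\<lambda>x. (norm (u t x))\<^sup>2) \<le> C"
      using AE_timeM_subset[OF C] assms by blast
    show "integrable (timeM a b) (\<lambda>t. \<integral>x. norm (case (t, x) of (t, x) \<Rightarrow> (norm (u t x))\<^sup>2) \<partial>cellM)"
    proof (rule timeM.integrable_const_bound[of _ C])
      show "AE t in timeM a b. norm (\<integral>x. norm (case (t, x) of (t, x) \<Rightarrow> (norm (u t x))\<^sup>2) \<partial>cellM) \<le> C"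
        using Cab by eventually_elim auto
      show "(\<lambda>t. \<integral>x. norm (case (t, x) of (t, x) \<Rightarrow> (norm (u t x))\<^sup>2) \<partial>cellM) \<in> borel_measurable (timeM a b)"
        using measurable_integral_cell[OF meas] by simp
    qed
    show "AE t in timeM a b. integrable cellM (\<lambda>x. case (t, x) of (t, x) \<Rightarrow> (norm (u t x))\<^sup>2)"
      using Cab by eventually_elim (simp add: torus_L2_dest)
  qed
  from tc.integrable_product_swap[OF this] show ?thesis by (simp add: split_beta')
qed

lemma integrable_p:
  assumes "0 < a" "b < T"
  shows "integrable (cellM \<Otimes>\<^sub>M timeM a b) (\<lambda>(x, t). p t x)"
  unfolding cellM_def timeM_def
proof (rule integrable_restrict_pair)
  have "compact ((torus_cell :: (real ^ 'n) set) \<times> {a..b})" "(torus_cell :: (real ^ 'n) set) \<times> {a..b} \<subseteq> UNIV \<times> {0<..<T}"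
    using assms by (auto intro!: compact_Times compact_torus_cell)
  then have "set_integrable lborel (torus_cell \<times> {a..b}) (\<lambda>(x, t). p t x)"
    using euler by (simp add: weak_euler_solution_def L1_loc_def)
  then show "set_integrable lborel (torus_cell \<times> {a<..<b}) (\<lambda>(x, t). p t x)"
    by (rule set_integrable_subset) (auto simp: borel_prod[symmetric] intro!: pair_measureI)
qed auto

lemma integrable_bounded_times:
  fixes f :: "(real ^ 'n) \<times> real \<Rightarrow> real" and \<phi> :: "real ^ 'n \<Rightarrow> real"
  assumes "integrable (cellM \<Otimes>\<^sub>M timeM a b) f" "continuous_on UNIV \<phi>" "\<And>x. \<bar>\<phi> x\<bar> \<le> c"
  shows "integrable (cellM \<Otimes>\<^sub>M timeM a b) (\<lambda>(x, t). f (x, t) * \<phi> x)"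
proof (rule Bochner_Integration.integrable_bound)
  show "integrable (cellM \<Otimes>\<^sub>M timeM a b) (\<lambda>z. c * f z)" using assms(1) by simp
  have "(\<lambda>(x, t). \<phi> x) \<in> borel_measurable (cellM \<Otimes>\<^sub>M timeM a b)"
    using assms(2) by (intro measurable_fst_cell borel_measurable_continuous_onI)
  then show "(\<lambda>(x, t). f (x, t) * \<phi> x) \<in> borel_measurable (cellM \<Otimes>\<^sub>M timeM a b)"
    using assms(1) by (simp add: split_beta')
  have "\<bar>f z * \<phi> x\<bar> \<le> \<bar>c * f z\<bar>" for z x
  proof -
    have "\<bar>\<phi> x\<bar> * \<bar>f z\<bar> \<le> \<bar>c\<bar> * \<bar>f z\<bar>"
      using assms(3)[of x] by (intro mult_right_mono) auto
    then show ?thesis by (simp add: abs_mult mult_ac)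
  qed
  then show "AE z in cellM \<Otimes>\<^sub>M timeM a b. norm (case z of (x, t) \<Rightarrow> f (x, t) * \<phi> x) \<le> norm (c * f z)"
    by (auto simp: split_beta')
qed

lemma integrable_uu:
  assumes "0 \<le> a" "b \<le> T"
  shows "integrable (cellM \<Otimes>\<^sub>M timeM a b) (\<lambda>(x, t). u t x $ i * u t x $ j)"
proof (rule Bochner_Integration.integrable_bound[OF integrable_u_square[OF assms]])
  show "(\<lambda>(x, t). u t x $ i * u t x $ j) \<in> borel_measurable (cellM \<Otimes>\<^sub>M timeM a b)"
  proof -
    have "(\<lambda>(x, t). u t x $ i) \<in> borel_measurable (cellM \<Otimes>\<^sub>M timeM a b)" for i
      using borel_measurable_continuous_on[OF continuous_on_component[OF continuous_on_id] measurable_u[OF assms]]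
      by (simp add: split_beta')
    from borel_measurable_times[OF this this] show ?thesis by (simp add: split_beta')
  qed
  have "\<bar>y $ i * y $ j\<bar> \<le> (norm y)\<^sup>2" for y :: "real ^ 'n"
    unfolding abs_mult power2_eq_square by (intro mult_mono component_le_norm_cart) auto
  then show "AE z in cellM \<Otimes>\<^sub>M timeM a b. norm (case z of (x, t) \<Rightarrow> u t x $ i * u t x $ j) \<le>
      norm (case z of (x, t) \<Rightarrow> (norm (u t x))\<^sup>2)"
    by (auto simp: split_beta')
qed

lemma integrable_u_component:
  assumes "0 \<le> a" "b \<le> T"
  shows "integrable (cellM \<Otimes>\<^sub>M timeM a b) (\<lambda>(x, t). u t x $ j)"
proof -
  interpret ctf: finite_measure "(cellM :: (real ^ 'n) measure) \<Otimes>\<^sub>M timeM a b"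
    by (intro finite_measure_pair_measure finite_measure_cellM finite_measure_timeM)
  show ?thesis
  proof (rule Bochner_Integration.integrable_bound)
    show "integrable (cellM \<Otimes>\<^sub>M timeM a b) (\<lambda>z. 1 + (case z of (x, t) \<Rightarrow> (norm (u t x))\<^sup>2))"
      using integrable_u_square[OF assms] by (intro Bochner_Integration.integrable_add) auto
    show "(\<lambda>(x, t). u t x $ j) \<in> borel_measurable (cellM \<Otimes>\<^sub>M timeM a b)"
      using borel_measurable_continuous_on[OF continuous_on_component[OF continuous_on_id] measurable_u[OF assms]]
      by (simp add: split_beta')
    have "\<bar>y $ j\<bar> \<le> 1 + (norm y)\<^sup>2" for y :: "real ^ 'n"
    proof -
      have "\<bar>y $ j\<bar> \<le> norm y" by (rule component_le_norm_cart)
      also have "\<dots> \<le> 2 * norm y" by simp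
      also have "\<dots> \<le> 1 + (norm y)\<^sup>2"
        using sum_squares_bound[of 1 "norm y"] by simp
      finally show ?thesis .
    qed
    then show "AE z in cellM \<Otimes>\<^sub>M timeM a b. norm (case z of (x, t) \<Rightarrow> u t x $ j) \<le>
      norm (1 + (case z of (x, t) \<Rightarrow> (norm (u t x))\<^sup>2))"
      by (auto simp: split_beta' abs_of_nonneg)
  qed
qed

end


section \<open>The momentum balance and the divergence constraint\<close>

lemma sum_mult_axis: "(\<Sum>k\<in>UNIV. f k * (a *\<^sub>R axis j (1::real)) $ k) = f j * a"
proof -
  have "f k * (a *\<^sub>R axis j (1::real)) $ k = (if k = j then f j * a else 0)" for k
    by (simp add: axis_def)
  then show ?thesis by simp
qed

context euler_solution
begin

lemma integrable_flux_density:
  assumes \<phi>: "smooth_periodic \<phi> D" and ab: "0 < a" "b < T"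
  shows "integrable (cellM \<Otimes>\<^sub>M timeM a b) (\<lambda>(x, t). (\<Sum>i\<in>UNIV. u t x $ i * u t x $ j * D i x) + p t x * D j x)"
proof -
  obtain c where c: "\<And>x i. \<bar>D i x\<bar> \<le> c" and cont: "\<And>i. continuous_on UNIV (D i)"
    using \<phi> unfolding smooth_periodic_def by blast
  have "integrable (cellM \<Otimes>\<^sub>M timeM a b) (\<lambda>z. (\<Sum>i\<in>UNIV. (case z of (x, t) \<Rightarrow> (case (x, t) of (x, t) \<Rightarrow> u t x $ i * u t x $ j) * D i x))
      + (case z of (x, t) \<Rightarrow> (case (x, t) of (x, t) \<Rightarrow> p t x) * D j x))"
    using ab by (intro Bochner_Integration.integrable_add Bochner_Integration.integrable_sum
        integrable_bounded_times[OF _ cont c] integrable_uu integrable_p) auto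
  then show ?thesis by (simp add: split_beta')
qed

text \<open>The test field is \<open>\<theta>(t) \<phi>(x)\<close> times the \<open>j\<close>-th basis vector. The left-hand side is formed with the weakly
continuous representative, which makes the identity hold for all pairs of times rather than almost all.\<close>
lemma momentum_increment:
  assumes \<phi>: "smooth_periodic \<phi> D" and s: "0 < s1" "s1 < s2" "s2 < T"
  shows "integral\<^sup>L cellM (\<lambda>x. v s2 x $ j * \<phi> x) - integral\<^sup>L cellM (\<lambda>x. v s1 x $ j * \<phi> x) =
    integral\<^sup>L (timeM s1 s2) (\<lambda>t. integral\<^sup>L cellM
      (\<lambda>x. (\<Sum>i\<in>UNIV. u t x $ i * u t x $ j * D i x) + p t x * D j x))"
proof (rule increment_of_weak_derivative[OF s])
  obtain c where c: "\<And>x. \<bar>\<phi> x\<bar> \<le> c" using \<phi> unfolding smooth_periodic_def by blast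
  have \<phi>c: "continuous_on UNIV \<phi>"
    using \<phi> unfolding smooth_periodic_def by (metis Ck_on.simps(1))
  have "(\<lambda>x. \<phi> x *\<^sub>R (axis j 1 :: real ^ 'n)) \<in> torus_L2"
  proof (rule bounded_in_torus_L2)
    show "periodic (\<lambda>x. \<phi> x *\<^sub>R (axis j 1 :: real ^ 'n))"
      using \<phi> by (simp add: smooth_periodic_def periodic_def)
    show "(\<lambda>x. \<phi> x *\<^sub>R (axis j 1 :: real ^ 'n)) \<in> borel_measurable borel"
      using \<phi>c by (intro borel_measurable_continuous_onI continuous_intros)
    show "norm (\<phi> x *\<^sub>R (axis j 1 :: real ^ 'n)) \<le> c" for x using c by simp
  qed
  from v_weakly_continuous[OF this]
  show g: "continuous_on {0<..<T} (\<lambda>t. integral\<^sup>L cellM (\<lambda>x. v t x $ j * \<phi> x))"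
    by (simp add: inner_axis mult.commute)
  let ?h = "\<lambda>t. integral\<^sup>L cellM (\<lambda>x. (\<Sum>i\<in>UNIV. u t x $ i * u t x $ j * D i x) + p t x * D j x)"
  show "integrable (timeM a b) ?h" if "0 < a" "b < T" for a b
    using ct.integrable_snd[OF integrable_flux_density[OF \<phi> that]] .
  fix \<theta> \<theta>' :: "real \<Rightarrow> real" and a' b'
  assume \<theta>: "\<And>k. Ck_on k UNIV \<theta>" "\<And>t. (\<theta> has_real_derivative \<theta>' t) (at t)"
    and supp: "0 < a'" "b' < T" "\<And>t. t \<notin> {a'..b'} \<Longrightarrow> \<theta> t = 0"
  \<comment> \<open>The pressure is integrable only on compact time intervals, so the integrals are moved to an interval
    \<open>{a<..<b}\<close> with \<open>0 < a\<close> and \<open>b < T\<close> outside of which both \<open>\<theta>\<close> and \<open>\<theta>'\<close> vanish.\<close>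
  define a b where "a = a' / 2" and "b = (b' + T) / 2"
  have ab: "0 < a" "a < a'" "b' < b" "b < T" using supp by (auto simp: a_def b_def)
  have zero: "\<theta> t = 0" "\<theta>' t = 0" if "t \<notin> {a<..<b}" for t
  proof -
    have "t \<notin> {a'..b'}" using that ab by auto
    then show "\<theta> t = 0" "\<theta>' t = 0"
      using supp(3) DERIV_zero_outside[OF supp(3) \<theta>(2)] by auto
  qed
  let ?F = "\<lambda>(x, t). (\<Sum>i\<in>UNIV. u t x $ i * u t x $ j * D i x) + p t x * D j x"
  let ?U = "\<lambda>(x, t). u t x $ j * \<phi> x"
  have F: "integrable (cellM \<Otimes>\<^sub>M timeM a b) ?F"
    using integrable_flux_density[OF \<phi>] ab by simp
  have U: "integrable (cellM \<Otimes>\<^sub>M timeM a b) ?U"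
    using integrable_bounded_times[OF integrable_u_component \<phi>c c, of a b j] ab by simp
  have "continuous_on UNIV \<theta>" using \<theta>(1)[of 0] by simp
  then have \<theta>m: "\<theta> \<in> borel_measurable (timeM a b)"
    by (intro measurable_timeM_continuous) (auto intro: continuous_on_subset)
  have "\<theta>' t = frechet_derivative \<theta> (at t) 1" for t
    using frechet_derivative_at[OF \<theta>(2)[unfolded has_field_derivative_def]] by (metis mult.right_neutral)
  then have "continuous_on UNIV \<theta>'"
    using \<theta>(1)[of 1] by simp
  then have \<theta>'m: "\<theta>' \<in> borel_measurable (timeM a b)"
    by (intro measurable_timeM_continuous) (auto intro: continuous_on_subset)
  have supp3: "\<forall>t. t \<notin> {a'..b'} \<longrightarrow> \<theta> t = 0" using supp(3) by blast
  let ?\<psi> = "\<lambda>z. (\<theta> (snd z) * \<phi> (fst z)) *\<^sub>R (axis j 1 :: real ^ 'n)"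
  let ?I = "\<lambda>t. integral\<^sup>L cellM (\<lambda>x. \<theta>' t * (u t x $ j * \<phi> x) +
       \<theta> t * ((\<Sum>i\<in>UNIV. u t x $ i * u t x $ j * D i x) + p t x * D j x))"
  note test = separated_test_function[OF \<phi> \<theta> supp(1,2) supp3]
  have "0 = integral\<^sup>L (timeM 0 T) (\<lambda>t. torus_integral (\<lambda>x.
            u t x \<bullet> dt ?\<psi> x t
          + (\<Sum>i\<in>UNIV. \<Sum>k\<in>UNIV. u t x $ i * u t x $ k * dx i ?\<psi> x t $ k)
          + p t x * (\<Sum>i\<in>UNIV. dx i ?\<psi> x t $ i)))"
    using euler[unfolded weak_euler_solution_def, THEN conjunct2, THEN conjunct2, THEN conjunct2,
        rule_format, OF test(1)] unfolding integral_timeM by (rule sym)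
  also have "\<dots> = integral\<^sup>L (timeM 0 T) ?I"
  proof -
    have "u t x \<bullet> dt ?\<psi> x t
          + (\<Sum>i\<in>UNIV. \<Sum>k\<in>UNIV. u t x $ i * u t x $ k * dx i ?\<psi> x t $ k)
          + p t x * (\<Sum>i\<in>UNIV. dx i ?\<psi> x t $ i) =
        \<theta>' t * (u t x $ j * \<phi> x) +
        \<theta> t * ((\<Sum>i\<in>UNIV. u t x $ i * u t x $ j * D i x) + p t x * D j x)" for t x
    proof -
      have 1: "u t x \<bullet> dt ?\<psi> x t = \<theta>' t * (u t x $ j * \<phi> x)"
        unfolding test(2) by (simp add: inner_axis)
      have 2: "(\<Sum>i\<in>UNIV. \<Sum>k\<in>UNIV. u t x $ i * u t x $ k * dx i ?\<psi> x t $ k) =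
          \<theta> t * (\<Sum>i\<in>UNIV. u t x $ i * u t x $ j * D i x)"
        unfolding test(3) sum_mult_axis sum_distrib_left by (intro sum.cong) (simp_all add: mult_ac)
      have 3: "(\<Sum>i\<in>UNIV. dx i ?\<psi> x t $ i) = \<theta> t * D j x"
        unfolding test(3) using sum_mult_axis[of "\<lambda>i. \<theta> t * D i x" 1 j] by simp
      show ?thesis unfolding 1 2 3 by (simp add: distrib_left mult_ac)
    qed
    then show ?thesis by (simp add: torus_integral_eq)
  qed
  also have "\<dots> = integral\<^sup>L (timeM a b) ?I"
    using ab zero by (intro integral_timeM_support) auto
  also have "\<dots> = integral\<^sup>L (timeM a b) (\<lambda>t. \<theta>' t * integral\<^sup>L cellM (\<lambda>x. v t x $ j * \<phi> x) + \<theta> t * ?h t)"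
  proof (rule integral_cong_AE)
    have \<theta>2: "(\<lambda>z. \<theta> (snd z)) \<in> borel_measurable (cellM \<Otimes>\<^sub>M timeM a b)"
      "(\<lambda>z. \<theta>' (snd z)) \<in> borel_measurable (cellM \<Otimes>\<^sub>M timeM a b)"
      using \<theta>m \<theta>'m by (auto intro: measurable_compose[OF measurable_snd])
    have "(\<lambda>z. \<theta>' (snd z) * ?U z + \<theta> (snd z) * ?F z) \<in> borel_measurable (cellM \<Otimes>\<^sub>M timeM a b)"
      by (intro borel_measurable_add borel_measurable_times[OF \<theta>2(1) borel_measurable_integrable[OF F]]
          borel_measurable_times[OF \<theta>2(2) borel_measurable_integrable[OF U]])
    from measurable_integral_cell[OF this] show "?I \<in> borel_measurable (timeM a b)" by simp
    have "(\<lambda>t. integral\<^sup>L cellM (\<lambda>x. v t x $ j * \<phi> x)) \<in> borel_measurable (timeM a b)"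
      using ab by (intro measurable_timeM_continuous continuous_on_subset[OF g]) auto
    moreover have "?h \<in> borel_measurable (timeM a b)"
      using ct.integrable_snd[OF F] by (rule borel_measurable_integrable)
    ultimately show "(\<lambda>t. \<theta>' t * integral\<^sup>L cellM (\<lambda>x. v t x $ j * \<phi> x) + \<theta> t * ?h t) \<in> borel_measurable (timeM a b)"
      using \<theta>m \<theta>'m by (intro borel_measurable_add borel_measurable_times)
    have "AE t in timeM a b. AE x in cellM. v t x = u t x"
      using AE_timeM_subset[OF AE_v_eq_u] ab by simp
    then show "AE t in timeM a b. ?I t = \<theta>' t * integral\<^sup>L cellM (\<lambda>x. v t x $ j * \<phi> x) + \<theta> t * ?h t"
      using ct.AE_integrable_snd[OF F] ct.AE_integrable_snd[OF U] AE_space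
    proof eventually_elim
      case (elim t)
      have "v t \<in> torus_L2" using elim(4) ab by (intro v_L2) (auto simp: space_timeM)
      then have vm: "(\<lambda>x. v t x $ j * \<phi> x) \<in> borel_measurable cellM"
        using torus_L2_integrable_component[of "v t" j] \<phi>c
        by (intro borel_measurable_times borel_measurable_integrable measurable_cellM[OF borel_measurable_continuous_onI])
      have "integral\<^sup>L cellM (\<lambda>x. v t x $ j * \<phi> x) = integral\<^sup>L cellM (\<lambda>x. u t x $ j * \<phi> x)"
        using elim(1) vm borel_measurable_integrable[OF elim(3)]
        by (intro integral_cong_AE) (auto elim: eventually_mono)
      then show ?case
        using elim(2,3) by simp
    qed
  qed
  also have "\<dots> = integral\<^sup>L (timeM 0 T) (\<lambda>t. \<theta>' t * integral\<^sup>L cellM (\<lambda>x. v t x $ j * \<phi> x) + \<theta> t * ?h t)"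
    using ab zero by (intro integral_timeM_support[symmetric]) auto
  finally show "integral\<^sup>L (timeM 0 T) (\<lambda>t. \<theta>' t * integral\<^sup>L cellM (\<lambda>x. v t x $ j * \<phi> x) + \<theta> t * ?h t) = 0"
    by simp
qed

text \<open>The constraint holds at almost every time at first, and at every time by weak continuity.\<close>
lemma v_orthogonal_gradient:
  assumes \<phi>: "smooth_periodic \<phi> D" and t: "t \<in> {0<..<T}"
  shows "integral\<^sup>L cellM (\<lambda>x. \<Sum>i\<in>UNIV. v t x $ i * D i x) = 0"
proof (rule zero_of_integrals_zero[OF _ _ t])
  obtain c where c: "\<And>x i. \<bar>D i x\<bar> \<le> c" and cont: "\<And>i. continuous_on UNIV (D i)"
    using \<phi> unfolding smooth_periodic_def by blast
  let ?D = "\<lambda>x. \<chi> i. D i x"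
  have DL2: "?D \<in> torus_L2"
  proof (rule bounded_in_torus_L2)
    show "periodic ?D"
      using \<phi> by (simp add: smooth_periodic_def periodic_def)
    show "?D \<in> borel_measurable borel"
      using cont by (intro borel_measurable_continuous_onI continuous_intros)
    show "norm (?D x) \<le> real CARD('n) * c" for x
      using norm_le_l1_cart[of "?D x"] sum_bounded_above[of UNIV "\<lambda>i. \<bar>D i x\<bar>" c] c
      by (auto intro: order_trans)
  qed
  let ?d = "\<lambda>t. integral\<^sup>L cellM (\<lambda>x. \<Sum>i\<in>UNIV. v t x $ i * D i x)"
  show d: "continuous_on {0<..<T} ?d"
    using v_weakly_continuous[OF DL2] by (simp add: inner_vec_def)
  fix a b assume ab: "0 < a" "a < b" "b < T"
  have dint: "integrable (timeM a b) ?d" if "0 < a" "b < T" for a b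
  proof -
    have "set_integrable lborel {a..b} ?d"
      unfolding set_integrable_def
      using that by (intro borel_integrable_compact continuous_on_subset[OF d]) auto
    then show ?thesis
      unfolding integrable_timeM_iff by (rule set_integrable_subset) auto
  qed
  \<comment> \<open>The constraint says that \<open>?d\<close>, as a distribution in time, is the derivative of the constant 0.\<close>
  have "0 - 0 = integral\<^sup>L (timeM a b) ?d"
  proof (rule increment_of_weak_derivative[OF ab, of "\<lambda>_. 0" ?d])
    fix \<theta> \<theta>' :: "real \<Rightarrow> real" and a' b'
    assume \<theta>: "\<And>k. Ck_on k UNIV \<theta>" "\<And>t. (\<theta> has_real_derivative \<theta>' t) (at t)"
      and supp: "0 < a'" "b' < T" "\<And>t. t \<notin> {a'..b'} \<Longrightarrow> \<theta> t = 0"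
    have supp3: "\<forall>t. t \<notin> {a'..b'} \<longrightarrow> \<theta> t = 0" using supp(3) by blast
    let ?\<psi> = "\<lambda>z. (\<theta> (snd z) * \<phi> (fst z)) *\<^sub>R (1::real)"
    note test = separated_test_function[OF \<phi> \<theta> supp(1,2) supp3, where e = "1::real"]
    have "continuous_on UNIV \<theta>" using \<theta>(1)[of 0] by simp
    then have \<theta>m: "\<theta> \<in> borel_measurable (timeM 0 T)"
      by (intro measurable_timeM_continuous) (auto intro: continuous_on_subset)
    have U: "integrable (cellM \<Otimes>\<^sub>M timeM 0 T) (\<lambda>(x, t). \<Sum>i\<in>UNIV. u t x $ i * D i x)"
    proof -
      have "integrable (cellM \<Otimes>\<^sub>M timeM 0 T) (\<lambda>z. \<Sum>i\<in>UNIV. case z of (x, t) \<Rightarrow> (case (x, t) of (x, t) \<Rightarrow> u t x $ i) * D i x)"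
        by (intro Bochner_Integration.integrable_sum integrable_bounded_times[OF _ cont c] integrable_u_component) auto
      then show ?thesis by (simp add: split_beta')
    qed
    have "integral\<^sup>L (timeM 0 T) (\<lambda>t. \<theta>' t * 0 + \<theta> t * ?d t) =
        integral\<^sup>L (timeM 0 T) (\<lambda>t. \<theta> t * integral\<^sup>L cellM (\<lambda>x. \<Sum>i\<in>UNIV. u t x $ i * D i x))"
    proof (rule integral_cong_AE)
      show "(\<lambda>t. \<theta>' t * 0 + \<theta> t * ?d t) \<in> borel_measurable (timeM 0 T)"
        using borel_measurable_times[OF \<theta>m measurable_timeM_continuous[OF d]] by simp
      show "(\<lambda>t. \<theta> t * integral\<^sup>L cellM (\<lambda>x. \<Sum>i\<in>UNIV. u t x $ i * D i x)) \<in> borel_measurable (timeM 0 T)"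
        by (intro borel_measurable_times[OF \<theta>m] borel_measurable_integrable ct.integrable_snd[OF U])
      show "AE t in timeM 0 T. \<theta>' t * 0 + \<theta> t * ?d t = \<theta> t * integral\<^sup>L cellM (\<lambda>x. \<Sum>i\<in>UNIV. u t x $ i * D i x)"
        using AE_v_eq_u ct.AE_integrable_snd[OF U] AE_space
      proof eventually_elim
        case (elim t)
        have "v t \<in> torus_L2" using elim(3) by (intro v_L2) (auto simp: space_timeM)
        from borel_measurable_integrable[OF torus_L2_integrable_inner[OF this DL2]]
        have "(\<lambda>x. \<Sum>i\<in>UNIV. v t x $ i * D i x) \<in> borel_measurable cellM"
          by (simp add: inner_vec_def)
        then have "?d t = integral\<^sup>L cellM (\<lambda>x. \<Sum>i\<in>UNIV. u t x $ i * D i x)"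
          using elim(1) borel_measurable_integrable[OF elim(2)]
          by (intro integral_cong_AE) (auto elim: eventually_mono)
        then show ?case by simp
      qed
    qed
    also have "\<dots> = integral\<^sup>L (timeM 0 T) (\<lambda>t. torus_integral (\<lambda>x. \<Sum>i\<in>UNIV. u t x $ i *
        dx i ?\<psi> x t))"
    proof -
      have "(\<Sum>i\<in>UNIV. u t x $ i * dx i ?\<psi> x t) = \<theta> t * (\<Sum>i\<in>UNIV. u t x $ i * D i x)" for t x
        unfolding test(3) sum_distrib_left by (intro sum.cong) simp_all
      then show ?thesis by (simp add: torus_integral_eq)
    qed
    also have "\<dots> = 0"
      using euler test(1) unfolding weak_euler_solution_def weakly_div_free_def integral_timeM by blast
    finally show "integral\<^sup>L (timeM 0 T) (\<lambda>t. \<theta>' t * 0 + \<theta> t * ?d t) = 0" .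
  qed (auto intro: dint)
  then show "integral\<^sup>L (timeM a b) ?d = 0" by simp
qed

end


section \<open>Pairing the solution at two times\<close>

lemma measurable_kernel:
  fixes \<kappa> :: "real ^ 'n \<Rightarrow> real"
  assumes "continuous_on UNIV \<kappa>" "f \<in> measurable M borel" "g \<in> measurable M borel"
  shows "(\<lambda>z. \<kappa> (f z - g z)) \<in> borel_measurable M"
  by (rule measurable_compose[OF borel_measurable_diff[OF assms(2,3)] borel_measurable_continuous_onI[OF assms(1)]])

lemma measurable_id_cellM: "(\<lambda>x. x) \<in> measurable cellM borel"
  by (rule measurable_cellM) simp

lemma integrable_kernel_pair:
  fixes f g :: "real ^ 'n \<Rightarrow> real" and \<kappa> :: "real ^ 'n \<Rightarrow> real"
  assumes "integrable cellM f" "integrable cellM g" "continuous_on UNIV \<kappa>" "\<And>x. \<bar>\<kappa> x\<bar> \<le> c"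
  shows "integrable (cellM \<Otimes>\<^sub>M cellM) (\<lambda>(y, x). f y * \<kappa> (x - y) * g x)"
proof (rule integrable_product_kernel[OF cc.pair_sigma_finite_axioms assms(1,2)])
  have "(\<lambda>z. \<kappa> (snd z - fst z)) \<in> borel_measurable (cellM \<Otimes>\<^sub>M cellM)"
    by (intro measurable_kernel[OF assms(3)] measurable_compose[OF measurable_fst measurable_id_cellM]
        measurable_compose[OF measurable_snd measurable_id_cellM])
  then show "(\<lambda>(y, x). \<kappa> (x - y)) \<in> borel_measurable (cellM \<Otimes>\<^sub>M cellM)"
    by (simp add: split_beta')
  show "\<bar>\<kappa> (x - y)\<bar> \<le> c" for x y by (rule assms(4))
qed

text \<open>Convolutions with bounded kernels are admissible test fields for the weak continuity of \<open>v\<close>, even if the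
convolved function is only integrable.\<close>
lemma cell_convolution_in_torus_L2:
  fixes f :: "real ^ 'n \<Rightarrow> real" and \<kappa> :: "real ^ 'n \<Rightarrow> real"
  assumes f: "integrable cellM f" and \<kappa>: "continuous_on UNIV \<kappa>" "\<And>x. \<bar>\<kappa> x\<bar> \<le> c"
    and per: "\<And>x. periodic (\<lambda>y. \<kappa> (x - y))"
  shows "(\<lambda>y. (\<integral>x. \<kappa> (x - y) * f x \<partial>cellM) *\<^sub>R axis j (1::real)) \<in> torus_L2"
    and "\<bar>\<integral>x. \<kappa> (x - y) * f x \<partial>cellM\<bar> \<le> c * (\<integral>x. \<bar>f x\<bar> \<partial>cellM)"
proof -
  let ?W = "\<lambda>y. \<integral>x. \<kappa> (x - y) * f x \<partial>cellM"
  have W: "\<bar>?W y\<bar> \<le> c * (\<integral>x. \<bar>f x\<bar> \<partial>cellM)" for y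
  proof -
    have "\<bar>?W y\<bar> \<le> (\<integral>x. \<bar>\<kappa> (x - y) * f x\<bar> \<partial>cellM)"
      by (rule integral_abs_bound)
    also have "\<dots> \<le> (\<integral>x. c * \<bar>f x\<bar> \<partial>cellM)"
    proof (rule integral_mono')
      show "integrable cellM (\<lambda>x. c * \<bar>f x\<bar>)" using f by simp
      show "\<bar>\<kappa> (x - y) * f x\<bar> \<le> c * \<bar>f x\<bar>" for x
        unfolding abs_mult by (intro mult_right_mono \<kappa>) auto
      show "0 \<le> c * \<bar>f x\<bar>" for x
        using order_trans[OF abs_ge_zero \<kappa>(2)] by (intro mult_nonneg_nonneg) auto
    qed
    finally show ?thesis by simp
  qed
  then show "\<bar>?W y\<bar> \<le> c * (\<integral>x. \<bar>f x\<bar> \<partial>cellM)" .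
  show "(\<lambda>y. ?W y *\<^sub>R axis j (1::real)) \<in> torus_L2"
  proof (rule bounded_in_torus_L2)
    show "periodic (\<lambda>y. ?W y *\<^sub>R axis j (1::real))"
      using per by (simp add: periodic_def)
    have "(\<lambda>(y, x). \<kappa> (x - y) * f x) \<in> borel_measurable (borel \<Otimes>\<^sub>M cellM)"
    proof -
      have "(\<lambda>z. \<kappa> (snd z - fst z)) \<in> borel_measurable (borel \<Otimes>\<^sub>M cellM)"
        by (intro measurable_kernel[OF \<kappa>(1)] measurable_fst measurable_compose[OF measurable_snd measurable_id_cellM])
      from borel_measurable_times[OF this measurable_compose[OF measurable_snd borel_measurable_integrable[OF f]]]
      show ?thesis by (simp add: split_beta')
    qed
    from cellM.borel_measurable_lebesgue_integral[OF this]
    show "(\<lambda>y. ?W y *\<^sub>R axis j (1::real)) \<in> borel_measurable borel" by simp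
    show "norm (?W y *\<^sub>R axis j (1::real)) \<le> c * (\<integral>x. \<bar>f x\<bar> \<partial>cellM)" for y
      using W by simp
  qed
qed

context euler_solution
begin

text \<open>The mollified energy with its two velocity factors taken at different times, so that the equation can be
used in one of them while the other is frozen.\<close>
definition energy_pairing :: "real \<Rightarrow> real \<Rightarrow> real \<Rightarrow> real" where
  "energy_pairing e s t = (\<Sum>j\<in>UNIV. \<integral>y. \<integral>x. v t y $ j * kern e (x - y) * v s x $ j \<partial>cellM \<partial>cellM)"

text \<open>Velocity products at time \<open>s\<close> use \<open>u\<close>, which is jointly measurable in space and time; the frozen factor
uses \<open>v\<close>, which is determined at every \<open>t\<close>.\<close>
definition flux_component :: "real \<Rightarrow> 'n \<Rightarrow> 'n \<Rightarrow> real \<Rightarrow> real \<Rightarrow> real" where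
  "flux_component e i j s t = (\<integral>y. \<integral>x. v t y $ j * dkern e i (x - y) * (u s x $ i * u s x $ j) \<partial>cellM \<partial>cellM)"

definition flux :: "real \<Rightarrow> real \<Rightarrow> real \<Rightarrow> real" where
  "flux e s t = (\<Sum>j\<in>UNIV. \<Sum>i\<in>UNIV. flux_component e i j s t)"

lemma v_component: "t \<in> {0<..<T} \<Longrightarrow> integrable cellM (\<lambda>x. v t x $ j)"
  by (intro torus_L2_integrable_component v_L2)

lemma energy_pairing_integrable:
  assumes "s \<in> {0<..<T}" "t \<in> {0<..<T}"
  shows "integrable (cellM \<Otimes>\<^sub>M cellM) (\<lambda>(y, x). v t y $ j * kern e (x - y) * v s x $ j)"
proof (rule integrable_kernel_pair[where c = 1])
  show "\<bar>kern e x\<bar> \<le> 1" for x :: "real ^ 'n" by (simp add: kern_nonneg kern_le_1)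
qed (intro v_component assms continuous_kern continuous_on_id)+

lemma energy_pairing_sym:
  assumes "s \<in> {0<..<T}" "t \<in> {0<..<T}"
  shows "energy_pairing e s t = energy_pairing e t s"
  unfolding energy_pairing_def
proof (rule sum.cong[OF refl])
  fix j
  have "(\<integral>y. \<integral>x. v t y $ j * kern e (x - y) * v s x $ j \<partial>cellM \<partial>cellM) =
      (\<integral>x. \<integral>y. v t y $ j * kern e (x - y) * v s x $ j \<partial>cellM \<partial>cellM)"
    using cc.Fubini_integral[OF energy_pairing_integrable[OF assms]] by simp
  also have "\<dots> = (\<integral>x. \<integral>y. v s x $ j * kern e (y - x) * v t y $ j \<partial>cellM \<partial>cellM)"
  proof (intro Bochner_Integration.integral_cong refl)
    fix x y
    show "v t y $ j * kern e (x - y) * v s x $ j = v s x $ j * kern e (y - x) * v t y $ j"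
      using kern_even[of e x y] by simp
  qed
  finally show "(\<integral>y. \<integral>x. v t y $ j * kern e (x - y) * v s x $ j \<partial>cellM \<partial>cellM) =
    (\<integral>y. \<integral>x. v s y $ j * kern e (x - y) * v t x $ j \<partial>cellM \<partial>cellM)" .
qed

lemma spacetime_kernel_integrable:
  fixes g :: "(real ^ 'n) \<times> real \<Rightarrow> real"
  assumes e: "0 < e" and t: "t \<in> {0<..<T}" and g: "integrable (cellM \<Otimes>\<^sub>M timeM a b) g"
  shows "integrable (cellM \<Otimes>\<^sub>M (cellM \<Otimes>\<^sub>M timeM a b)) (\<lambda>(y, z). v t y $ j * dkern e i (fst z - y) * g z)"
proof (rule integrable_product_kernel[where c = "32 / e"])
  interpret R: finite_measure "(cellM :: (real ^ 'n) measure) \<Otimes>\<^sub>M timeM a b"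
    by (intro finite_measure_pair_measure finite_measure_cellM finite_measure_timeM)
  show "pair_sigma_finite cellM ((cellM :: (real ^ 'n) measure) \<Otimes>\<^sub>M timeM a b)" ..
  show "integrable cellM (\<lambda>y. v t y $ j)" by (rule v_component[OF t])
  have "(\<lambda>w. dkern e i (fst (snd w) - fst w)) \<in> borel_measurable (cellM \<Otimes>\<^sub>M (cellM \<Otimes>\<^sub>M timeM a b))"
    by (intro measurable_kernel[OF continuous_dkern[OF continuous_on_id]]
        measurable_compose[OF measurable_fst measurable_id_cellM]
        measurable_compose[OF measurable_snd measurable_compose[OF measurable_fst measurable_id_cellM]])
  then show "(\<lambda>(y, z). dkern e i (fst z - y)) \<in> borel_measurable (cellM \<Otimes>\<^sub>M (cellM \<Otimes>\<^sub>M timeM a b))"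
    by (simp add: split_beta')
  show "\<bar>dkern e i (fst z - y)\<bar> \<le> 32 / e" for y z by (rule dkern_bound[OF e])
qed (fact g)

text \<open>The integrand is absolutely integrable over all three variables, so the time integral can be taken last;
at almost every \<open>s\<close> the two space integrals may then be exchanged.\<close>
lemma flux_component_integral:
  assumes e: "0 < e" and t: "t \<in> {0<..<T}" and ab: "0 \<le> a" "b \<le> T"
  shows "integrable (timeM a b) (\<lambda>s. flux_component e i j s t)"
    and "(\<integral>y. \<integral>z. v t y $ j * dkern e i (fst z - y) * (case z of (x, s) \<Rightarrow> u s x $ i * u s x $ j)
        \<partial>(cellM \<Otimes>\<^sub>M timeM a b) \<partial>cellM) = integral\<^sup>L (timeM a b) (\<lambda>s. flux_component e i j s t)"
proof -
  interpret R: finite_measure "(cellM :: (real ^ 'n) measure) \<Otimes>\<^sub>M timeM a b"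
    by (intro finite_measure_pair_measure finite_measure_cellM finite_measure_timeM)
  interpret cR: pair_sigma_finite "cellM :: (real ^ 'n) measure" "(cellM :: (real ^ 'n) measure) \<Otimes>\<^sub>M timeM a b" ..
  let ?uu = "\<lambda>(x, s). u s x $ i * u s x $ j"
  let ?K = "\<lambda>y z. v t y $ j * dkern e i (fst z - y) * ?uu z"
  have uu: "integrable (cellM \<Otimes>\<^sub>M timeM a b) ?uu" by (rule integrable_uu[OF ab])
  have K: "integrable (cellM \<Otimes>\<^sub>M (cellM \<Otimes>\<^sub>M timeM a b)) (case_prod ?K)"
    using spacetime_kernel_integrable[OF e t uu] .
  let ?k = "\<lambda>x s. \<integral>y. ?K y (x, s) \<partial>cellM"
  have k: "integrable (cellM \<Otimes>\<^sub>M timeM a b) (case_prod ?k)"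
    using cR.integrable_snd[OF K] by (simp add: split_beta')
  have AE: "AE s in timeM a b. (\<integral>x. ?k x s \<partial>cellM) = flux_component e i j s t"
    using ct.AE_integrable_snd[OF uu]
  proof eventually_elim
    case (elim s)
    have "integrable (cellM \<Otimes>\<^sub>M cellM) (\<lambda>(y, x). v t y $ j * dkern e i (x - y) * (u s x $ i * u s x $ j))"
      by (intro integrable_kernel_pair[where c = "32 / e"] v_component t elim continuous_dkern continuous_on_id dkern_bound e)
    from cc.Fubini_integral[OF this] show ?case by (simp add: flux_component_def)
  qed
  have km: "(\<lambda>s. \<integral>x. ?k x s \<partial>cellM) \<in> borel_measurable (timeM a b)"
    using ct.integrable_snd[OF k] by (rule borel_measurable_integrable)
  have fm: "(\<lambda>s. flux_component e i j s t) \<in> borel_measurable (timeM a b)"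
  proof -
    have "(\<lambda>(s, y, x). v t y $ j * dkern e i (x - y) * (u s x $ i * u s x $ j)) \<in>
        borel_measurable (timeM a b \<Otimes>\<^sub>M (cellM \<Otimes>\<^sub>M cellM))"
    proof -
      have "(\<lambda>w. (fst (snd w), (snd (snd w), fst w))) \<in>
          measurable (timeM a b \<Otimes>\<^sub>M (cellM \<Otimes>\<^sub>M cellM)) (cellM \<Otimes>\<^sub>M (cellM \<Otimes>\<^sub>M timeM a b))"
        by measurable
      from measurable_compose[OF this borel_measurable_integrable[OF K]]
      show ?thesis by (simp add: split_beta')
    qed
    then have "(\<lambda>((s, y), x). v t y $ j * dkern e i (x - y) * (u s x $ i * u s x $ j)) \<in>
        borel_measurable ((timeM a b \<Otimes>\<^sub>M cellM) \<Otimes>\<^sub>M cellM)"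
    proof -
      assume *: "(\<lambda>(s, y, x). v t y $ j * dkern e i (x - y) * (u s x $ i * u s x $ j)) \<in>
        borel_measurable (timeM a b \<Otimes>\<^sub>M (cellM \<Otimes>\<^sub>M cellM))"
      have "(\<lambda>w. (fst (fst w), (snd (fst w), snd w))) \<in>
          measurable ((timeM a b \<Otimes>\<^sub>M cellM) \<Otimes>\<^sub>M cellM) (timeM a b \<Otimes>\<^sub>M (cellM \<Otimes>\<^sub>M cellM))"
        by measurable
      from measurable_compose[OF this *] show ?thesis by (simp add: split_beta')
    qed
    from cellM.borel_measurable_lebesgue_integral[of "\<lambda>(s, y) x. v t y $ j * dkern e i (x - y) * (u s x $ i * u s x $ j)" "timeM a b \<Otimes>\<^sub>M cellM"] this
    have "(\<lambda>(s, y). \<integral>x. v t y $ j * dkern e i (x - y) * (u s x $ i * u s x $ j) \<partial>cellM) \<in>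
        borel_measurable (timeM a b \<Otimes>\<^sub>M cellM)" by (simp add: split_beta')
    from cellM.borel_measurable_lebesgue_integral[OF this]
    show ?thesis unfolding flux_component_def .
  qed
  show "integrable (timeM a b) (\<lambda>s. flux_component e i j s t)"
    using integrable_cong_AE[OF km fm AE] ct.integrable_snd[OF k] by blast
  have "(\<integral>y. \<integral>z. ?K y z \<partial>(cellM \<Otimes>\<^sub>M timeM a b) \<partial>cellM) = (\<integral>z. \<integral>y. ?K y z \<partial>cellM \<partial>(cellM \<Otimes>\<^sub>M timeM a b))"
    using cR.Fubini_integral[OF K] by simp
  also have "\<dots> = (\<integral>s. \<integral>x. ?k x s \<partial>cellM \<partial>timeM a b)"
    using ct.integral_snd[OF k] by (simp add: split_beta')
  also have "\<dots> = integral\<^sup>L (timeM a b) (\<lambda>s. flux_component e i j s t)"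
    by (rule integral_cong_AE[OF km fm AE])
  finally show "(\<integral>y. \<integral>z. ?K y z \<partial>(cellM \<Otimes>\<^sub>M timeM a b) \<partial>cellM) = integral\<^sup>L (timeM a b) (\<lambda>s. flux_component e i j s t)" .
qed

text \<open>Integrating over \<open>y\<close> first leaves, for each \<open>z\<close>, the pairing of \<open>v t\<close> with a gradient in \<open>y\<close>: as the kernel
is even, its gradient in \<open>x\<close> is the negative of its gradient in \<open>y\<close>.\<close>
lemma pressure_drops_out:
  assumes e: "0 < e" and t: "t \<in> {0<..<T}" and g: "integrable (cellM \<Otimes>\<^sub>M timeM a b) g"
  shows "(\<Sum>j\<in>UNIV. \<integral>y. \<integral>z. v t y $ j * dkern e j (fst z - y) * g z \<partial>(cellM \<Otimes>\<^sub>M timeM a b) \<partial>cellM) = 0"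
proof -
  interpret R: finite_measure "(cellM :: (real ^ 'n) measure) \<Otimes>\<^sub>M timeM a b"
    by (intro finite_measure_pair_measure finite_measure_cellM finite_measure_timeM)
  interpret cR: pair_sigma_finite "cellM :: (real ^ 'n) measure" "(cellM :: (real ^ 'n) measure) \<Otimes>\<^sub>M timeM a b" ..
  let ?K = "\<lambda>j y z. v t y $ j * dkern e j (fst z - y) * g z"
  have K: "integrable (cellM \<Otimes>\<^sub>M (cellM \<Otimes>\<^sub>M timeM a b)) (case_prod (?K j))" for j
    using spacetime_kernel_integrable[OF e t g] .
  have "(\<Sum>j\<in>UNIV. \<integral>y. \<integral>z. ?K j y z \<partial>(cellM \<Otimes>\<^sub>M timeM a b) \<partial>cellM) =
      (\<Sum>j\<in>UNIV. \<integral>z. \<integral>y. ?K j y z \<partial>cellM \<partial>(cellM \<Otimes>\<^sub>M timeM a b))"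
    using cR.Fubini_integral[OF K] by simp
  also have "\<dots> = (\<integral>z. (\<Sum>j\<in>UNIV. \<integral>y. ?K j y z \<partial>cellM) \<partial>(cellM \<Otimes>\<^sub>M timeM a b))"
    using cR.integrable_snd[OF K] by (intro Bochner_Integration.integral_sum[symmetric]) auto
  also have "\<dots> = (\<integral>z. 0 \<partial>((cellM :: (real ^ 'n) measure) \<Otimes>\<^sub>M timeM a b))"
  proof (rule Bochner_Integration.integral_cong[OF refl])
    fix z :: "(real ^ 'n) \<times> real"
    have int: "integrable cellM (\<lambda>y. v t y $ j * dkern e j (fst z - y))" for j
    proof (rule Bochner_Integration.integrable_bound)
      show "integrable cellM (\<lambda>y. 32 / e * v t y $ j)" using v_component[OF t] by simp
      show "(\<lambda>y. v t y $ j * dkern e j (fst z - y)) \<in> borel_measurable cellM"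
        by (intro borel_measurable_times borel_measurable_integrable[OF v_component[OF t]]
            measurable_cellM borel_measurable_continuous_onI continuous_dkern continuous_intros)
      have "\<bar>dkern e j (fst z - y)\<bar> * \<bar>v t y $ j\<bar> \<le> 32 / e * \<bar>v t y $ j\<bar>" for y
        by (intro mult_right_mono dkern_bound e) auto
      then show "AE y in cellM. norm (v t y $ j * dkern e j (fst z - y)) \<le> norm (32 / e * v t y $ j)"
        using e by (simp add: abs_mult mult.commute)
    qed
    have "(\<Sum>j\<in>UNIV. \<integral>y. ?K j y z \<partial>cellM) = (\<Sum>j\<in>UNIV. (\<integral>y. v t y $ j * dkern e j (fst z - y) \<partial>cellM)) * g z"
      by (simp add: sum_distrib_right)
    also have "(\<Sum>j\<in>UNIV. (\<integral>y. v t y $ j * dkern e j (fst z - y) \<partial>cellM)) =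
        (\<integral>y. (\<Sum>j\<in>UNIV. v t y $ j * dkern e j (fst z - y)) \<partial>cellM)"
      using int by (intro Bochner_Integration.integral_sum[symmetric]) auto
    also have "\<dots> = (\<integral>y. - (\<Sum>j\<in>UNIV. v t y $ j * dkern e j (y - fst z)) \<partial>cellM)"
      using dkern_odd[of e _ "fst z"] by (simp add: sum_negf)
    also have "\<dots> = 0"
      using v_orthogonal_gradient[OF smooth_periodic_kern[OF e] t, of "fst z"] by simp
    finally show "(\<Sum>j\<in>UNIV. \<integral>y. ?K j y z \<partial>cellM) = 0" by simp
  qed
  finally show ?thesis by simp
qed

lemma energy_pairing_increment:
  assumes e: "0 < e" and s: "0 < s1" "s1 < s2" "s2 < T" and t: "t \<in> {0<..<T}"
  shows "energy_pairing e s2 t - energy_pairing e s1 t = integral\<^sup>L (timeM s1 s2) (\<lambda>s. flux e s t)"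
proof -
  let ?P = "(cellM :: (real ^ 'n) measure) \<Otimes>\<^sub>M timeM s1 s2"
  interpret R: finite_measure ?P
    by (intro finite_measure_pair_measure finite_measure_cellM finite_measure_timeM)
  interpret cR: pair_sigma_finite "cellM :: (real ^ 'n) measure" ?P ..
  have st: "s1 \<in> {0<..<T}" "s2 \<in> {0<..<T}" using s by auto
  let ?uu = "\<lambda>i j (x, s). u s x $ i * u s x $ j"
  let ?p = "\<lambda>(x, s). p s x"
  have uu: "integrable ?P (?uu i j)" for i j using s by (intro integrable_uu) auto
  have p: "integrable ?P ?p" using s by (intro integrable_p) auto
  have dk: "integrable ?P (\<lambda>z. dkern e i (fst z - y) * g z)" if "integrable ?P g" for g i y
  proof -
    have "integrable ?P (\<lambda>(x, t). g (x, t) * dkern e i (x - y))"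
      using e by (intro integrable_bounded_times[OF that, where c = "32 / e"] continuous_dkern continuous_intros dkern_bound)
    then show ?thesis by (simp add: split_beta' mult.commute)
  qed
  \<comment> \<open>The momentum balance tested with the kernel centred at \<open>y\<close>, before it is integrated against \<open>v t y\<close>.\<close>
  have M: "(\<integral>x. v s2 x $ j * kern e (x - y) \<partial>cellM) - (\<integral>x. v s1 x $ j * kern e (x - y) \<partial>cellM) =
      (\<Sum>i\<in>UNIV. \<integral>z. dkern e i (fst z - y) * ?uu i j z \<partial>?P) + (\<integral>z. dkern e j (fst z - y) * ?p z \<partial>?P)" for j y
  proof -
    note sp = smooth_periodic_kern[OF e, of y]
    have "(\<integral>x. v s2 x $ j * kern e (x - y) \<partial>cellM) - (\<integral>x. v s1 x $ j * kern e (x - y) \<partial>cellM) =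
      (\<integral>z. (case z of (x, t) \<Rightarrow> (\<Sum>i\<in>UNIV. u t x $ i * u t x $ j * dkern e i (x - y)) + p t x * dkern e j (x - y)) \<partial>?P)"
      using momentum_increment[OF sp s, of j] ct.integral_snd[OF integrable_flux_density[OF sp s(1,3), of j]]
      by simp
    also have "\<dots> = (\<integral>z. (\<Sum>i\<in>UNIV. dkern e i (fst z - y) * ?uu i j z) + dkern e j (fst z - y) * ?p z \<partial>?P)"
      by (intro Bochner_Integration.integral_cong) (auto simp: split_beta' mult_ac)
    also have "\<dots> = (\<Sum>i\<in>UNIV. \<integral>z. dkern e i (fst z - y) * ?uu i j z \<partial>?P) + (\<integral>z. dkern e j (fst z - y) * ?p z \<partial>?P)"
      using dk[OF uu] dk[OF p] by (subst Bochner_Integration.integral_add) (auto simp: Bochner_Integration.integral_sum)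
    finally show ?thesis .
  qed
  have Kint: "integrable cellM (\<lambda>y. \<integral>z. v t y $ j * dkern e i (fst z - y) * g z \<partial>?P)" if "integrable ?P g" for i j g
    using cR.integrable_fst[OF spacetime_kernel_integrable[OF e t that]] .
  have component: "(\<integral>y. \<integral>x. v t y $ j * kern e (x - y) * v s2 x $ j \<partial>cellM \<partial>cellM) -
      (\<integral>y. \<integral>x. v t y $ j * kern e (x - y) * v s1 x $ j \<partial>cellM \<partial>cellM) =
      (\<Sum>i\<in>UNIV. integral\<^sup>L (timeM s1 s2) (\<lambda>s. flux_component e i j s t)) +
      (\<integral>y. \<integral>z. v t y $ j * dkern e j (fst z - y) * ?p z \<partial>?P \<partial>cellM)" for j
  proof -
    have "(\<integral>y. \<integral>x. v t y $ j * kern e (x - y) * v s2 x $ j \<partial>cellM \<partial>cellM) -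
      (\<integral>y. \<integral>x. v t y $ j * kern e (x - y) * v s1 x $ j \<partial>cellM \<partial>cellM) =
      (\<integral>y. (\<integral>x. v t y $ j * kern e (x - y) * v s2 x $ j \<partial>cellM) -
         (\<integral>x. v t y $ j * kern e (x - y) * v s1 x $ j \<partial>cellM) \<partial>cellM)"
      using cc.integrable_fst[OF energy_pairing_integrable[OF st(1) t]]
        cc.integrable_fst[OF energy_pairing_integrable[OF st(2) t]]
      by (intro Bochner_Integration.integral_diff[symmetric]) auto
    also have "\<dots> = (\<integral>y. (\<Sum>i\<in>UNIV. \<integral>z. v t y $ j * dkern e i (fst z - y) * ?uu i j z \<partial>?P) +
        (\<integral>z. v t y $ j * dkern e j (fst z - y) * ?p z \<partial>?P) \<partial>cellM)"
    proof (rule Bochner_Integration.integral_cong[OF refl])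
      fix y
      have "(\<integral>x. v t y $ j * kern e (x - y) * v s2 x $ j \<partial>cellM) -
         (\<integral>x. v t y $ j * kern e (x - y) * v s1 x $ j \<partial>cellM) =
         v t y $ j * ((\<integral>x. v s2 x $ j * kern e (x - y) \<partial>cellM) - (\<integral>x. v s1 x $ j * kern e (x - y) \<partial>cellM))"
        by (simp add: mult.assoc mult.commute[of "kern e _"] right_diff_distrib)
      then show "(\<integral>x. v t y $ j * kern e (x - y) * v s2 x $ j \<partial>cellM) -
         (\<integral>x. v t y $ j * kern e (x - y) * v s1 x $ j \<partial>cellM) =
         (\<Sum>i\<in>UNIV. \<integral>z. v t y $ j * dkern e i (fst z - y) * ?uu i j z \<partial>?P) +
        (\<integral>z. v t y $ j * dkern e j (fst z - y) * ?p z \<partial>?P)"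
        unfolding M by (simp add: distrib_left sum_distrib_left mult.assoc)
    qed
    also have "\<dots> = (\<Sum>i\<in>UNIV. \<integral>y. \<integral>z. v t y $ j * dkern e i (fst z - y) * ?uu i j z \<partial>?P \<partial>cellM) +
        (\<integral>y. \<integral>z. v t y $ j * dkern e j (fst z - y) * ?p z \<partial>?P \<partial>cellM)"
      using Kint[OF uu] Kint[OF p] by (subst Bochner_Integration.integral_add) (auto simp: Bochner_Integration.integral_sum)
    finally show ?thesis
      using flux_component_integral(2)[OF e t, where a = s1 and b = s2 and j = j] s by simp
  qed
  have "energy_pairing e s2 t - energy_pairing e s1 t =
      (\<Sum>j\<in>UNIV. \<Sum>i\<in>UNIV. integral\<^sup>L (timeM s1 s2) (\<lambda>s. flux_component e i j s t)) +
      (\<Sum>j\<in>UNIV. \<integral>y. \<integral>z. v t y $ j * dkern e j (fst z - y) * ?p z \<partial>?P \<partial>cellM)"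
    unfolding energy_pairing_def sum_subtractf[symmetric] component sum.distrib ..
  also have "\<dots> = (\<Sum>j\<in>UNIV. \<Sum>i\<in>UNIV. integral\<^sup>L (timeM s1 s2) (\<lambda>s. flux_component e i j s t))"
    using pressure_drops_out[OF e t p] by simp
  also have "\<dots> = integral\<^sup>L (timeM s1 s2) (\<lambda>s. flux e s t)"
    unfolding flux_def using flux_component_integral(1)[OF e t] s
    by (simp add: Bochner_Integration.integral_sum)
  finally show ?thesis .
qed

lemma flux_integrable:
  assumes "0 < e" "t \<in> {0<..<T}" "0 \<le> a" "b \<le> T"
  shows "integrable (timeM a b) (\<lambda>s. flux e s t)"
  unfolding flux_def using assms
  by (intro Bochner_Integration.integrable_sum flux_component_integral(1)) auto

text \<open>One factor is moved from \<open>a\<close> to \<open>b\<close> at a time; symmetry turns the motion of the second factor into a motion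
of the first.\<close>
lemma energy_increment:
  assumes e: "0 < e" and s: "0 < a" "a < b" "b < T"
  shows "energy_pairing e b b - energy_pairing e a a =
    integral\<^sup>L (timeM a b) (\<lambda>s. flux e s a + flux e s b)"
proof -
  have ab: "a \<in> {0<..<T}" "b \<in> {0<..<T}" using s by auto
  have "energy_pairing e b b - energy_pairing e a a =
     (energy_pairing e b a - energy_pairing e a a) + (energy_pairing e b b - energy_pairing e a b)"
    using energy_pairing_sym[OF ab] by simp
  also have "\<dots> = integral\<^sup>L (timeM a b) (\<lambda>s. flux e s a) + integral\<^sup>L (timeM a b) (\<lambda>s. flux e s b)"
    using energy_pairing_increment[OF e s] ab by simp
  also have "\<dots> = integral\<^sup>L (timeM a b) (\<lambda>s. flux e s a + flux e s b)"
    using flux_integrable[OF e] ab s by (intro Bochner_Integration.integral_add[symmetric]) auto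
  finally show ?thesis .
qed

end


section \<open>Riemann sums along the diagonal\<close>

lemma integral_timeM_indicator:
  fixes f :: "real \<Rightarrow> real"
  assumes "a \<le> c" "d \<le> b"
  shows "integral\<^sup>L (timeM a b) (\<lambda>r. indicator {c<..<d} r * f r) = integral\<^sup>L (timeM c d) f"
  unfolding integral_timeM set_lebesgue_integral_def
  using assms by (intro Bochner_Integration.integral_cong) (auto simp: indicator_def)

text \<open>Summing the increments over a partition gives an integral of \<open>F r\<close> at the two nodes next to \<open>r\<close>. As the
partition is refined, continuity of \<open>F r\<close> and dominated convergence replace both nodes by \<open>r\<close> itself.\<close>
lemma diagonal_flux_bound:
  fixes E :: "real \<Rightarrow> real" and F :: "real \<Rightarrow> real \<Rightarrow> real"
  assumes ab: "a < b"
    and inc: "\<And>s t. a \<le> s \<Longrightarrow> s < t \<Longrightarrow> t \<le> b \<Longrightarrow>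
        E t - E s = integral\<^sup>L (timeM s t) (\<lambda>r. F r s + F r t)"
    and int: "\<And>t. t \<in> {a..b} \<Longrightarrow> integrable (timeM a b) (\<lambda>r. F r t)"
    and cont: "AE r in timeM a b. continuous_on {a..b} (F r)"
    and bd: "AE r in timeM a b. \<forall>t\<in>{a..b}. \<bar>F r t\<bar> \<le> B"
    and diag: "AE r in timeM a b. \<bar>F r r\<bar> \<le> H r"
    and H: "integrable (timeM a b) H"
  shows "\<bar>E b - E a\<bar> \<le> 2 * integral\<^sup>L (timeM a b) H"
proof -
  define \<tau> where "\<tau> N k = a + real k * ((b - a) / real (Suc N))" for N k
  have \<tau>0: "\<tau> N 0 = a" and \<tau>1: "\<tau> N (Suc N) = b" for N
    by (auto simp: \<tau>_def simp del: of_nat_Suc)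
  have \<tau>_Suc: "\<tau> N (Suc k) = \<tau> N k + (b - a) / real (Suc N)" for N k
    by (simp add: \<tau>_def distrib_right add_divide_distrib)
  have \<tau>_mono: "\<tau> N k \<le> \<tau> N l" if "k \<le> l" for N k l
    unfolding \<tau>_def using that ab by (intro add_left_mono mult_right_mono divide_nonneg_nonneg) auto
  have \<tau>_less: "\<tau> N k < \<tau> N (Suc k)" for N k
    using ab by (simp add: \<tau>_Suc)
  have \<tau>_mem: "\<tau> N k \<in> {a..b}" if "k \<le> Suc N" for N k
    using \<tau>_mono[of 0 k N] \<tau>_mono[OF that, of N] by (simp add: \<tau>0 \<tau>1)
  define D where "D N r = (\<Sum>k<Suc N. indicator {\<tau> N k<..<\<tau> N (Suc k)} r * (F r (\<tau> N k) + F r (\<tau> N (Suc k))))" for N r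
  have piece: "integrable (timeM a b) (\<lambda>r. indicator {\<tau> N k<..<\<tau> N (Suc k)} r * (F r (\<tau> N k) + F r (\<tau> N (Suc k))))"
    if "k < Suc N" for N k
  proof -
    have "integrable (timeM a b) (\<lambda>r. F r (\<tau> N k) + F r (\<tau> N (Suc k)))"
      using that by (intro Bochner_Integration.integrable_add int \<tau>_mem) auto
    then have "integrable lborel (\<lambda>r. indicator {\<tau> N k<..<\<tau> N (Suc k)} r *\<^sub>R (indicator {a<..<b} r *\<^sub>R (F r (\<tau> N k) + F r (\<tau> N (Suc k)))))"
      unfolding integrable_timeM_iff set_integrable_def by (rule integrable_mult_indicator[rotated]) simp
    then show ?thesis
      unfolding integrable_timeM_iff set_integrable_def by (simp add: mult.left_commute)
  qed
  have intD: "integral\<^sup>L (timeM a b) (D N) = E b - E a" for N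
  proof -
    have "integral\<^sup>L (timeM a b) (D N) =
        (\<Sum>k<Suc N. integral\<^sup>L (timeM a b) (\<lambda>r. indicator {\<tau> N k<..<\<tau> N (Suc k)} r * (F r (\<tau> N k) + F r (\<tau> N (Suc k)))))"
      unfolding D_def by (intro Bochner_Integration.integral_sum piece) auto
    also have "\<dots> = (\<Sum>k<Suc N. E (\<tau> N (Suc k)) - E (\<tau> N k))"
    proof (rule sum.cong[OF refl])
      fix k assume k: "k \<in> {..<Suc N}"
      then have *: "a \<le> \<tau> N k" "\<tau> N (Suc k) \<le> b"
        using \<tau>_mem[of k N] \<tau>_mem[of "Suc k" N] by auto
      show "integral\<^sup>L (timeM a b) (\<lambda>r. indicator {\<tau> N k<..<\<tau> N (Suc k)} r * (F r (\<tau> N k) + F r (\<tau> N (Suc k)))) =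
          E (\<tau> N (Suc k)) - E (\<tau> N k)"
        unfolding integral_timeM_indicator[OF *] using inc[OF *(1) \<tau>_less *(2)] by simp
    qed
    also have "\<dots> = E b - E a"
      using sum_lessThan_telescope[of "\<lambda>k. E (\<tau> N k)" "Suc N"] unfolding \<tau>0 \<tau>1 .
    finally show ?thesis .
  qed
  have Dval: "\<exists>k<Suc N. \<tau> N k < r \<and> r < \<tau> N (Suc k) \<and> D N r = F r (\<tau> N k) + F r (\<tau> N (Suc k))"
    if r: "r \<in> {a<..<b}" and nodes: "\<forall>N k. r \<noteq> \<tau> N k" for N r
  proof -
    define m where "m = (LEAST m. r < \<tau> N m)"
    have ex: "r < \<tau> N (Suc N)" using r by (simp add: \<tau>1)
    have m: "r < \<tau> N m" unfolding m_def by (rule LeastI[of "\<lambda>m. r < \<tau> N m", OF ex])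
    have "m \<le> Suc N" unfolding m_def by (rule Least_le) (rule ex)
    moreover have "m \<noteq> 0" using m r \<tau>0[of N] by (intro notI) auto
    ultimately obtain k where k: "m = Suc k" "k < Suc N" by (cases m) auto
    have "\<not> r < \<tau> N k" using not_less_Least[of k "\<lambda>m. r < \<tau> N m"] k(1) by (simp add: m_def)
    then have rk: "\<tau> N k < r" "r < \<tau> N (Suc k)"
      using nodes m k(1) by (auto simp: less_le not_less)
    have "indicator {\<tau> N l<..<\<tau> N (Suc l)} r * (F r (\<tau> N l) + F r (\<tau> N (Suc l))) =
        (if l = k then F r (\<tau> N k) + F r (\<tau> N (Suc k)) else 0)" for l
    proof -
      consider "l < k" | "l = k" | "k < l" by linarith
      then show ?thesis
      proof cases
        case 1
        then show ?thesis using rk \<tau>_mono[of "Suc l" k N] by (auto simp: indicator_def)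
      next
        case 3
        then show ?thesis using rk \<tau>_mono[of "Suc k" l N] by (auto simp: indicator_def)
      qed (use rk in auto)
    qed
    then have "D N r = (\<Sum>l<Suc N. if l = k then F r (\<tau> N k) + F r (\<tau> N (Suc k)) else 0)"
      unfolding D_def by simp
    also have "\<dots> = F r (\<tau> N k) + F r (\<tau> N (Suc k))" using k(2) by (subst sum.delta) auto
    finally show ?thesis using k(2) rk by blast
  qed
  have nodes: "AE r in timeM a b. \<forall>N k. r \<noteq> \<tau> N k"
  proof -
    have "AE r in lborel. \<forall>N k. r \<noteq> \<tau> N k"
      unfolding AE_all_countable using AE_lborel_singleton by blast
    then show ?thesis unfolding AE_timeM_iff by (auto elim: eventually_mono)
  qed
  have lim: "AE r in timeM a b. (\<lambda>N. D N r) \<longlonglongrightarrow> 2 * F r r"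
    using nodes cont AE_space
  proof eventually_elim
    case (elim r)
    then have r: "r \<in> {a<..<b}" by (simp add: space_timeM)
    show ?case
    proof (rule metric_LIMSEQ_I)
      fix \<epsilon> :: real assume "0 < \<epsilon>"
      then obtain \<delta> where \<delta>: "0 < \<delta>" "\<And>t. t \<in> {a..b} \<Longrightarrow> dist t r < \<delta> \<Longrightarrow> dist (F r t) (F r r) < \<epsilon> / 2"
        using elim(2)[unfolded continuous_on_iff, rule_format, of r "\<epsilon> / 2"] r by auto
      obtain n0 where n0: "\<And>N. n0 \<le> N \<Longrightarrow> (b - a) / real (Suc N) < \<delta>"
        using order_tendstoD(2)[OF LIMSEQ_Suc[OF lim_const_over_n[of "b - a"]] \<delta>(1)]
        by (auto simp: eventually_sequentially)
      show "\<exists>n0. \<forall>N\<ge>n0. dist (D N r) (2 * F r r) < \<epsilon>"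
      proof (intro exI allI impI)
        fix N assume N: "n0 \<le> N"
        obtain k where k: "k < Suc N" "\<tau> N k < r" "r < \<tau> N (Suc k)"
          "D N r = F r (\<tau> N k) + F r (\<tau> N (Suc k))"
          using Dval[OF r elim(1)] by blast
        have "dist (\<tau> N k) r < \<delta>" "dist (\<tau> N (Suc k)) r < \<delta>"
          using n0[OF N] k(2,3) \<tau>_Suc[of N k] by (auto simp: dist_real_def)
        then have "dist (F r (\<tau> N k)) (F r r) < \<epsilon> / 2" "dist (F r (\<tau> N (Suc k))) (F r r) < \<epsilon> / 2"
          using \<delta>(2)[OF \<tau>_mem[of k N]] \<delta>(2)[OF \<tau>_mem[of "Suc k" N]] k(1) by simp_all
        then show "dist (D N r) (2 * F r r) < \<epsilon>"
          unfolding k(4) dist_real_def by linarith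
      qed
    qed
  qed
  \<comment> \<open>The diagonal \<open>F r r\<close> is not known to be measurable in \<open>r\<close>; the pointwise limit of the step functions is,
    and it agrees with \<open>2 * F r r\<close> almost everywhere.\<close>
  define f where "f r = lim (\<lambda>N. D N r)" for r
  have Dm: "D N \<in> borel_measurable (timeM a b)" for N
    unfolding D_def by (intro borel_measurable_integrable Bochner_Integration.integrable_sum piece) auto
  have fm: "f \<in> borel_measurable (timeM a b)"
    unfolding f_def by (rule borel_measurable_lim_metric[OF Dm])
  have f_eq: "AE r in timeM a b. f r = 2 * F r r"
    using lim by eventually_elim (simp add: f_def limI)
  have Dbd: "AE r in timeM a b. norm (D N r) \<le> 2 * B" for N
    using nodes bd AE_space
  proof eventually_elim
    case (elim r)
    then have r: "r \<in> {a<..<b}" by (simp add: space_timeM)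
    obtain k where k: "k < Suc N" "D N r = F r (\<tau> N k) + F r (\<tau> N (Suc k))"
      using Dval[OF r elim(1)] by blast
    have "\<bar>F r (\<tau> N k)\<bar> \<le> B" "\<bar>F r (\<tau> N (Suc k))\<bar> \<le> B"
      using elim(2) \<tau>_mem[of k N] \<tau>_mem[of "Suc k" N] k(1) by auto
    then show ?case unfolding k(2) by simp
  qed
  have limf: "AE r in timeM a b. (\<lambda>N. D N r) \<longlonglongrightarrow> f r"
    using lim f_eq by eventually_elim simp
  have cB: "integrable (timeM a b) (\<lambda>_. 2 * B)" by simp
  have "(\<lambda>N. integral\<^sup>L (timeM a b) (D N)) \<longlonglongrightarrow> integral\<^sup>L (timeM a b) f"
    by (rule integral_dominated_convergence[OF fm Dm cB limf Dbd])
  then have eq: "E b - E a = integral\<^sup>L (timeM a b) f"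
    unfolding intD by (rule LIMSEQ_unique[OF tendsto_const])
  have fi: "integrable (timeM a b) f"
    by (rule integrable_dominated_convergence[OF fm Dm cB limf Dbd])
  have "\<bar>integral\<^sup>L (timeM a b) f\<bar> \<le> integral\<^sup>L (timeM a b) (\<lambda>r. \<bar>f r\<bar>)"
    by (rule integral_abs_bound)
  also have "\<dots> \<le> integral\<^sup>L (timeM a b) (\<lambda>r. 2 * H r)"
  proof (rule integral_mono_AE)
    show "AE r in timeM a b. \<bar>f r\<bar> \<le> 2 * H r"
      using f_eq diag by eventually_elim simp
  qed (use fi H in auto)
  finally show ?thesis unfolding eq by simp
qed


section \<open>The flux as a third-order expression\<close>

lemma integrable_cont_pair:
  fixes f :: "real ^ 'n \<Rightarrow> real ^ 'n \<Rightarrow> real"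
  assumes "continuous_on UNIV (\<lambda>z. f (fst z) (snd z))"
  shows "integrable (cellM \<Otimes>\<^sub>M cellM) (\<lambda>(y, x). f y x)"
  using integrable_continuous_cell_pair[OF assms] by (simp add: split_beta')

lemma abs_dkern_integral:
  fixes i :: "'n::finite"
  shows "(\<integral>y. \<integral>x. \<bar>dkern e i (x - y)\<bar> \<partial>cellM \<partial>cellM) = torus_integral (\<lambda>x. \<bar>dkern e i x\<bar>)"
  by (simp add: abs_dkern_mass_shift measure_cellM)

text \<open>The identity of Duchon and Robert: the third-order quantity
\<open>S = \<Sum>\<^sub>i dkern e i (x - y) (w x - w y)\<^sub>i |w x - w y|\<^sup>2\<close> integrates to \<open>-4\<close> times the flux. Mean zero of the
kernel gradient and orthogonality of \<open>w\<close> to gradients remove all other terms of its expansion.\<close>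
lemma third_order_flux_bound:
  fixes w :: "real ^ 'n \<Rightarrow> real ^ 'n"
  assumes e: "0 < e" and w: "continuous_on UNIV w"
    and osc: "\<And>x y. cosdist (x - y) < e\<^sup>2 \<Longrightarrow> norm (w x - w y) \<le> \<delta>"
    and orth: "\<And>y. integral\<^sup>L cellM (\<lambda>x. \<Sum>i\<in>UNIV. w x $ i * dkern e i (x - y)) = 0"
  shows "\<bar>\<Sum>j\<in>UNIV. \<Sum>i\<in>UNIV. \<integral>y. \<integral>x. w y $ j * dkern e i (x - y) * (w x $ i * w x $ j) \<partial>cellM \<partial>cellM\<bar>
    \<le> \<delta> ^ 3 * (\<Sum>i\<in>UNIV. torus_integral (\<lambda>x::real^'n. \<bar>dkern e i x\<bar>))"
proof -
  define I where "I f = (\<integral>y. \<integral>x. f y x \<partial>cellM \<partial>cellM)" for f :: "real ^ 'n \<Rightarrow> real ^ 'n \<Rightarrow> real"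
  define C where "C f \<longleftrightarrow> continuous_on UNIV (\<lambda>z. f (fst z) (snd z))" for f :: "real ^ 'n \<Rightarrow> real ^ 'n \<Rightarrow> real"
  have I_eq: "I f = integral\<^sup>L (cellM \<Otimes>\<^sub>M cellM) (\<lambda>(y, x). f y x)" if "C f" for f
    unfolding I_def using that cc.integral_fst[OF integrable_cont_pair] by (simp add: C_def)
  have I_swap: "I f = (\<integral>x. \<integral>y. f y x \<partial>cellM \<partial>cellM)" if "C f" for f
    unfolding I_def using that[unfolded C_def] by (rule cc.Fubini_integral[OF integrable_cont_pair, symmetric])
  have I_add: "I (\<lambda>y x. f y x + g y x) = I f + I g" if "C f" "C g" for f g
  proof -
    have "C (\<lambda>y x. f y x + g y x)" using that unfolding C_def by (intro continuous_intros)
    then show ?thesis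
      using that integrable_cont_pair[of f] integrable_cont_pair[of g]
      unfolding I_eq[OF that(1)] I_eq[OF that(2)] I_eq[OF \<open>C (\<lambda>y x. f y x + g y x)\<close>] C_def
      by (simp add: split_beta')
  qed
  have I_cmult: "I (\<lambda>y x. c * f y x) = c * I f" for c f by (simp add: I_def)
  have I_sum: "I (\<lambda>y x. \<Sum>i\<in>S. f i y x) = (\<Sum>i\<in>S. I (f i))" if "finite S" "\<And>i. C (f i)" for S and f :: "'n \<Rightarrow> _"
    using that(1)
  proof (induction S)
    case (insert i S)
    have "C (\<lambda>y x. \<Sum>i\<in>S. f i y x)" using that(2) unfolding C_def by (intro continuous_intros)
    then show ?case using insert that(2) by (simp add: I_add)
  qed (simp add: I_def)
  have I_mono: "\<bar>I f\<bar> \<le> I g" if "C f" "C g" "\<And>y x. \<bar>f y x\<bar> \<le> g y x" for f g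
  proof -
    have "\<bar>I f\<bar> \<le> integral\<^sup>L (cellM \<Otimes>\<^sub>M cellM) (\<lambda>z. \<bar>case z of (y, x) \<Rightarrow> f y x\<bar>)"
      unfolding I_eq[OF that(1)] by (rule integral_abs_bound)
    also have "\<dots> \<le> I g"
      unfolding I_eq[OF that(2)] using that integrable_cont_pair[of f] integrable_cont_pair[of g]
      by (intro Bochner_Integration.integral_mono) (auto simp: C_def)
    finally show ?thesis .
  qed
  have wc [continuous_intros]: "continuous_on S (\<lambda>z. w (f z))" if "continuous_on S f" for f and S :: "((real^'n)\<times>(real^'n)) set"
    using continuous_on_compose2[OF w that] by simp
  define Q where "Q y x = (norm (w x - w y))\<^sup>2" for y x
  have Q_sym: "Q x y = Q y x" for x y by (simp add: Q_def norm_minus_commute)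
  define S where "S y x = (\<Sum>i\<in>UNIV. dkern e i (x - y) * (w x - w y) $ i * Q y x)" for y x
  have CS: "C S" unfolding C_def S_def Q_def by (intro continuous_intros)
  \<comment> \<open>The two halves of \<open>S\<close>, with \<open>w x\<close> and with \<open>w y\<close> in place of \<open>w x - w y\<close>, are exchanged up to sign by
    swapping \<open>x\<close> and \<open>y\<close>, because the gradient of an even kernel is odd.\<close>
  define a where "a y x = (\<Sum>i\<in>UNIV. dkern e i (x - y) * w x $ i * Q y x)" for y x
  define b where "b y x = (\<Sum>i\<in>UNIV. dkern e i (x - y) * w y $ i * Q y x)" for y x
  have Ca: "C a" and Cb: "C b" unfolding C_def a_def b_def Q_def by (intro continuous_intros)+
  have "b y x = - a x y" for y x
    unfolding a_def b_def sum_negf[symmetric]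
    using dkern_odd[of e _ y x] Q_sym[of x y] by (intro sum.cong) simp_all
  then have b_eq: "b = (\<lambda>y x. - a x y)" by (intro ext)
  have "I b = - (\<integral>y. \<integral>x. a x y \<partial>cellM \<partial>cellM)" unfolding I_def b_eq by simp
  then have Ib: "I b = - I a" using I_swap[OF Ca] by simp
  have "S y x = a y x + (-1) * b y x" for y x
    unfolding S_def a_def b_def sum_distrib_left sum.distrib[symmetric]
    by (intro sum.cong) (simp_all add: algebra_simps)
  then have "S = (\<lambda>y x. a y x + (-1) * b y x)" by (intro ext)
  then have "I S = I (\<lambda>y x. a y x + (-1) * b y x)" by (rule arg_cong)
  also have "\<dots> = I a + (-1) * I b"
    using Ca Cb unfolding I_cmult[symmetric]
    by (intro I_add) (auto simp: C_def intro!: continuous_intros)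
  finally have IS: "I S = 2 * I a" using Ib by simp

  \<comment> \<open>The terms of \<open>|w x|\<^sup>2 - 2 (w x \<bullet> w y) + |w y|\<^sup>2\<close>: the first integrates to zero because the gradient of the
    kernel has mean zero in \<open>y\<close>, the third because \<open>w\<close> is orthogonal to gradients in \<open>x\<close>.\<close>
  define f1 where "f1 y x = (\<Sum>i\<in>UNIV. dkern e i (x - y) * (w x $ i * (norm (w x))\<^sup>2))" for y x
  define f2 where "f2 y x = (\<Sum>j\<in>UNIV. \<Sum>i\<in>UNIV. w y $ j * dkern e i (x - y) * (w x $ i * w x $ j))" for y x
  define f3 where "f3 y x = (\<Sum>i\<in>UNIV. w x $ i * dkern e i (x - y)) * (norm (w y))\<^sup>2" for y x
  have Cf: "C f1" "C f2" "C f3" unfolding C_def f1_def f2_def f3_def by (intro continuous_intros)+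
  have "a y x = f1 y x + ((-2) * f2 y x + f3 y x)" for y x
  proof -
    have Q_exp: "Q y x = (norm (w x))\<^sup>2 - 2 * (w x \<bullet> w y) + (norm (w y))\<^sup>2"
      unfolding Q_def power2_norm_eq_inner by (simp add: algebra_simps inner_commute)
    define \<sigma> where "\<sigma> = (\<Sum>i\<in>UNIV. dkern e i (x - y) * w x $ i)"
    have "a y x = \<sigma> * Q y x" by (simp add: a_def \<sigma>_def sum_distrib_right)
    moreover have "f1 y x = \<sigma> * (norm (w x))\<^sup>2"
      by (simp add: f1_def \<sigma>_def sum_distrib_right mult.assoc)
    moreover have "f2 y x = \<sigma> * (w x \<bullet> w y)"
      unfolding f2_def \<sigma>_def inner_vec_def sum_product
      by (subst sum.swap) (intro sum.cong refl, simp add: mult_ac)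
    moreover have "f3 y x = \<sigma> * (norm (w y))\<^sup>2"
      by (simp add: f3_def \<sigma>_def mult.commute)
    ultimately show ?thesis unfolding Q_exp by (simp add: algebra_simps)
  qed
  then have "a = (\<lambda>y x. f1 y x + ((-2) * f2 y x + f3 y x))" by (intro ext)
  then have "I a = I (\<lambda>y x. f1 y x + ((-2) * f2 y x + f3 y x))" by (rule arg_cong)
  also have "\<dots> = I f1 + I (\<lambda>y x. (-2) * f2 y x + f3 y x)"
    using Cf by (intro I_add) (auto simp: C_def intro!: continuous_intros)
  also have "I (\<lambda>y x. (-2) * f2 y x + f3 y x) = (-2) * I f2 + I f3"
    using Cf unfolding I_cmult[symmetric] by (intro I_add) (auto simp: C_def intro!: continuous_intros)
  also have "I f3 = 0"
    unfolding I_def f3_def using orth by simp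
  also have "I f1 = 0"
  proof -
    have "I f1 = (\<Sum>i\<in>UNIV. I (\<lambda>y x. dkern e i (x - y) * (w x $ i * (norm (w x))\<^sup>2)))"
      unfolding f1_def by (rule I_sum) (auto simp: C_def intro!: continuous_intros)
    also have "\<dots> = (\<Sum>i\<in>(UNIV :: 'n set). 0)"
    proof (rule sum.cong[OF refl])
      fix i
      have "I (\<lambda>y x. dkern e i (x - y) * (w x $ i * (norm (w x))\<^sup>2)) =
          (\<integral>x. \<integral>y. dkern e i (x - y) * (w x $ i * (norm (w x))\<^sup>2) \<partial>cellM \<partial>cellM)"
        by (rule I_swap) (auto simp: C_def intro!: continuous_intros)
      then show "I (\<lambda>y x. dkern e i (x - y) * (w x $ i * (norm (w x))\<^sup>2)) = 0"
        by (simp add: dkern_mass_zero)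
    qed
    finally show ?thesis by simp
  qed
  finally have Ia: "I a = - 2 * I f2" by simp
  have If2: "I f2 = (\<Sum>j\<in>UNIV. \<Sum>i\<in>UNIV. \<integral>y. \<integral>x. w y $ j * dkern e i (x - y) * (w x $ i * w x $ j) \<partial>cellM \<partial>cellM)"
  proof -
    have "I f2 = (\<Sum>j\<in>UNIV. I (\<lambda>y x. \<Sum>i\<in>UNIV. w y $ j * dkern e i (x - y) * (w x $ i * w x $ j)))"
      unfolding f2_def by (rule I_sum) (auto simp: C_def intro!: continuous_intros)
    also have "\<dots> = (\<Sum>j\<in>UNIV. \<Sum>i\<in>UNIV. I (\<lambda>y x. w y $ j * dkern e i (x - y) * (w x $ i * w x $ j)))"
      by (intro sum.cong refl I_sum) (auto simp: C_def intro!: continuous_intros)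
    finally show ?thesis by (simp add: I_def)
  qed

  have \<delta>: "0 \<le> \<delta>"
    using osc[of 0 0] e by (simp add: cosdist_def)
  have "\<bar>S y x\<bar> \<le> (\<Sum>i\<in>UNIV. \<delta> ^ 3 * \<bar>dkern e i (x - y)\<bar>)" for y x
  proof -
    have "\<bar>S y x\<bar> \<le> (\<Sum>i\<in>UNIV. \<bar>dkern e i (x - y) * (w x - w y) $ i * Q y x\<bar>)"
      unfolding S_def by (rule sum_abs)
    also have "\<dots> \<le> (\<Sum>i\<in>UNIV. \<delta> ^ 3 * \<bar>dkern e i (x - y)\<bar>)"
    proof (rule sum_mono)
      fix i
      show "\<bar>dkern e i (x - y) * (w x - w y) $ i * Q y x\<bar> \<le> \<delta> ^ 3 * \<bar>dkern e i (x - y)\<bar>"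
      proof (cases "cosdist (x - y) < e\<^sup>2")
        case True
        note o = osc[OF True]
        have "\<bar>(w x - w y) $ i\<bar> \<le> \<delta>"
          using component_le_norm_cart[of "w x - w y" i] o by linarith
        moreover have "\<bar>Q y x\<bar> \<le> \<delta>\<^sup>2" unfolding Q_def using o by (simp add: power_mono)
        ultimately have "\<bar>(w x - w y) $ i\<bar> * \<bar>Q y x\<bar> \<le> \<delta> * \<delta>\<^sup>2"
          using \<delta> by (intro mult_mono) auto
        then have "\<bar>dkern e i (x - y)\<bar> * (\<bar>(w x - w y) $ i\<bar> * \<bar>Q y x\<bar>) \<le> \<bar>dkern e i (x - y)\<bar> * \<delta> ^ 3"
          by (intro mult_left_mono) (auto simp: power3_eq_cube power2_eq_square)
        then show ?thesis by (simp add: abs_mult mult_ac)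
      qed (use dkern_eq_0[OF e, of "x - y" i] \<delta> in \<open>simp add: not_less\<close>)
    qed
    finally show ?thesis .
  qed
  then have "\<bar>I S\<bar> \<le> I (\<lambda>y x. \<Sum>i\<in>UNIV. \<delta> ^ 3 * \<bar>dkern e i (x - y)\<bar>)"
    by (intro I_mono CS) (auto simp: C_def intro!: continuous_intros)
  also have "\<dots> = (\<Sum>i\<in>UNIV. I (\<lambda>y x. \<delta> ^ 3 * \<bar>dkern e i (x - y)\<bar>))"
    by (rule I_sum) (auto simp: C_def intro!: continuous_intros)
  also have "\<dots> = \<delta> ^ 3 * (\<Sum>i\<in>UNIV. torus_integral (\<lambda>x::real^'n. \<bar>dkern e i x\<bar>))"
    unfolding I_cmult sum_distrib_left by (simp add: I_def abs_dkern_integral)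
  finally have "\<bar>I S\<bar> \<le> \<delta> ^ 3 * (\<Sum>i\<in>UNIV. torus_integral (\<lambda>x::real^'n. \<bar>dkern e i x\<bar>))" .
  moreover have "I S = - 4 * I f2" using IS Ia by simp
  ultimately show ?thesis unfolding If2[symmetric] by simp
qed

text \<open>On the support of the kernel \<open>w y \<bullet> w x\<close> differs from \<open>|w y|\<^sup>2\<close> by at most \<open>B \<delta>\<close>.\<close>
lemma mollified_energy_lower:
  fixes w :: "real ^ 'n \<Rightarrow> real ^ 'm"
  assumes e: "0 < e" and w: "continuous_on UNIV w"
    and osc: "\<And>x y. cosdist (x - y) < e\<^sup>2 \<Longrightarrow> norm (w x - w y) \<le> \<delta>"
    and B: "\<And>x. norm (w x) \<le> B"
  shows "torus_integral (kern e :: real ^ 'n \<Rightarrow> real) * (integral\<^sup>L cellM (\<lambda>x. (norm (w x))\<^sup>2) - B * \<delta>) \<le>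
    (\<Sum>j\<in>UNIV. \<integral>y. \<integral>x. w y $ j * kern e (x - y) * w x $ j \<partial>cellM \<partial>cellM)"
proof -
  define A where "A = torus_integral (kern e :: real ^ 'n \<Rightarrow> real)"
  have wc [continuous_intros]: "continuous_on S (\<lambda>z. w (f z))" if "continuous_on S f" for f and S :: "((real^'n)\<times>(real^'n)) set"
    using continuous_on_compose2[OF w that] by simp
  have B0: "0 \<le> B" using B[of 0] norm_ge_zero order_trans by blast
  have \<delta>: "0 \<le> \<delta>"
    using osc[of 0 0] e by (simp add: cosdist_def)
  have i1: "integrable (cellM \<Otimes>\<^sub>M cellM) (\<lambda>(y, x). kern e (x - y) * ((norm (w y))\<^sup>2 - B * \<delta>))"
    by (rule integrable_cont_pair) (intro continuous_intros)
  have i2: "integrable (cellM \<Otimes>\<^sub>M cellM) (\<lambda>(y, x). \<Sum>j\<in>UNIV. w y $ j * kern e (x - y) * w x $ j)"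
    by (rule integrable_cont_pair) (intro continuous_intros)
  have i3: "integrable (cellM \<Otimes>\<^sub>M cellM) (\<lambda>(y, x). w y $ j * kern e (x - y) * w x $ j)" for j
    by (rule integrable_cont_pair) (intro continuous_intros)
  have w2: "integrable cellM (\<lambda>x. (norm (w x))\<^sup>2)"
    by (intro integrable_continuous_cellM continuous_intros w)
  have "(\<integral>y. \<integral>x. kern e (x - y) * ((norm (w y))\<^sup>2 - B * \<delta>) \<partial>cellM \<partial>cellM) \<le>
      (\<integral>y. \<integral>x. (\<Sum>j\<in>UNIV. w y $ j * kern e (x - y) * w x $ j) \<partial>cellM \<partial>cellM)"
    unfolding cc.integral_fst[OF i1] cc.integral_fst[OF i2]
  proof (rule Bochner_Integration.integral_mono[OF i1 i2], clarify)
    fix y x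
    have "(\<Sum>j\<in>UNIV. w y $ j * kern e (x - y) * w x $ j) = kern e (x - y) * (w y \<bullet> w x)"
      by (simp add: inner_vec_def sum_distrib_left mult_ac)
    also have "\<dots> \<ge> kern e (x - y) * ((norm (w y))\<^sup>2 - B * \<delta>)"
    proof (cases "cosdist (x - y) < e\<^sup>2")
      case True
      have "\<bar>w y \<bullet> (w x - w y)\<bar> \<le> norm (w y) * norm (w x - w y)" by (rule Cauchy_Schwarz_ineq2)
      also have "\<dots> \<le> B * \<delta>" using B[of y] osc[OF True] B0 by (intro mult_mono) auto
      finally have "(norm (w y))\<^sup>2 - B * \<delta> \<le> w y \<bullet> w x"
        by (simp add: inner_diff_right power2_norm_eq_inner)
      then show ?thesis by (intro mult_left_mono kern_nonneg)
    qed (use kern_eq_0[OF e, of "x - y"] in \<open>simp add: not_less\<close>)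
    finally show "kern e (x - y) * ((norm (w y))\<^sup>2 - B * \<delta>) \<le> (\<Sum>j\<in>UNIV. w y $ j * kern e (x - y) * w x $ j)" .
  qed
  also have "(\<integral>y. \<integral>x. kern e (x - y) * ((norm (w y))\<^sup>2 - B * \<delta>) \<partial>cellM \<partial>cellM) =
      A * (integral\<^sup>L cellM (\<lambda>x. (norm (w x))\<^sup>2) - B * \<delta>)"
    using w2 by (simp add: kern_mass_shift A_def measure_cellM)
  also have "(\<integral>y. \<integral>x. (\<Sum>j\<in>UNIV. w y $ j * kern e (x - y) * w x $ j) \<partial>cellM \<partial>cellM) =
      (\<Sum>j\<in>UNIV. \<integral>y. \<integral>x. w y $ j * kern e (x - y) * w x $ j \<partial>cellM \<partial>cellM)"
    unfolding cc.integral_fst[OF i2] cc.integral_fst[OF i3]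
    using i3 by (simp add: split_beta' Bochner_Integration.integral_sum)
  finally show ?thesis unfolding A_def .
qed

text \<open>Since \<open>2 f y \<bullet> f x \<le> |f y|\<^sup>2 + |f x|\<^sup>2\<close>, and the kernel has the same mass in either variable, no
regularity of \<open>f\<close> is involved.\<close>
lemma mollified_energy_upper:
  fixes f :: "real ^ 'n \<Rightarrow> real ^ 'm"
  assumes f: "f \<in> torus_L2"
  shows "(\<Sum>j\<in>UNIV. \<integral>y. \<integral>x. f y $ j * kern e (x - y) * f x $ j \<partial>cellM \<partial>cellM) \<le>
    torus_integral (kern e :: real ^ 'n \<Rightarrow> real) * integral\<^sup>L cellM (\<lambda>x. (norm (f x))\<^sup>2)"
proof -
  define A where "A = torus_integral (kern e :: real ^ 'n \<Rightarrow> real)"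
  have k1: "\<bar>kern e x\<bar> \<le> 1" for x :: "real ^ 'n" by (simp add: kern_nonneg kern_le_1)
  note int = integrable_kernel_pair[OF _ _ continuous_kern[OF continuous_on_id] k1]
  have i3: "integrable (cellM \<Otimes>\<^sub>M cellM) (\<lambda>(y, x). f y $ j * kern e (x - y) * f x $ j)" for j
    by (intro int torus_L2_integrable_component f)
  have N: "integrable cellM (\<lambda>x. (norm (f x))\<^sup>2)" by (rule torus_L2_dest(3)[OF f])
  have one: "integrable cellM (\<lambda>x. 1::real)" by simp
  have a1: "integrable (cellM \<Otimes>\<^sub>M cellM) (\<lambda>(y, x). (norm (f y))\<^sup>2 * kern e (x - y) * 1)"
    by (rule int[OF N one])
  have a2: "integrable (cellM \<Otimes>\<^sub>M cellM) (\<lambda>(y, x). 1 * kern e (x - y) * (norm (f x))\<^sup>2)"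
    by (rule int[OF one N])
  have "(\<Sum>j\<in>UNIV. \<integral>y. \<integral>x. f y $ j * kern e (x - y) * f x $ j \<partial>cellM \<partial>cellM) =
      integral\<^sup>L (cellM \<Otimes>\<^sub>M cellM) (\<lambda>z. \<Sum>j\<in>UNIV. case z of (y, x) \<Rightarrow> f y $ j * kern e (x - y) * f x $ j)"
    unfolding cc.integral_fst[OF i3] using i3 by (simp add: Bochner_Integration.integral_sum)
  also have "\<dots> \<le> integral\<^sup>L (cellM \<Otimes>\<^sub>M cellM) (\<lambda>z. 1 / 2 * ((case z of (y, x) \<Rightarrow> (norm (f y))\<^sup>2 * kern e (x - y) * 1) +
      (case z of (y, x) \<Rightarrow> 1 * kern e (x - y) * (norm (f x))\<^sup>2)))"
  proof (rule Bochner_Integration.integral_mono)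
    show "integrable (cellM \<Otimes>\<^sub>M cellM) (\<lambda>z. \<Sum>j\<in>UNIV. case z of (y, x) \<Rightarrow> f y $ j * kern e (x - y) * f x $ j)"
      using i3 by (intro Bochner_Integration.integrable_sum) auto
    show "integrable (cellM \<Otimes>\<^sub>M cellM) (\<lambda>z. 1 / 2 * ((case z of (y, x) \<Rightarrow> (norm (f y))\<^sup>2 * kern e (x - y) * 1) +
      (case z of (y, x) \<Rightarrow> 1 * kern e (x - y) * (norm (f x))\<^sup>2)))"
      using a1 a2 by (intro integrable_mult_right Bochner_Integration.integrable_add) auto
    fix z :: "(real ^ 'n) \<times> (real ^ 'n)"
    obtain y x where z: "z = (y, x)" by force
    have "(\<Sum>j\<in>UNIV. f y $ j * kern e (x - y) * f x $ j) = kern e (x - y) * (f y \<bullet> f x)"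
      by (simp add: inner_vec_def sum_distrib_left mult_ac)
    also have "\<dots> \<le> kern e (x - y) * (1 / 2 * ((norm (f y))\<^sup>2 + (norm (f x))\<^sup>2))"
    proof (intro mult_left_mono kern_nonneg)
      have "f y \<bullet> f x \<le> norm (f y) * norm (f x)" by (rule norm_cauchy_schwarz)
      then show "f y \<bullet> f x \<le> 1 / 2 * ((norm (f y))\<^sup>2 + (norm (f x))\<^sup>2)"
        using sum_squares_bound[of "norm (f y)" "norm (f x)"] by simp
    qed
    finally show "(\<Sum>j\<in>UNIV. case z of (y, x) \<Rightarrow> f y $ j * kern e (x - y) * f x $ j) \<le>
      1 / 2 * ((case z of (y, x) \<Rightarrow> (norm (f y))\<^sup>2 * kern e (x - y) * 1) +
      (case z of (y, x) \<Rightarrow> 1 * kern e (x - y) * (norm (f x))\<^sup>2))"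
      unfolding z by (simp add: algebra_simps)
  qed
  also have "\<dots> = 1 / 2 * (integral\<^sup>L (cellM \<Otimes>\<^sub>M cellM) (\<lambda>(y, x). (norm (f y))\<^sup>2 * kern e (x - y) * 1) +
      integral\<^sup>L (cellM \<Otimes>\<^sub>M cellM) (\<lambda>(y, x). 1 * kern e (x - y) * (norm (f x))\<^sup>2))"
    using a1 a2 by simp
  also have "integral\<^sup>L (cellM \<Otimes>\<^sub>M cellM) (\<lambda>(y, x). (norm (f y))\<^sup>2 * kern e (x - y) * 1) =
      A * integral\<^sup>L cellM (\<lambda>x. (norm (f x))\<^sup>2)"
    unfolding cc.integral_fst[OF a1, symmetric] by (simp add: kern_mass_shift A_def)
  also have "integral\<^sup>L (cellM \<Otimes>\<^sub>M cellM) (\<lambda>(y, x). 1 * kern e (x - y) * (norm (f x))\<^sup>2) =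
      A * integral\<^sup>L cellM (\<lambda>x. (norm (f x))\<^sup>2)"
    unfolding cc.integral_snd[OF a2, symmetric] by (simp add: kern_mass_shift A_def)
  finally show ?thesis unfolding A_def by simp
qed


section \<open>Regular times and the kinetic energy\<close>

lemma periodic_continuous_bounded:
  fixes w :: "real ^ 'n \<Rightarrow> 'b::real_normed_vector"
  assumes "periodic w" "continuous_on UNIV w"
  obtains B where "\<And>x. norm (w x) \<le> B"
proof -
  have "compact (w ` torus_cell)"
    using assms(2) compact_torus_cell by (intro compact_continuous_image continuous_on_subset[OF assms(2)]) auto
  then have "bounded (w ` torus_cell)" by (rule compact_imp_bounded)
  then obtain B where "\<forall>z\<in>w ` torus_cell. norm z \<le> B" unfolding bounded_iff by blast
  then have B: "norm (w x) \<le> B" if "x \<in> torus_cell" for x using that by blast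
  have "norm (w x) \<le> B" for x
  proof -
    let ?k = "(\<chi> i. - of_int \<lfloor>x $ i\<rfloor>) :: real ^ 'n"
    have "w (x + ?k) = w x" using assms(1) by (rule periodic_add_lattice) simp
    moreover have "0 \<le> x $ i + - of_int \<lfloor>x $ i\<rfloor> \<and> x $ i + - of_int \<lfloor>x $ i\<rfloor> \<le> 1" for i
      using floor_correct[of "x $ i"] by linarith
    then have "x + ?k \<in> torus_cell"
      unfolding mem_torus_cell by simp
    ultimately show ?thesis using B by metis
  qed
  then show ?thesis by (rule that)
qed

text \<open>Periodicity reduces two points whose difference is within \<open>e\<close> of the lattice to points at distance at most
\<open>e\<close>, and \<open>(ln (1 / r)) powr (- lam) * r powr \<alpha>\<close> increases with \<open>r\<close>. As \<open>e < 1\<close>, the exponent may be lowered to 1/3.\<close>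
lemma holog_oscillation:
  fixes w :: "real ^ 'n \<Rightarrow> 'b::real_normed_vector"
  assumes w: "w \<in> holog_space \<alpha> lam" and \<alpha>: "1 / 3 \<le> \<alpha>" and lam: "0 < lam" and e: "0 < e" "e < 1"
    and near: "cosdist (x - y) < e\<^sup>2"
  shows "norm (w x - w y) \<le> holog_norm \<alpha> lam w * (ln (1 / e) powr (- lam) * e powr (1 / 3))"
proof -
  have per: "periodic w" and cont: "continuous_on UNIV w"
    and bdd: "bdd_above (holog_quotient \<alpha> lam w ` near_pairs)"
    using w by (auto simp: holog_space_def)
  let ?K = "holog_seminorm \<alpha> lam w" and ?g = "\<lambda>r. ln (1 / r) powr (- lam) * r powr \<alpha>"
  have q: "holog_quotient \<alpha> lam w z \<le> ?K" if "z \<in> near_pairs" for z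
    unfolding holog_seminorm_def using bdd that by (rule cSUP_upper2) simp
  have K: "0 \<le> ?K"
  proof -
    obtain i :: 'n where True by simp
    have "(0, (1 / 2) *\<^sub>R axis i 1) \<in> (near_pairs :: ((real ^ 'n) \<times> (real ^ 'n)) set)"
      by (simp add: near_pairs_def)
    from q[OF this] show ?thesis
      by (rule order_trans[rotated]) (simp add: holog_quotient_def)
  qed
  obtain B where B: "\<And>x. norm (w x) \<le> B"
    using periodic_continuous_bounded[OF per cont] by metis
  have "0 \<le> norm (w 0)" by simp
  also have "\<dots> \<le> (SUP x. norm (w x))"
    using B by (intro cSUP_upper) (auto intro!: bdd_aboveI2)
  finally have Kn: "?K \<le> holog_norm \<alpha> lam w" by (simp add: holog_norm_def)
  obtain k where k: "\<And>i. k $ i \<in> \<int>" "norm (x - y - k) \<le> e"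
    using near_lattice[OF near e(1)] by blast
  have wk: "w x - w y = w x - w (y + k)" using periodic_add_lattice[OF per k(1)] by simp
  have mono: "?g r \<le> ln (1 / e) powr (- lam) * e powr (1 / 3)" if r: "0 < r" "r \<le> e" for r
  proof (rule mult_mono)
    have "0 < ln (1 / e)" using e by simp
    moreover have "ln (1 / e) \<le> ln (1 / r)" using r e by (simp add: frac_le)
    ultimately show "ln (1 / r) powr (- lam) \<le> ln (1 / e) powr (- lam)"
      using lam by (intro powr_mono2') auto
    have "r powr \<alpha> \<le> r powr (1 / 3)" using r e \<alpha> by (intro powr_mono') auto
    also have "\<dots> \<le> e powr (1 / 3)" using r by (intro powr_mono2) auto
    finally show "r powr \<alpha> \<le> e powr (1 / 3)" .
  qed auto
  show ?thesis
  proof (cases "x = y + k")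
    case True
    then show ?thesis using wk K Kn by simp
  next
    case False
    let ?r = "norm (x - (y + k))"
    have r: "0 < ?r" "?r \<le> e" using False k(2) by (auto simp: algebra_simps)
    then have "(x, y + k) \<in> near_pairs" using e by (simp add: near_pairs_def)
    from q[OF this] have "norm (w x - w (y + k)) / ?g ?r \<le> ?K"
      by (simp add: holog_quotient_def)
    moreover have "0 < ?g ?r" using r e by (intro mult_pos_pos) auto
    ultimately have "norm (w x - w (y + k)) \<le> ?K * ?g ?r"
      by (simp only: pos_divide_le_eq)
    also have "\<dots> \<le> holog_norm \<alpha> lam w * (ln (1 / e) powr (- lam) * e powr (1 / 3))"
      using K Kn by (intro mult_mono[OF Kn mono[OF r]]) auto
    finally show ?thesis using wk by simp
  qed
qed

context euler_solution
begin

definition energy :: "real \<Rightarrow> real" where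
  "energy t = integral\<^sup>L cellM (\<lambda>x. (norm (v t x))\<^sup>2)"

text \<open>Weak lower semicontinuity of the norm, tested with \<open>v t\<close> itself.\<close>
lemma energy_le_of_AE:
  assumes M: "AE s in timeM 0 T. energy s \<le> M" and t: "t \<in> {0<..<T}"
  shows "energy t \<le> M"
proof (rule ccontr)
  assume "\<not> ?thesis"
  then have big: "M < energy t" by simp
  \<comment> \<open>Continuous at \<open>s = t\<close> with value \<open>energy t\<close>, and at most \<open>(M + energy t) / 2\<close> at almost every \<open>s\<close>.\<close>
  define f where "f s = integral\<^sup>L cellM (\<lambda>x. v s x \<bullet> v t x)" for s
  have f_le: "f s \<le> (energy s + energy t) / 2" if "s \<in> {0<..<T}" for s
  proof -
    have "f s \<le> integral\<^sup>L cellM (\<lambda>x. ((norm (v s x))\<^sup>2 + (norm (v t x))\<^sup>2) / 2)"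
      unfolding f_def
    proof (rule Bochner_Integration.integral_mono)
      show "integrable cellM (\<lambda>x. v s x \<bullet> v t x)"
        by (rule torus_L2_integrable_inner[OF v_L2[OF that] v_L2[OF t]])
      show "integrable cellM (\<lambda>x. ((norm (v s x))\<^sup>2 + (norm (v t x))\<^sup>2) / 2)"
        using torus_L2_dest(3)[OF v_L2[OF that]] torus_L2_dest(3)[OF v_L2[OF t]] by simp
      show "v s x \<bullet> v t x \<le> ((norm (v s x))\<^sup>2 + (norm (v t x))\<^sup>2) / 2" for x
        using norm_cauchy_schwarz[of "v s x" "v t x"] sum_squares_bound[of "norm (v s x)" "norm (v t x)"]
        by simp
    qed
    also have "\<dots> = (energy s + energy t) / 2"
      using torus_L2_dest(3)[OF v_L2[OF that]] torus_L2_dest(3)[OF v_L2[OF t]] by (simp add: energy_def)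
    finally show ?thesis .
  qed
  have ft: "f t = energy t" by (simp add: f_def energy_def power2_norm_eq_inner)
  have "continuous_on {0<..<T} f" unfolding f_def by (rule v_weakly_continuous[OF v_L2[OF t]])
  then have "isCont f t" using t by (simp add: continuous_on_eq_continuous_at)
  then have "(f \<longlongrightarrow> f t) (nhds t)" by (simp add: isCont_def tendsto_at_iff_tendsto_nhds)
  then have "eventually (\<lambda>s. (M + energy t) / 2 < f s) (nhds t)"
    by (rule order_tendstoD(1)) (use big ft in simp)
  moreover have "eventually (\<lambda>s. s \<in> {0<..<T}) (nhds t)"
    using t by (intro eventually_nhds_in_open) auto
  ultimately have "eventually (\<lambda>s. (M + energy t) / 2 < f s \<and> s \<in> {0<..<T}) (nhds t)"
    by eventually_elim auto
  then obtain r where r: "0 < r" "\<And>s. dist s t < r \<Longrightarrow> (M + energy t) / 2 < f s \<and> s \<in> {0<..<T}"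
    unfolding eventually_nhds_metric by blast
  have "0 < t - r / 2 \<and> t - r / 2 < T" using r(2)[of "t - r / 2"] r(1) by (simp add: dist_real_def)
  then have "AE s in timeM (t - r / 2) t. energy s \<le> M"
    using t by (intro AE_timeM_subset[OF M]) auto
  then have "\<exists>s\<in>{t - r / 2<..<t}. energy s \<le> M"
    by (rule AE_timeM_ex[rotated]) (use r(1) in simp)
  then obtain s where s: "t - r / 2 < s" "s < t" "energy s \<le> M" by auto
  have "(M + energy t) / 2 < f s \<and> s \<in> {0<..<T}"
    using s r(1) by (intro r(2)) (simp add: dist_real_def)
  then show False using f_le[of s] s(3) by simp
qed

lemma energy_bounded: "\<exists>C. \<forall>t\<in>{0<..<T}. energy t \<le> C"
proof -
  obtain C where C: "AE t in timeM 0 T. u t \<in> torus_L2 \<and> integral\<^sup>L cellM (\<lambda>x. (norm (u t x))\<^sup>2) \<le> C"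
    using u_bound by blast
  have "AE t in timeM 0 T. energy t \<le> C"
    using C AE_v_eq_u AE_space
  proof eventually_elim
    case (elim t)
    then have t: "t \<in> {0<..<T}" by (simp add: space_timeM)
    have "energy t = integral\<^sup>L cellM (\<lambda>x. (norm (u t x))\<^sup>2)"
      unfolding energy_def
    proof (rule integral_cong_AE)
      show "(\<lambda>x. (norm (v t x))\<^sup>2) \<in> borel_measurable cellM" "(\<lambda>x. (norm (u t x))\<^sup>2) \<in> borel_measurable cellM"
        using torus_L2_dest(3)[OF v_L2[OF t]] torus_L2_dest(3)[of "u t"] elim(1) by auto
    qed (use elim(2) in \<open>auto elim: eventually_mono\<close>)
    then show ?case using elim(1) by simp
  qed
  then show ?thesis using energy_le_of_AE by blast
qed

lemma flux_component_eq:
  "flux_component e i j s t = (\<integral>y. v t y \<bullet> ((\<integral>x. dkern e i (x - y) * (u s x $ i * u s x $ j) \<partial>cellM) *\<^sub>R axis j 1) \<partial>cellM)"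
  unfolding flux_component_def
proof (rule Bochner_Integration.integral_cong[OF refl])
  fix y
  have "(\<integral>x. v t y $ j * dkern e i (x - y) * (u s x $ i * u s x $ j) \<partial>cellM) =
      v t y $ j * (\<integral>x. dkern e i (x - y) * (u s x $ i * u s x $ j) \<partial>cellM)"
    unfolding mult.assoc[of "v t y $ j"] by (rule integral_mult_right_zero)
  then show "(\<integral>x. v t y $ j * dkern e i (x - y) * (u s x $ i * u s x $ j) \<partial>cellM) =
      v t y \<bullet> ((\<integral>x. dkern e i (x - y) * (u s x $ i * u s x $ j) \<partial>cellM) *\<^sub>R axis j 1)"
    by (simp add: inner_axis)
qed

text \<open>The flux is the pairing of \<open>v t\<close> with a bounded field that depends on \<open>s\<close> alone, so weak continuity of \<open>v\<close>
applies; the bounds on the energy make the estimate uniform.\<close>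
lemma flux_continuous_and_bounded:
  assumes e: "0 < e"
  shows "\<exists>B. AE s in timeM 0 T. continuous_on {0<..<T} (flux e s) \<and> (\<forall>t\<in>{0<..<T}. \<bar>flux e s t\<bar> \<le> B)"
proof -
  obtain C where C: "AE t in timeM 0 T. u t \<in> torus_L2 \<and> integral\<^sup>L cellM (\<lambda>x. (norm (u t x))\<^sup>2) \<le> C"
    using u_bound by blast
  obtain C' where C': "\<And>t. t \<in> {0<..<T} \<Longrightarrow> energy t \<le> C'"
    using energy_bounded by blast
  define B where "B = (1 + C') * (32 / e * C)"
  have "AE s in timeM 0 T. \<forall>i j. integrable cellM (\<lambda>x. u s x $ i * u s x $ j)"
  proof -
    have "AE s in timeM 0 T. integrable cellM (\<lambda>x. u s x $ i * u s x $ j)" for i j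
      using ct.AE_integrable_snd[OF integrable_uu[of 0 T i j]] by simp
    then show ?thesis by (intro eventually_all_finite)
  qed
  then have "AE s in timeM 0 T. continuous_on {0<..<T} (flux e s) \<and>
      (\<forall>t\<in>{0<..<T}. \<bar>flux e s t\<bar> \<le> (\<Sum>j\<in>(UNIV::'n set). \<Sum>i\<in>(UNIV::'n set). B))"
    using C
  proof eventually_elim
    case (elim s)
    have uu: "integrable cellM (\<lambda>x. u s x $ i * u s x $ j)" for i j using elim(1) by simp
    let ?W = "\<lambda>i j y. (\<integral>x. dkern e i (x - y) * (u s x $ i * u s x $ j) \<partial>cellM)"
    note conv = cell_convolution_in_torus_L2[OF uu continuous_dkern[OF continuous_on_id] dkern_bound[OF e] periodic_dkern_shift']
    have cont: "continuous_on {0<..<T} (flux_component e i j s)" for i j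
      unfolding flux_component_eq[abs_def] by (rule v_weakly_continuous[OF conv(1)])
    have "(\<integral>x. \<bar>u s x $ i * u s x $ j\<bar> \<partial>cellM) \<le> C" for i j
    proof -
      have "(\<integral>x. \<bar>u s x $ i * u s x $ j\<bar> \<partial>cellM) \<le> integral\<^sup>L cellM (\<lambda>x. (norm (u s x))\<^sup>2)"
      proof (rule Bochner_Integration.integral_mono)
        show "\<bar>u s x $ i * u s x $ j\<bar> \<le> (norm (u s x))\<^sup>2" for x
          unfolding abs_mult power2_eq_square by (intro mult_mono component_le_norm_cart) auto
      qed (use uu elim(2) torus_L2_dest(3) in auto)
      then show ?thesis using elim(2) by simp
    qed
    then have "32 / e * (\<integral>x. \<bar>u s x $ i * u s x $ j\<bar> \<partial>cellM) \<le> 32 / e * C" for i j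
      using e by (intro mult_left_mono) auto
    with conv(2) have W: "\<bar>?W i j y\<bar> \<le> 32 / e * C" for i j y
      by (rule order_trans)
    have bd: "\<bar>flux_component e i j s t\<bar> \<le> B" if t: "t \<in> {0<..<T}" for i j t
    proof -
      have WC: "0 \<le> 32 / e * C" by (rule order_trans[OF abs_ge_zero W])
      have N: "integrable cellM (\<lambda>x. (norm (v t x))\<^sup>2)" by (rule torus_L2_dest(3)[OF v_L2[OF t]])
      have "\<bar>flux_component e i j s t\<bar> \<le> (\<integral>y. \<bar>v t y \<bullet> (?W i j y *\<^sub>R axis j 1)\<bar> \<partial>cellM)"
        unfolding flux_component_eq by (rule integral_abs_bound)
      also have "\<dots> \<le> (\<integral>y. (1 + (norm (v t y))\<^sup>2) * (32 / e * C) \<partial>cellM)"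
      proof (rule Bochner_Integration.integral_mono)
        show "integrable cellM (\<lambda>y. \<bar>v t y \<bullet> (?W i j y *\<^sub>R axis j 1)\<bar>)"
          by (intro integrable_abs torus_L2_integrable_inner v_L2 t conv(1))
        show "integrable cellM (\<lambda>y. (1 + (norm (v t y))\<^sup>2) * (32 / e * C))"
          using N by (intro integrable_mult_left Bochner_Integration.integrable_add) auto
        fix y
        have "\<bar>v t y $ j\<bar> \<le> norm (v t y)" by (rule component_le_norm_cart)
        also have "\<dots> \<le> 2 * norm (v t y)" by simp
        also have "\<dots> \<le> 1 + (norm (v t y))\<^sup>2"
          using sum_squares_bound[of 1 "norm (v t y)"] by simp
        finally have "\<bar>?W i j y\<bar> * \<bar>v t y $ j\<bar> \<le> (32 / e * C) * (1 + (norm (v t y))\<^sup>2)"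
          using W WC by (intro mult_mono) auto
        then show "\<bar>v t y \<bullet> (?W i j y *\<^sub>R axis j 1)\<bar> \<le> (1 + (norm (v t y))\<^sup>2) * (32 / e * C)"
          by (simp add: inner_axis abs_mult mult.commute)
      qed
      also have "\<dots> = (1 + energy t) * (32 / e * C)"
        using N by (simp add: energy_def measure_cellM)
      also have "\<dots> \<le> B"
        unfolding B_def using C'[OF t] WC by (intro mult_right_mono) auto
      finally show ?thesis .
    qed
    have "continuous_on {0<..<T} (flux e s)"
      unfolding flux_def[abs_def] by (intro continuous_intros cont)
    moreover have "\<bar>flux e s t\<bar> \<le> (\<Sum>j\<in>(UNIV::'n set). \<Sum>i\<in>(UNIV::'n set). B)" if "t \<in> {0<..<T}" for t
      unfolding flux_def using bd[OF that] by (intro order_trans[OF sum_abs] sum_mono)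
    ultimately show ?case by blast
  qed
  then show ?thesis by blast
qed

text \<open>At a time where \<open>u\<close> and \<open>v\<close> agree almost everywhere with a continuous field, diagonal quantities may be
computed from that field.\<close>
lemma diagonal_terms_of_representative:
  assumes s: "s \<in> {0<..<T}" and w: "continuous_on UNIV w"
    and vw: "AE x in cellM. v s x = w x" and uw: "AE x in cellM. u s x = w x" and uL: "u s \<in> torus_L2"
  shows "flux e s s = (\<Sum>j\<in>UNIV. \<Sum>i\<in>UNIV. \<integral>y. \<integral>x. w y $ j * dkern e i (x - y) * (w x $ i * w x $ j) \<partial>cellM \<partial>cellM)"
    and "energy_pairing e s s = (\<Sum>j\<in>UNIV. \<integral>y. \<integral>x. w y $ j * kern e (x - y) * w x $ j \<partial>cellM \<partial>cellM)"
    and "energy s = integral\<^sup>L cellM (\<lambda>x. (norm (w x))\<^sup>2)"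
proof -
  have vm: "v s \<in> borel_measurable cellM" by (rule measurable_cellM[OF torus_L2_dest(2)[OF v_L2[OF s]]])
  have um: "u s \<in> borel_measurable cellM" by (rule measurable_cellM[OF torus_L2_dest(2)[OF uL]])
  have wm: "w \<in> borel_measurable cellM" by (rule measurable_cellM[OF borel_measurable_continuous_onI[OF w]])
  have comp: "(\<lambda>x. f x $ j) \<in> borel_measurable cellM" if "f \<in> borel_measurable cellM"
    for f :: "real ^ 'n \<Rightarrow> real ^ 'n" and j
    using borel_measurable_continuous_on[OF continuous_on_component[OF continuous_on_id] that] by simp
  have km: "(\<lambda>x. \<kappa> (x - y)) \<in> borel_measurable cellM" if "continuous_on UNIV \<kappa>" for \<kappa> :: "real ^ 'n \<Rightarrow> real" and y
    using that by (intro measurable_cellM borel_measurable_continuous_onI continuous_on_compose2[OF that] continuous_intros) auto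
  have wi: "integrable cellM (\<lambda>x. w x $ j)" "integrable cellM (\<lambda>x. w x $ i * w x $ j)" for i j
    by (intro integrable_continuous_cellM continuous_intros w)+
  have general: "(\<integral>y. \<integral>x. v s y $ j * \<kappa> (x - y) * f x \<partial>cellM \<partial>cellM) =
      (\<integral>y. \<integral>x. w y $ j * \<kappa> (x - y) * g x \<partial>cellM \<partial>cellM)"
    if \<kappa>: "continuous_on UNIV \<kappa>" "\<And>x. \<bar>\<kappa> x\<bar> \<le> c" and f: "f \<in> borel_measurable cellM" and g: "integrable cellM g"
      and fg: "AE x in cellM. f x = g x" for \<kappa> f g j c
  proof -
    have "(\<integral>y. \<integral>x. v s y $ j * \<kappa> (x - y) * f x \<partial>cellM \<partial>cellM) =
        (\<integral>y. \<integral>x. v s y $ j * \<kappa> (x - y) * g x \<partial>cellM \<partial>cellM)"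
    proof (rule Bochner_Integration.integral_cong[OF refl], rule integral_cong_AE)
      fix y
      show "(\<lambda>x. v s y $ j * \<kappa> (x - y) * f x) \<in> borel_measurable cellM"
        by (intro borel_measurable_times borel_measurable_const km \<kappa>(1) f)
      show "(\<lambda>x. v s y $ j * \<kappa> (x - y) * g x) \<in> borel_measurable cellM"
        by (intro borel_measurable_times borel_measurable_const km \<kappa>(1) borel_measurable_integrable g)
      show "AE x in cellM. v s y $ j * \<kappa> (x - y) * f x = v s y $ j * \<kappa> (x - y) * g x"
        using fg by eventually_elim simp
    qed
    also have "\<dots> = (\<integral>y. \<integral>x. w y $ j * \<kappa> (x - y) * g x \<partial>cellM \<partial>cellM)"
    proof (rule integral_cong_AE)
      show "(\<lambda>y. \<integral>x. v s y $ j * \<kappa> (x - y) * g x \<partial>cellM) \<in> borel_measurable cellM"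
        using cc.integrable_fst[OF integrable_kernel_pair[OF v_component[OF s] g \<kappa>]] by (rule borel_measurable_integrable)
      show "(\<lambda>y. \<integral>x. w y $ j * \<kappa> (x - y) * g x \<partial>cellM) \<in> borel_measurable cellM"
        using cc.integrable_fst[OF integrable_kernel_pair[OF wi(1) g \<kappa>]] by (rule borel_measurable_integrable)
      show "AE y in cellM. (\<integral>x. v s y $ j * \<kappa> (x - y) * g x \<partial>cellM) = (\<integral>x. w y $ j * \<kappa> (x - y) * g x \<partial>cellM)"
        using vw by eventually_elim simp
    qed
    finally show ?thesis .
  qed
  show "energy_pairing e s s = (\<Sum>j\<in>UNIV. \<integral>y. \<integral>x. w y $ j * kern e (x - y) * w x $ j \<partial>cellM \<partial>cellM)"
    unfolding energy_pairing_def
  proof (rule sum.cong[OF refl], rule general[where c = 1])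
    show "\<bar>kern e x\<bar> \<le> 1" for x :: "real ^ 'n" by (simp add: kern_nonneg kern_le_1)
    show "AE x in cellM. v s x $ j = w x $ j" for j using vw by eventually_elim simp
  qed (intro continuous_kern continuous_on_id comp vm wi)+
  have bounded_dkern: "\<exists>c. \<forall>x::real^'n. \<bar>dkern e i x\<bar> \<le> c" for i
  proof -
    obtain c where "\<And>x::real^'n. norm (dkern e i x) \<le> c"
      using periodic_continuous_bounded[OF periodic_dkern continuous_dkern[OF continuous_on_id]] by metis
    then show ?thesis by auto
  qed
  show "flux e s s = (\<Sum>j\<in>UNIV. \<Sum>i\<in>UNIV. \<integral>y. \<integral>x. w y $ j * dkern e i (x - y) * (w x $ i * w x $ j) \<partial>cellM \<partial>cellM)"
    unfolding flux_def flux_component_def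
  proof (rule sum.cong[OF refl], rule sum.cong[OF refl])
    fix i j
    obtain c where c: "\<And>x::real^'n. \<bar>dkern e i x\<bar> \<le> c" using bounded_dkern by blast
    show "(\<integral>y. \<integral>x. v s y $ j * dkern e i (x - y) * (u s x $ i * u s x $ j) \<partial>cellM \<partial>cellM) =
        (\<integral>y. \<integral>x. w y $ j * dkern e i (x - y) * (w x $ i * w x $ j) \<partial>cellM \<partial>cellM)"
    proof (rule general[OF _ c])
      show "AE x in cellM. u s x $ i * u s x $ j = w x $ i * w x $ j" using uw by eventually_elim simp
    qed (intro continuous_dkern continuous_on_id borel_measurable_times comp um wi)+
  qed
  show "energy s = integral\<^sup>L cellM (\<lambda>x. (norm (w x))\<^sup>2)"
    unfolding energy_def
  proof (rule integral_cong_AE)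
    show "(\<lambda>x. (norm (v s x))\<^sup>2) \<in> borel_measurable cellM" "(\<lambda>x. (norm (w x))\<^sup>2) \<in> borel_measurable cellM"
      using vm wm by measurable
    show "AE x in cellM. (norm (v s x))\<^sup>2 = (norm (w x))\<^sup>2" using vw by eventually_elim simp
  qed
qed

end


section \<open>Conservation of energy\<close>

context euler_solution
begin

text \<open>With \<open>\<delta> = K (ln (1 / e)) powr (- lam) * e powr (1 / 3)\<close> the cube of the oscillation contains exactly one factor \<open>e\<close>,
which the gradient of the kernel consumes.\<close>
lemma mollified_energy_increment:
  fixes w :: "real \<Rightarrow> real ^ 'n \<Rightarrow> real ^ 'n"
  assumes \<alpha>: "1 / 3 \<le> \<alpha>" and lam: "0 < lam"
    and hol: "AE s in timeM 0 T. w s \<in> holog_space \<alpha> lam \<and> (AE x in cellM. u s x = w s x)"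
    and K3: "integrable (timeM 0 T) (\<lambda>s. holog_norm \<alpha> lam (w s) ^ 3)"
    and ab: "0 < a" "a < b" "b < T"
  shows "\<exists>\<Lambda>. \<forall>e. 0 < e \<longrightarrow> e < 1 \<longrightarrow>
    \<bar>energy_pairing e b b - energy_pairing e a a\<bar> \<le>
      torus_integral (kern e :: real ^ 'n \<Rightarrow> real) * ((ln (1 / e) powr (- lam)) ^ 3 * \<Lambda>)"
proof -
  obtain C where C: "0 < C" "\<And>e i. 0 < e \<Longrightarrow> e \<le> 1 \<Longrightarrow>
     torus_integral (\<lambda>x::real^'n. \<bar>dkern e i x\<bar>) \<le> C / e * torus_integral (kern e :: real ^ 'n \<Rightarrow> real)"
    using dkern_mass_le_kern_mass by blast
  obtain C' where C': "AE t in timeM 0 T. u t \<in> torus_L2 \<and> integral\<^sup>L cellM (\<lambda>x. (norm (u t x))\<^sup>2) \<le> C'"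
    using u_bound by blast
  let ?K = "\<lambda>s. holog_norm \<alpha> lam (w s)"
  have K3ab: "integrable (timeM a b) (\<lambda>s. ?K s ^ 3)"
    using K3 ab unfolding integrable_timeM_iff by (elim set_integrable_subset) auto
  show ?thesis
  proof (intro exI allI impI)
    fix e :: real
    assume e: "0 < e" "e < 1"
    define A where "A = torus_integral (kern e :: real ^ 'n \<Rightarrow> real)"
    define z where "z = ln (1 / e) powr (- lam)"
    define c where "c = z ^ 3 * (real CARD('n) * C * A)"
    obtain B where B: "AE s in timeM 0 T. continuous_on {0<..<T} (flux e s) \<and> (\<forall>t\<in>{0<..<T}. \<bar>flux e s t\<bar> \<le> B)"
      using flux_continuous_and_bounded[OF e(1)] by blast
    have Bab: "AE s in timeM a b. continuous_on {0<..<T} (flux e s) \<and> (\<forall>t\<in>{0<..<T}. \<bar>flux e s t\<bar> \<le> B)"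
      using AE_timeM_subset[OF B] ab by simp
    have "\<bar>energy_pairing e b b - energy_pairing e a a\<bar> \<le> 2 * integral\<^sup>L (timeM a b) (\<lambda>s. ?K s ^ 3 * c)"
    proof (rule diagonal_flux_bound[where E = "\<lambda>t. energy_pairing e t t" and F = "flux e" and B = B, OF ab(2)])
      show "energy_pairing e t t - energy_pairing e s s = integral\<^sup>L (timeM s t) (\<lambda>r. flux e r s + flux e r t)"
        if "a \<le> s" "s < t" "t \<le> b" for s t
        using that ab by (intro energy_increment e) auto
      show "integrable (timeM a b) (\<lambda>r. flux e r t)" if "t \<in> {a..b}" for t
        using that ab by (intro flux_integrable e) auto
      show "AE r in timeM a b. continuous_on {a..b} (flux e r)"
        using Bab by eventually_elim (use ab in \<open>auto elim: continuous_on_subset\<close>)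
      show "AE r in timeM a b. \<forall>t\<in>{a..b}. \<bar>flux e r t\<bar> \<le> B"
        using Bab by eventually_elim (use ab in auto)
      show "integrable (timeM a b) (\<lambda>s. ?K s ^ 3 * c)" using K3ab by simp
      have "AE s in timeM 0 T. \<bar>flux e s s\<bar> \<le> ?K s ^ 3 * c"
        using hol AE_v_eq_u C' AE_space
      proof eventually_elim
        case (elim s)
        then have s: "s \<in> {0<..<T}" by (simp add: space_timeM)
        have ws: "w s \<in> holog_space \<alpha> lam" and uw: "AE x in cellM. u s x = w s x" using elim(1) by auto
        have cont: "continuous_on UNIV (w s)" using ws by (simp add: holog_space_def)
        have vw: "AE x in cellM. v s x = w s x" using uw elim(2) by eventually_elim simp
        define \<delta> where "\<delta> = ?K s * (z * e powr (1 / 3))"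
        have osc: "norm (w s x - w s y) \<le> \<delta>" if "cosdist (x - y) < e\<^sup>2" for x y
          unfolding \<delta>_def z_def by (rule holog_oscillation[OF ws \<alpha> lam e that])
        have \<delta>: "0 \<le> \<delta>" using osc[of 0 0] e by (simp add: cosdist_def)
        have orth: "integral\<^sup>L cellM (\<lambda>x. \<Sum>i\<in>UNIV. w s x $ i * dkern e i (x - y)) = 0" for y
        proof -
          have "integral\<^sup>L cellM (\<lambda>x. \<Sum>i\<in>UNIV. w s x $ i * dkern e i (x - y)) =
              integral\<^sup>L cellM (\<lambda>x. \<Sum>i\<in>UNIV. v s x $ i * dkern e i (x - y))"
          proof (rule integral_cong_AE)
            show "(\<lambda>x. \<Sum>i\<in>UNIV. w s x $ i * dkern e i (x - y)) \<in> borel_measurable cellM"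
              by (intro measurable_cellM borel_measurable_continuous_onI continuous_intros cont)
            have "(\<lambda>x. v s x $ i) \<in> borel_measurable cellM" for i
              using v_component[OF s] by (rule borel_measurable_integrable)
            moreover have "(\<lambda>x. dkern e i (x - y)) \<in> borel_measurable cellM" for i
              by (intro measurable_cellM borel_measurable_continuous_onI continuous_intros)
            ultimately show "(\<lambda>x. \<Sum>i\<in>UNIV. v s x $ i * dkern e i (x - y)) \<in> borel_measurable cellM"
              by (intro borel_measurable_sum borel_measurable_times)
            show "AE x in cellM. (\<Sum>i\<in>UNIV. w s x $ i * dkern e i (x - y)) = (\<Sum>i\<in>UNIV. v s x $ i * dkern e i (x - y))"
              using vw by eventually_elim simp
          qed
          then show ?thesis
            using v_orthogonal_gradient[OF smooth_periodic_kern[OF e(1)] s, of y] by simp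
        qed
        have uL: "u s \<in> torus_L2" using elim(3) by simp
        have "\<bar>flux e s s\<bar> \<le> \<delta> ^ 3 * (\<Sum>i\<in>UNIV. torus_integral (\<lambda>x::real^'n. \<bar>dkern e i x\<bar>))"
          unfolding diagonal_terms_of_representative(1)[OF s cont vw uw uL]
          by (rule third_order_flux_bound[OF e(1) cont osc orth])
        also have "\<dots> \<le> \<delta> ^ 3 * (\<Sum>i\<in>(UNIV::'n set). C / e * A)"
          unfolding A_def using \<delta> e by (intro mult_left_mono sum_mono C) auto
        also have "\<dots> = ?K s ^ 3 * c"
        proof -
          have "(e powr (1 / 3)) ^ 3 = e" using e by (simp add: powr_power)
          then have "\<delta> ^ 3 = ?K s ^ 3 * z ^ 3 * e" by (simp add: \<delta>_def power_mult_distrib)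
          then show ?thesis using e by (simp add: c_def)
        qed
        finally show ?case .
      qed
      then show "AE r in timeM a b. \<bar>flux e r r\<bar> \<le> ?K r ^ 3 * c"
        using ab by (elim AE_timeM_subset) auto
    qed
    also have "\<dots> = A * (z ^ 3 * (2 * real CARD('n) * C * integral\<^sup>L (timeM a b) (\<lambda>s. ?K s ^ 3)))"
      by (simp add: c_def mult_ac)
    finally show "\<bar>energy_pairing e b b - energy_pairing e a a\<bar> \<le>
      torus_integral (kern e :: real ^ 'n \<Rightarrow> real) * ((ln (1 / e) powr (- lam)) ^ 3 *
        (2 * real CARD('n) * C * integral\<^sup>L (timeM a b) (\<lambda>s. ?K s ^ 3)))"
      unfolding A_def z_def .
  qed
qed

text \<open>At \<open>s\<close> the mollified energy approximates the energy from below up to a vanishing error, and at \<open>t\<close> it is at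
most the energy; the mollified energies at \<open>s\<close> and at \<open>t\<close> become equal in the limit. All errors
are bounded by multiples of powers of \<open>(ln (1 / e)) powr (- lam)\<close>.\<close>
lemma energy_minimal_at_regular_times:
  fixes w :: "real \<Rightarrow> real ^ 'n \<Rightarrow> real ^ 'n"
  assumes \<alpha>: "1 / 3 \<le> \<alpha>" and lam: "0 < lam"
    and hol: "AE s in timeM 0 T. w s \<in> holog_space \<alpha> lam \<and> (AE x in cellM. u s x = w s x)"
    and K3: "integrable (timeM 0 T) (\<lambda>s. holog_norm \<alpha> lam (w s) ^ 3)"
    and t: "t \<in> {0<..<T}"
  shows "AE s in timeM 0 T. energy s \<le> energy t"
proof -
  obtain C' where C': "AE t in timeM 0 T. u t \<in> torus_L2 \<and> integral\<^sup>L cellM (\<lambda>x. (norm (u t x))\<^sup>2) \<le> C'"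
    using u_bound by blast
  show ?thesis
    using hol AE_v_eq_u C' AE_space
  proof eventually_elim
    case (elim s)
    then have s: "s \<in> {0<..<T}" by (simp add: space_timeM)
    have ws: "w s \<in> holog_space \<alpha> lam" and uw: "AE x in cellM. u s x = w s x" using elim(1) by auto
    have cont: "continuous_on UNIV (w s)" and per: "periodic (w s)" using ws by (auto simp: holog_space_def)
    have vw: "AE x in cellM. v s x = w s x" using uw elim(2) by eventually_elim simp
    have uL: "u s \<in> torus_L2" using elim(3) by simp
    note diag = diagonal_terms_of_representative[OF s cont vw uw uL]
    obtain B where B: "\<And>x. norm (w s x) \<le> B"
      using periodic_continuous_bounded[OF per cont] by metis
    have B0: "0 \<le> B" using order_trans[OF norm_ge_zero B] .
    let ?K = "holog_norm \<alpha> lam (w s)"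
    have "\<exists>\<Lambda>. \<forall>e. 0 < e \<longrightarrow> e < 1 \<longrightarrow> \<bar>energy_pairing e s s - energy_pairing e t t\<bar> \<le>
      torus_integral (kern e :: real ^ 'n \<Rightarrow> real) * ((ln (1 / e) powr (- lam)) ^ 3 * \<Lambda>)"
    proof -
      consider "s = t" | "s < t" | "t < s" by linarith
      then show ?thesis
      proof cases
        case 1
        then show ?thesis by (intro exI[of _ 0]) simp
      next
        case 2
        then show ?thesis
          using mollified_energy_increment[OF \<alpha> lam hol K3, of s t] s t by (simp add: abs_minus_commute)
      next
        case 3
        then show ?thesis
          using mollified_energy_increment[OF \<alpha> lam hol K3, of t s] s t by simp
      qed
    qed
    then obtain \<Lambda> where \<Lambda>: "\<And>e. 0 < e \<Longrightarrow> e < 1 \<Longrightarrow> \<bar>energy_pairing e s s - energy_pairing e t t\<bar> \<le>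
      torus_integral (kern e :: real ^ 'n \<Rightarrow> real) * ((ln (1 / e) powr (- lam)) ^ 3 * \<Lambda>)"
      by blast
    define z where "z n = real (Suc n) powr (- lam)" for n
    have z0: "z \<longlonglongrightarrow> 0"
      unfolding z_def
      by (rule tendsto_neg_powr[OF _ filterlim_compose[OF filterlim_real_sequentially filterlim_Suc]])
        (use lam in simp)
    have main: "energy s \<le> energy t + (z n ^ 3 * \<Lambda> + B * (?K * z n))" for n
    proof -
      \<comment> \<open>At this scale \<open>ln (1 / e)\<close> is exactly \<open>n + 1\<close>.\<close>
      define e where "e = exp (- real (Suc n))"
      have e: "0 < e" "e < 1" by (auto simp: e_def)
      have lne: "ln (1 / e) powr (- lam) = z n"
        by (simp add: e_def z_def ln_div add.commute)
      define A where "A = torus_integral (kern e :: real ^ 'n \<Rightarrow> real)"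
      have A: "0 < A" unfolding A_def using e by (intro kern_mass_pos) auto
      define \<delta> where "\<delta> = ?K * (z n * e powr (1 / 3))"
      have osc: "norm (w s x - w s y) \<le> \<delta>" if "cosdist (x - y) < e\<^sup>2" for x y
        using holog_oscillation[OF ws \<alpha> lam e that] unfolding \<delta>_def lne .
      have \<delta>0: "0 \<le> \<delta>" using osc[of 0 0] e by (simp add: cosdist_def)
      have zp: "0 < z n" "0 < e powr (1 / 3)" using e by (auto simp: z_def)
      then have "0 < z n * e powr (1 / 3)" by (rule mult_pos_pos)
      then have K0: "0 \<le> ?K" using \<delta>0 unfolding \<delta>_def zero_le_mult_iff[of ?K] by linarith
      have "e powr (1 / 3) \<le> 1" using e powr_mono2[of "1 / 3" e 1] by simp
      then have \<delta>1: "\<delta> \<le> ?K * z n"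
        unfolding \<delta>_def using K0 zp mult_left_mono[of "e powr (1 / 3)" 1 "?K * z n"] by (simp add: mult.assoc)
      have "A * (energy s - B * \<delta>) \<le> energy_pairing e s s"
        using mollified_energy_lower[OF e(1) cont osc B] unfolding diag(2,3) A_def .
      also have "\<dots> \<le> energy_pairing e t t + A * (z n ^ 3 * \<Lambda>)"
        using \<Lambda>[OF e] unfolding lne A_def by linarith
      also have "energy_pairing e t t \<le> A * energy t"
        using mollified_energy_upper[OF v_L2[OF t], of e] unfolding energy_pairing_def energy_def A_def .
      finally have "A * (energy s - B * \<delta>) \<le> A * (energy t + z n ^ 3 * \<Lambda>)"
        by (simp add: distrib_left)
      then have "energy s - B * \<delta> \<le> energy t + z n ^ 3 * \<Lambda>"
        using A by (rule mult_left_le_imp_le)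
      moreover have "B * \<delta> \<le> B * (?K * z n)" using B0 \<delta>1 by (rule mult_left_mono[rotated])
      ultimately show ?thesis by linarith
    qed
    have "(\<lambda>n. energy t + (z n ^ 3 * \<Lambda> + B * (?K * z n))) \<longlonglongrightarrow> energy t + (0 ^ 3 * \<Lambda> + B * (?K * 0))"
      by (intro tendsto_intros z0)
    then have "(\<lambda>n. energy t + (z n ^ 3 * \<Lambda> + B * (?K * z n))) \<longlonglongrightarrow> energy t" by simp
    then show "energy s \<le> energy t"
      by (rule LIMSEQ_le_const) (use main in blast)
  qed
qed

lemma energy_conserved:
  assumes \<alpha>: "1 / 3 \<le> \<alpha>" and lam: "0 < lam" and u: "u \<in> Lq_holog 3 T \<alpha> lam"
    and t: "t1 \<in> {0<..<T}" "t2 \<in> {0<..<T}"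
  shows "energy t2 = energy t1"
proof -
  obtain w where w: "AE s\<in>{0<..<T} in lborel. w s \<in> holog_space \<alpha> lam \<and> (AE x in lborel. u s x = w s x)"
    and K: "set_integrable lborel {0<..<T} (\<lambda>s. holog_norm \<alpha> lam (w s) ^ 3)"
    using u unfolding Lq_holog_def by blast
  have hol: "AE s in timeM 0 T. w s \<in> holog_space \<alpha> lam \<and> (AE x in cellM. u s x = w s x)"
    unfolding AE_timeM_iff using w by eventually_elim (auto intro: AE_cellM)
  have K3: "integrable (timeM 0 T) (\<lambda>s. holog_norm \<alpha> lam (w s) ^ 3)"
    using K by (simp add: integrable_timeM_iff)
  have "energy r \<le> energy t" if "r \<in> {0<..<T}" "t \<in> {0<..<T}" for r t
    by (rule energy_le_of_AE[OF energy_minimal_at_regular_times[OF \<alpha> lam hol K3 that(2)] that(1)])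
  then show ?thesis using t by (intro antisym) auto
qed

end

theorem mainTheorem3:
  fixes T \<alpha> lam t1 t2 :: real
    and u v :: "real \<Rightarrow> real ^ 'n \<Rightarrow> real ^ 'n"
    and p :: "real \<Rightarrow> real ^ 'n \<Rightarrow> real"
  assumes "T > 0" and "1 / 3 \<le> \<alpha>" and "\<alpha> < 1" and "lam > 0"
    and "weak_euler_solution T u p"
    and "u \<in> Lq_holog 3 T \<alpha> lam"
    and "weakly_continuous_representative T u v"
    and "t1 \<in> {0<..<T}" and "t2 \<in> {0<..<T}"
  shows "torus_L2_norm (v t2) = torus_L2_norm (v t1)"
proof -
  interpret euler_solution T u v p
    using assms(1,5,7) by unfold_locales
  have "energy t2 = energy t1"
    by (rule energy_conserved[OF assms(2,4,6,8,9)])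
  then show ?thesis
    by (simp add: torus_L2_norm_def torus_integral_eq energy_def)
qed

end
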